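(* Let $m\ge n$ and let $(\hat p,\hat q)$ be any polynomial pair in $\mathcal{P}^k_{m,n}$. Then for every $\delta>0$ there is an $\eta>0$ such that, if $(p,q)\in\mathcal{P}_{m,n}$ and $\varepsilon>0$ satisfy $$\|(p,q)-(\hat p,\hat q)\|<\eta<\varepsilon<\theta_{k+1}(\hat p,\hat q)-\eta,$$ then there is a unique numerical GCD $\gcd_\varepsilon(p,q)=\gcd(\tilde p,\tilde q)$ with $(\tilde p,\tilde q)\in\mathcal{P}^k_{m,n}$ satisfying $\|(\tilde p,\tilde q)-(\hat p,\hat q)\|<\delta$. Moreover, Algorithm uvGCD applied to the input $(p,q)$, $\varepsilon$ generates a sequence of polynomial triplets $(u_j,v_j,w_j)$ satisfying $$\lim_{j\to\infty}u_j=u\in\gcd\nolimits_\varepsilon(p,q)\qquad\text{and}\qquad\lim_{j\to\infty}\|(u_jv_j,u_jw_j)-(\tilde p,\tilde q)\|=0.$$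
   Context: All polynomials are in $\mathbb{C}[x]$, one variable. $P_n$ is the vector space of polynomials of degree at most $n$; boldface $\mathbf p=[\rho_0;\dots;\rho_n]\in\mathbb{C}^{n+1}$ is the coefficient vector of $p=\rho_0+\cdots+\rho_nx^n\in P_n$ ("$;$" stacks column vectors); $\|p\|=\|\mathbf p\|$ is Euclidean, and $\|(p_1,\dots,p_l)\|=\sqrt{\|p_1\|^2+\cdots+\|p_l\|^2}$. $\mathcal{P}_{m,n}=\{(p,q) : \deg p=m,\ \deg q=n\}$. A GCD of $(p,q)$ is any polynomial of highest degree dividing both (not necessarily monic); $\gcd(p,q)$ is the set of all GCDs, one equivalence class for the relation $f\sim g\iff f=\alpha g$, $\alpha\neq0$ constant. $\mathcal{P}^k_{m,n}=\{(p,q)\in\mathcal{P}_{m,n} : \deg\gcd(p,q)=k\}$ and $\theta_k(p,q)=\inf\{\|(p,q)-(r,s)\| : (r,s)\in\mathcal{P}^k_{m,n}\}$ (with $\inf\emptyset=+\infty$). Numerical GCD: let $(p,q)\in\mathcal{P}_{m,n}$, $\varepsilon>0$, and $k=\max\{j : \theta_j(p,q)<\varepsilon\}$. A numerical GCD of $(p,q)$ within $\varepsilon$ is an exact GCD of a pair $(\tilde p,\tilde q)\in\mathcal{P}^k_{m,n}$ with $\|(\tilde p,\tilde q)-(p,q)\|=\theta_k(p,q)$; the $\sim$-class is $\gcd_\varepsilon(p,q)=\gcd(\tilde p,\tilde q)$, and uniqueness is that of the $\sim$-class. Matrices: for $f\in P_l$, $C_j(f)$ is the $(l+j+1)\times(j+1)$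 matrix of $P_j\to P_{l+j}$, $g\mapsto fg$, in monomial bases. For $1\le j\le n$, $S_j(p,q)=[\,C_{n-j}(p)\mid C_{m-j}(q)\,]$ is the $j$-th Sylvester matrix; $\sigma_{-1}(A)$ is the smallest singular value of $A$. For $\mathbf h\in\mathbb{C}^{k+1}$, $u\in P_k$, $v\in P_{m-k}$, $w\in P_{n-k}$, $$\mathbf f_{\mathbf h}(u,v,w)=\begin{bmatrix}\mathbf h^{\mathsf H}\mathbf u\\ C_k(v)\mathbf u\\ C_k(w)\mathbf u\end{bmatrix},\qquad J_{\mathbf h}(u,v,w)=\begin{bmatrix}\mathbf h^{\mathsf H}&0&0\\ C_k(v)&C_{m-k}(u)&0\\ C_k(w)&0&C_{n-k}(u)\end{bmatrix}.$$ $A^+=(A^{\mathsf H}A)^{-1}A^{\mathsf H}$ for injective $A$. Algorithm uvGCD. Input: $(p,q)\in\mathcal{P}_{m,n}$ with $m\ge n$, and $\varepsilon>0$. For $j=n,n-1,\dots,1$: compute $\sigma_{-1}(S_j(p,q))$ and a corresponding unit right singular vector $[\mathbf w_0;-\mathbf v_0]$ of $S_j(p,q)$, with $\mathbf w_0\in\mathbb{C}^{n-j+1}$, $\mathbf v_0\in\mathbb{C}^{m-j+1}$. If $\sigma_{-1}(S_j(p,q))<\varepsilon\sqrt{m-j+1}$, then: set $k=j$; take $v_0,w_0$ from the singular vector; let $u_0$ be the least squares solution of $\begin{bmatrix}C_j(v_0)\\C_j(w_0)\end{bmatrix}\mathbf u_0=\begin{bmatrix}\mathbf p\\\mathbf q\end{bmatrix}$;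 rescale $(u_0,v_0,w_0)$ to $(u_0/s,\,s v_0,\,s w_0)$ with $s=\|u_0\|$; put $\mathbf h=\mathbf u_0$ and $\beta=1$ (so $\mathbf h^{\mathsf H}\mathbf u_0=\beta$); and apply the Gauss–Newton iteration $$\begin{bmatrix}\mathbf u_{i+1}\\\mathbf v_{i+1}\\\mathbf w_{i+1}\end{bmatrix}=\begin{bmatrix}\mathbf u_i\\\mathbf v_i\\\mathbf w_i\end{bmatrix}-J_{\mathbf h}(u_i,v_i,w_i)^+\left(\mathbf f_{\mathbf h}(u_i,v_i,w_i)-\begin{bmatrix}\beta\\\mathbf p\\\mathbf q\end{bmatrix}\right),\quad i=0,1,\dots,$$ stopping when the residual $\|\mathbf f_{\mathbf h}(u_i,v_i,w_i)-[\beta;\mathbf p;\mathbf q]\|$ stops decreasing; let $\rho$ be the final residual; if $\rho<\varepsilon$ leave the loop. Output: the final triplet $(u,v,w)$ if $\rho<\varepsilon$, or the trivial triplet $(1,p,q)$ if no $j$ succeeds. In the theorem, computations are exact, and the generated sequence $(u_j,v_j,w_j)$ is the sequence of Gauss–Newton iterates for the degree $k$ of the numerical GCD, continued indefinitely (for $k=0$, the constant triplet $(1,p,q)$). *)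

theory Defs
  imports
    "HOL-Library.Extended_Real"
    "HOL-Computational_Algebra.Polynomial"
    "Jordan_Normal_Form.Matrix"
    "Jordan_Normal_Form.Gauss_Jordan_Elimination"
    "Jordan_Normal_Form.Char_Poly"
    "Jordan_Normal_Form.Schur_Decomposition"
begin

section \<open>Norms and coefficient vectors\<close>

definition euclid_norm :: "complex vec \<Rightarrow> real" where
  "euclid_norm x = sqrt (\<Sum>i<dim_vec x. (cmod (x $ i))\<^sup>2)"

definition coeff_vec :: "nat \<Rightarrow> complex poly \<Rightarrow> complex vec" where
  "coeff_vec l f = vec (l + 1) (coeff f)"

definition vec_poly :: "complex vec \<Rightarrow> complex poly" where
  "vec_poly x = Poly (list_of_vec x)"

text \<open>Padding a coefficient vector with zeros does not change its norm, so the norm of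
  a polynomial does not depend on the space of polynomials it is considered in.\<close>

definition poly_norm :: "complex poly \<Rightarrow> real" where
  "poly_norm p = euclid_norm (coeff_vec (degree p) p)"

definition pair_norm :: "complex poly \<Rightarrow> complex poly \<Rightarrow> real" where
  "pair_norm p q = sqrt ((poly_norm p)\<^sup>2 + (poly_norm q)\<^sup>2)"

section \<open>Exact and numerical greatest common divisors\<close>

text \<open>The zero polynomial is not a polynomial of degree 0 in the mathematical sense, so it is
  excluded explicitly.\<close>

definition poly_pairs :: "nat \<Rightarrow> nat \<Rightarrow> (complex poly \<times> complex poly) set" where
  "poly_pairs m n = {(p, q). p \<noteq> 0 \<and> q \<noteq> 0 \<and> degree p = m \<and> degree q = n}"

text \<open>Not normalised: for nonzero \<open>p\<close>, \<open>q\<close> this is a full class modulo nonzero constant factors.\<close>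

definition poly_gcds :: "complex poly \<Rightarrow> complex poly \<Rightarrow> complex poly set" where
  "poly_gcds p q = {g. g dvd p \<and> g dvd q \<and> (\<forall>d. d dvd p \<and> d dvd q \<longrightarrow> degree d \<le> degree g)}"

definition poly_pairs_gcd :: "nat \<Rightarrow> nat \<Rightarrow> nat \<Rightarrow> (complex poly \<times> complex poly) set" where
  "poly_pairs_gcd m n k = {(p, q) \<in> poly_pairs m n. \<exists>g\<in>poly_gcds p q. degree g = k}"

text \<open>Extended real, so that the infimum over the empty set is \<open>\<infinity>\<close>.\<close>

definition theta :: "nat \<Rightarrow> nat \<Rightarrow> nat \<Rightarrow> complex poly \<Rightarrow> complex poly \<Rightarrow> ereal" where
  "theta m n k p q = (INF (r, s)\<in>poly_pairs_gcd m n k. ereal (pair_norm (p - r) (q - s)))"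

definition num_gcd_degree :: "nat \<Rightarrow> nat \<Rightarrow> real \<Rightarrow> complex poly \<Rightarrow> complex poly \<Rightarrow> nat" where
  "num_gcd_degree m n \<epsilon> p q = Max {j. theta m n j p q < ereal \<epsilon>}"

definition num_gcd_pairs ::
  "nat \<Rightarrow> nat \<Rightarrow> real \<Rightarrow> complex poly \<Rightarrow> complex poly \<Rightarrow> (complex poly \<times> complex poly) set" where
  "num_gcd_pairs m n \<epsilon> p q =
     {(r, s) \<in> poly_pairs_gcd m n (num_gcd_degree m n \<epsilon> p q).
        ereal (pair_norm (r - p) (s - q)) = theta m n (num_gcd_degree m n \<epsilon> p q) p q}"

text \<open>The set of all classes that are a numerical GCD of \<open>(p, q)\<close> within \<open>\<epsilon>\<close>; the numerical GCD
  exists and is unique when this set is a singleton.\<close>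

definition num_gcd_classes ::
  "nat \<Rightarrow> nat \<Rightarrow> real \<Rightarrow> complex poly \<Rightarrow> complex poly \<Rightarrow> complex poly set set" where
  "num_gcd_classes m n \<epsilon> p q = (\<lambda>(r, s). poly_gcds r s) ` num_gcd_pairs m n \<epsilon> p q"

section \<open>Matrices\<close>

definition append_cols :: "complex mat \<Rightarrow> complex mat \<Rightarrow> complex mat" (infixr \<open>@\<^sub>c\<close> 66) where
  "A @\<^sub>c B = four_block_mat A B (0\<^sub>m 0 (dim_col A)) (0\<^sub>m 0 (dim_col B))"

text \<open>The \<open>c\<close>-th column holds the coefficients of \<open>f * x ^ c\<close>.\<close>

definition conv_mat :: "nat \<Rightarrow> nat \<Rightarrow> complex poly \<Rightarrow> complex mat" where
  "conv_mat l j f = mat (l + j + 1) (j + 1) (\<lambda>(r, c). coeff (f * monom 1 c) r)"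

definition sylvester :: "nat \<Rightarrow> nat \<Rightarrow> nat \<Rightarrow> complex poly \<Rightarrow> complex poly \<Rightarrow> complex mat" where
  "sylvester m n j p q = conv_mat m (n - j) p @\<^sub>c conv_mat n (m - j) q"

text \<open>The square roots of the eigenvalues of the Gram matrix are the singular values of a matrix
  that has at least as many rows as columns, which is the case for the matrices
  \<open>sylvester m n j p q\<close> with \<open>1 \<le> j \<le> n \<le> m\<close>.\<close>

definition sigma_min :: "complex mat \<Rightarrow> real" where
  "sigma_min A = Min {\<sigma>. 0 \<le> \<sigma> \<and> eigenvalue (mat_adjoint A * A) (complex_of_real (\<sigma>\<^sup>2))}"

definition min_right_singular_vector :: "complex mat \<Rightarrow> complex vec \<Rightarrow> bool" where
  "min_right_singular_vector A x \<longleftrightarrow>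
     x \<in> carrier_vec (dim_col A) \<and> euclid_norm x = 1 \<and>
     (mat_adjoint A * A) *\<^sub>v x = complex_of_real ((sigma_min A)\<^sup>2) \<cdot>\<^sub>v x"

definition least_squares_solution :: "complex mat \<Rightarrow> complex vec \<Rightarrow> complex vec \<Rightarrow> bool" where
  "least_squares_solution A b x \<longleftrightarrow>
     x \<in> carrier_vec (dim_col A) \<and>
     (\<forall>y\<in>carrier_vec (dim_col A). euclid_norm (A *\<^sub>v x - b) \<le> euclid_norm (A *\<^sub>v y - b))"

definition injective_mat :: "complex mat \<Rightarrow> bool" where
  "injective_mat A \<longleftrightarrow> inj_on ((*\<^sub>v) A) (carrier_vec (dim_col A))"

text \<open>Meaningful only for injective \<open>A\<close>.\<close>

definition pinv :: "complex mat \<Rightarrow> complex mat" where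
  "pinv A = the (mat_inverse (mat_adjoint A * A)) * mat_adjoint A"

section \<open>The Gauss--Newton iteration\<close>

type_synonym triplet = "complex poly \<times> complex poly \<times> complex poly"

definition triplet_vec :: "nat \<Rightarrow> nat \<Rightarrow> nat \<Rightarrow> triplet \<Rightarrow> complex vec" where
  "triplet_vec m n k = (\<lambda>(u, v, w).
     coeff_vec k u @\<^sub>v coeff_vec (m - k) v @\<^sub>v coeff_vec (n - k) w)"

definition vec_triplet :: "nat \<Rightarrow> nat \<Rightarrow> nat \<Rightarrow> complex vec \<Rightarrow> triplet" where
  "vec_triplet m n k z =
     (vec_poly (vec (k + 1) (\<lambda>i. z $ i)),
      vec_poly (vec (m - k + 1) (\<lambda>i. z $ (k + 1 + i))),
      vec_poly (vec (n - k + 1) (\<lambda>i. z $ (k + 1 + (m - k + 1) + i))))"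

text \<open>The row \<open>h\<^sup>H\<close>; its product with a column vector \<open>u\<close> is the scalar product that is
  conjugate linear in \<open>h\<close>.\<close>

definition adjoint_row :: "complex vec \<Rightarrow> complex mat" where
  "adjoint_row h = mat_of_row (conjugate h)"

definition gn_fun :: "nat \<Rightarrow> nat \<Rightarrow> nat \<Rightarrow> complex vec \<Rightarrow> triplet \<Rightarrow> complex vec" where
  "gn_fun m n k h = (\<lambda>(u, v, w).
     (adjoint_row h *\<^sub>v coeff_vec k u)
     @\<^sub>v (conv_mat (m - k) k v *\<^sub>v coeff_vec k u)
     @\<^sub>v (conv_mat (n - k) k w *\<^sub>v coeff_vec k u))"

definition gn_jacobian :: "nat \<Rightarrow> nat \<Rightarrow> nat \<Rightarrow> complex vec \<Rightarrow> triplet \<Rightarrow> complex mat" where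
  "gn_jacobian m n k h = (\<lambda>(u, v, w).
     (adjoint_row h @\<^sub>c 0\<^sub>m 1 (m - k + 1) @\<^sub>c 0\<^sub>m 1 (n - k + 1))
     @\<^sub>r (conv_mat (m - k) k v @\<^sub>c conv_mat k (m - k) u @\<^sub>c 0\<^sub>m (m + 1) (n - k + 1))
     @\<^sub>r (conv_mat (n - k) k w @\<^sub>c 0\<^sub>m (n + 1) (m - k + 1) @\<^sub>c conv_mat k (n - k) u))"

text \<open>The right-hand side \<open>[\<beta>; p; q]\<close> with \<open>\<beta> = 1\<close>.\<close>

definition gn_rhs :: "nat \<Rightarrow> nat \<Rightarrow> complex poly \<Rightarrow> complex poly \<Rightarrow> complex vec" where
  "gn_rhs m n p q = vec_of_list [1] @\<^sub>v coeff_vec m p @\<^sub>v coeff_vec n q"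

text \<open>A step from a triplet at which the Jacobian is not injective is undefined, and the iteration
  breaks down there (\<open>None\<close>).\<close>

definition gn_step ::
  "nat \<Rightarrow> nat \<Rightarrow> nat \<Rightarrow> complex poly \<Rightarrow> complex poly \<Rightarrow> complex vec \<Rightarrow> triplet \<Rightarrow> triplet option" where
  "gn_step m n k p q h t =
     (if injective_mat (gn_jacobian m n k h t)
      then Some (vec_triplet m n k
             (triplet_vec m n k t -
              pinv (gn_jacobian m n k h t) *\<^sub>v (gn_fun m n k h t - gn_rhs m n p q)))
      else None)"

primrec gauss_newton ::
  "nat \<Rightarrow> nat \<Rightarrow> nat \<Rightarrow> complex poly \<Rightarrow> complex poly \<Rightarrow> complex vec \<Rightarrow> triplet \<Rightarrow> nat \<Rightarrow> triplet option"
where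
  "gauss_newton m n k p q h t 0 = Some t"
| "gauss_newton m n k p q h t (Suc i) =
     Option.bind (gauss_newton m n k p q h t i) (gn_step m n k p q h)"

section \<open>Algorithm uvGCD in exact arithmetic\<close>

text \<open>The initial triplets before rescaling. The singular vector is only determined up to a factor
  (or a choice within a singular subspace), hence a set.\<close>

definition uvGCD_initial ::
  "nat \<Rightarrow> nat \<Rightarrow> nat \<Rightarrow> complex poly \<Rightarrow> complex poly \<Rightarrow> triplet set" where
  "uvGCD_initial m n j p q = {(u, v, w).
     degree u \<le> j \<and> degree v \<le> m - j \<and> degree w \<le> n - j \<and>
     min_right_singular_vector (sylvester m n j p q)
       (coeff_vec (n - j) w @\<^sub>v - coeff_vec (m - j) v) \<and>
     least_squares_solution (conv_mat (m - j) j v @\<^sub>r conv_mat (n - j) j w)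
       (coeff_vec m p @\<^sub>v coeff_vec n q) (coeff_vec j u)}"

text \<open>The rescaling by \<open>s = \<parallel>u\<parallel>\<close> is undefined if \<open>u = 0\<close>.\<close>

definition uvGCD_run_from ::
  "nat \<Rightarrow> nat \<Rightarrow> nat \<Rightarrow> complex poly \<Rightarrow> complex poly \<Rightarrow> triplet \<Rightarrow> nat \<Rightarrow> triplet option" where
  "uvGCD_run_from m n j p q = (\<lambda>(u, v, w) i.
     if u = 0 then None
     else let s = complex_of_real (poly_norm u); u' = smult (1 / s) u
          in gauss_newton m n j p q (coeff_vec j u') (u', smult s v, smult s w) i)"

text \<open>All sequences the algorithm may generate for degree \<open>j\<close>, continued indefinitely. Degree 0 is
  the trivial output.\<close>

definition uvGCD_runs ::
  "nat \<Rightarrow> nat \<Rightarrow> nat \<Rightarrow> complex poly \<Rightarrow> complex poly \<Rightarrow> (nat \<Rightarrow> triplet option) set" where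
  "uvGCD_runs m n j p q =
     (if j = 0 then {\<lambda>i. Some (1, p, q)}
      else uvGCD_run_from m n j p q ` uvGCD_initial m n j p q)"

text \<open>The vector \<open>h\<close> of a run is the coefficient vector of its own first component.\<close>

definition uvGCD_residual ::
  "nat \<Rightarrow> nat \<Rightarrow> nat \<Rightarrow> complex poly \<Rightarrow> complex poly \<Rightarrow> (nat \<Rightarrow> triplet option) \<Rightarrow> nat \<Rightarrow> real" where
  "uvGCD_residual m n j p q r i =
     euclid_norm (gn_fun m n j (coeff_vec j (fst (the (r 0)))) (the (r i)) - gn_rhs m n p q)"

definition uvGCD_test ::
  "nat \<Rightarrow> nat \<Rightarrow> nat \<Rightarrow> complex poly \<Rightarrow> complex poly \<Rightarrow> real \<Rightarrow> bool" where
  "uvGCD_test m n j p q \<epsilon> \<longleftrightarrow> sigma_min (sylvester m n j p q) < \<epsilon> * sqrt (real (m - j + 1))"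

text \<open>The loop may be left at degree \<open>j\<close>: the test succeeds and some run stops, at the first index
  after which its residual does not decrease, with a residual below \<open>\<epsilon>\<close>.\<close>

definition uvGCD_accepts ::
  "nat \<Rightarrow> nat \<Rightarrow> nat \<Rightarrow> complex poly \<Rightarrow> complex poly \<Rightarrow> real \<Rightarrow> bool" where
  "uvGCD_accepts m n j p q \<epsilon> \<longleftrightarrow>
     uvGCD_test m n j p q \<epsilon> \<and>
     (\<exists>r\<in>uvGCD_runs m n j p q. \<exists>i.
        r (Suc i) \<noteq> None \<and>
        (\<forall>l<i. uvGCD_residual m n j p q r (Suc l) < uvGCD_residual m n j p q r l) \<and>
        uvGCD_residual m n j p q r i \<le> uvGCD_residual m n j p q r (Suc i) \<and>
        uvGCD_residual m n j p q r i < \<epsilon>)"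

text \<open>The loop over \<open>j = n, n - 1, \<dots>, 1\<close> arrives at degree \<open>k\<close> and starts the iteration there; for
  \<open>k = 0\<close>, no degree is accepted and the trivial triplet is returned.\<close>

definition uvGCD_reaches ::
  "nat \<Rightarrow> nat \<Rightarrow> nat \<Rightarrow> complex poly \<Rightarrow> complex poly \<Rightarrow> real \<Rightarrow> bool" where
  "uvGCD_reaches m n k p q \<epsilon> \<longleftrightarrow>
     (\<forall>j\<in>{k<..n}. \<not> uvGCD_accepts m n j p q \<epsilon>) \<and> (k > 0 \<longrightarrow> uvGCD_test m n k p q \<epsilon>)"

end

theory Submission
  imports Defs
    "HOL-Analysis.Topology_Euclidean_Space"
    "HOL-Analysis.Convex"
    "HOL-Computational_Algebra.Field_as_Ring"
    "HOL-Computational_Algebra.Polynomial_Factorial"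
    "HOL-Computational_Algebra.Fundamental_Theorem_Algebra"
    "Jordan_Normal_Form.Spectral_Radius"
begin

text \<open>The theorem is a statement about a nonlinear least squares problem. A pair with a GCD of degree
  \<open>k\<close> is a pair of products \<open>(u v, u w)\<close>, and the map from \<open>(u, v, w)\<close> to the products, completed by a
  scaling condition \<open>\<langle>u, h\<rangle> = 1\<close>, is quadratic. At an exact pair with coprime cofactors its derivative is
  injective: the only direction in which the products do not change is that of the scaling orbit
  (\<open>dfac_injective\<close>). Compactness makes this quantitative.

  Numerical GCDs. All products \<open>(u v, u w)\<close> within the degree bounds lie in the closure of the pairs
  whose GCD has degree \<open>k\<close> (\<open>theta_le_factored\<close>). Therefore \<open>\<theta>\<^sub>k\<close> is nondecreasing in \<open>k\<close>, which
  identifies \<open>k\<close> as the degree of the numerical GCD under the hypothesis on \<open>\<epsilon>\<close>; and \<open>\<theta>\<^sub>k(p, q)\<close> is the minimal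
  distance to products of triplets in a vector space, which is attained (\<open>ex_best_factorization\<close>). A
  minimizer is a critical point of the least squares problem. Close to the exact pair the Gauss--Newton step
  contracts towards every critical point with a small residual (\<open>gauss_newton_contraction\<close>), so
  that there is at most one of them; this gives uniqueness, and convergence from any starting point
  in the basin (\<open>gauss_newton_local\<close>).

  The algorithm. At a degree \<open>j > k\<close> no iterate can have a residual below \<open>\<epsilon>\<close>, because the residual
  is at least \<open>\<theta>\<^sub>j(p, q) > \<epsilon>\<close> (\<open>not_accepted_above\<close>). At the degree \<open>k\<close> the smallest singular value of the
  Sylvester matrix is at most \<open>\<surd>(m - k + 1)\<close> times the distance to the exact pair
  (\<open>sigma_min_sylvester_perturbed_le\<close>). The kernel of the Sylvester matrix of the exact pair is spanned by
  its cofactors, hence the singular vector approximates the cofactors and the initial triplet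
  approximates the exact factorization (\<open>initial_triplet_near\<close>).

  The singular vector is only determined up to a phase \<open>\<alpha>\<close>, and the scaling vector \<open>h\<close> is taken from the
  starting point, so each run solves its own least squares problem. The rotations
  \<open>(u, v, w) \<mapsto> (\<alpha> u, \<alpha>' v, \<alpha>' w)\<close>, with \<open>\<alpha>'\<close> the conjugate of \<open>\<alpha>\<close>, preserve norms, products and the derivative
  (\<open>dfac_rot\<close>), which makes all constants independent of the run.\<close>

unbundle no vec_syntax
unbundle no inner_syntax

section \<open>Polynomials as an inner product space\<close>

text \<open>A separate type, because the sign of a polynomial (that of its leading coefficient) already
  occupies the operation \<open>sgn\<close>, which in a normed space has to be the direction \<open>p / \<parallel>p\<parallel>\<close>.\<close>

typedef l2_poly = "UNIV :: complex poly set"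
  morphisms poly_of l2 ..

setup_lifting type_definition_l2_poly

declare l2_inverse [OF UNIV_I, simp] poly_of_inverse [simp]

lemma poly_of_eq_iff: "p = q \<longleftrightarrow> poly_of p = poly_of q"
  by (simp add: poly_of_inject)

instantiation l2_poly :: idom
begin

lift_definition zero_l2_poly :: l2_poly is 0 .
lift_definition one_l2_poly :: l2_poly is 1 .
lift_definition plus_l2_poly :: "l2_poly \<Rightarrow> l2_poly \<Rightarrow> l2_poly" is plus .
lift_definition minus_l2_poly :: "l2_poly \<Rightarrow> l2_poly \<Rightarrow> l2_poly" is minus .
lift_definition uminus_l2_poly :: "l2_poly \<Rightarrow> l2_poly" is uminus .
lift_definition times_l2_poly :: "l2_poly \<Rightarrow> l2_poly \<Rightarrow> l2_poly" is times .

instance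
  by standard (transfer, simp add: algebra_simps)+

end

lift_definition smul :: "complex \<Rightarrow> l2_poly \<Rightarrow> l2_poly" is smult .

lemmas poly_of_simps [simp] =
  zero_l2_poly.rep_eq one_l2_poly.rep_eq plus_l2_poly.rep_eq minus_l2_poly.rep_eq
  uminus_l2_poly.rep_eq times_l2_poly.rep_eq smul.rep_eq

lemma l2_eq_iff [simp]: "l2 p = l2 q \<longleftrightarrow> p = q"
  by (metis l2_inverse UNIV_I)

lemma l2_simps:
  "l2 (p + q) = l2 p + l2 q" "l2 (p - q) = l2 p - l2 q" "l2 (p * q) = l2 p * l2 q"
  "l2 (- p) = - l2 p" "l2 (smult c p) = smul c (l2 p)" "l2 0 = 0" "l2 1 = 1"
  by (simp_all add: poly_of_eq_iff)

text \<open>Only the first argument bounds the range of summation: beyond its degree all products vanish,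
  whatever the degree of the second one is.\<close>

definition cinner :: "l2_poly \<Rightarrow> l2_poly \<Rightarrow> complex" where
  "cinner p q = (\<Sum>i\<le>degree (poly_of p). coeff (poly_of p) i * cnj (coeff (poly_of q) i))"

lemma cinner_cutoff:
  assumes "degree (poly_of p) \<le> N"
  shows "cinner p q = (\<Sum>i\<le>N. coeff (poly_of p) i * cnj (coeff (poly_of q) i))"
  unfolding cinner_def
  by (rule sum.mono_neutral_left) (use assms in \<open>auto simp: coeff_eq_0\<close>)

lemma
  shows cinner_commute: "cinner p q = cnj (cinner q p)"
    and cinner_add_left: "cinner (p + p') q = cinner p q + cinner p' q"
    and cinner_diff_left: "cinner (p - p') q = cinner p q - cinner p' q"
    and cinner_smul_left: "cinner (smul c p) q = c * cinner p q"
proof -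
  let ?N = "Max {degree (poly_of p), degree (poly_of p'), degree (poly_of q)}"
  have deg: "degree (poly_of p) \<le> ?N" "degree (poly_of q) \<le> ?N" "degree (poly_of p') \<le> ?N"
    by simp_all
  have deg': "degree (poly_of (p + p')) \<le> ?N" "degree (poly_of (p - p')) \<le> ?N"
    "degree (poly_of (smul c p)) \<le> ?N"
    using degree_add_le_max[of "poly_of p" "poly_of p'"] degree_diff_le_max[of "poly_of p" "poly_of p'"]
      degree_smult_le[of c "poly_of p"] by auto
  show "cinner p q = cnj (cinner q p)"
    by (simp add: cinner_cutoff[OF deg(1)] cinner_cutoff[OF deg(2)] mult.commute)
  show "cinner (p + p') q = cinner p q + cinner p' q"
    by (simp add: cinner_cutoff[OF deg(1)] cinner_cutoff[OF deg(3)] cinner_cutoff[OF deg'(1)]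
        ring_distribs sum.distrib)
  show "cinner (p - p') q = cinner p q - cinner p' q"
    by (simp add: cinner_cutoff[OF deg(1)] cinner_cutoff[OF deg(3)] cinner_cutoff[OF deg'(2)]
        ring_distribs sum_subtractf)
  show "cinner (smul c p) q = c * cinner p q"
    by (simp add: cinner_cutoff[OF deg(1)] cinner_cutoff[OF deg'(3)] sum_distrib_left mult.assoc)
qed

lemma cinner_self: "cinner p p = of_real (\<Sum>i\<le>degree (poly_of p). (cmod (coeff (poly_of p) i))\<^sup>2)"
  by (simp add: cinner_def complex_norm_square[symmetric])

instantiation l2_poly :: real_inner
begin

definition scaleR_l2_poly :: "real \<Rightarrow> l2_poly \<Rightarrow> l2_poly" where
  "scaleR_l2_poly r p = smul (of_real r) p"

definition inner_l2_poly :: "l2_poly \<Rightarrow> l2_poly \<Rightarrow> real" where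
  "inner_l2_poly p q = Re (cinner p q)"

definition norm_l2_poly :: "l2_poly \<Rightarrow> real" where
  "norm_l2_poly p = sqrt (inner p p)"

definition sgn_l2_poly :: "l2_poly \<Rightarrow> l2_poly" where
  "sgn_l2_poly p = scaleR (inverse (norm p)) p"

definition dist_l2_poly :: "l2_poly \<Rightarrow> l2_poly \<Rightarrow> real" where
  "dist_l2_poly p q = norm (p - q)"

definition uniformity_l2_poly :: "(l2_poly \<times> l2_poly) filter" where
  "uniformity_l2_poly = (INF e\<in>{0<..}. principal {(x, y). dist x y < e})"

definition open_l2_poly :: "l2_poly set \<Rightarrow> bool" where
  "open_l2_poly U = (\<forall>x\<in>U. eventually (\<lambda>(x', y). x' = x \<longrightarrow> y \<in> U) uniformity)"

instance
proof
  fix p q r :: l2_poly and a b :: real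
  show "scaleR a (p + q) = scaleR a p + scaleR a q" "scaleR (a + b) p = scaleR a p + scaleR b p"
    "scaleR a (scaleR b p) = scaleR (a * b) p" "scaleR 1 p = p"
    by (simp_all add: scaleR_l2_poly_def poly_of_eq_iff smult_add_right smult_add_left)
  show "dist p q = norm (p - q)"
    by (simp add: dist_l2_poly_def)
  show "sgn p = scaleR (inverse (norm p)) p"
    by (simp add: sgn_l2_poly_def)
  show "(uniformity :: (l2_poly \<times> l2_poly) filter) = (INF e\<in>{0<..}. principal {(x, y). dist x y < e})"
    by (simp add: uniformity_l2_poly_def)
  show "open U = (\<forall>x\<in>U. eventually (\<lambda>(x', y). x' = x \<longrightarrow> y \<in> U) uniformity)" for U :: "l2_poly set"
    by (simp add: open_l2_poly_def)
  show "inner p q = inner q p"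
    using arg_cong[OF cinner_commute[of p q], of Re] by (simp add: inner_l2_poly_def)
  show "inner (p + q) r = inner p r + inner q r"
    by (simp add: inner_l2_poly_def cinner_add_left)
  show "inner (scaleR a p) q = a * inner p q"
    by (simp add: inner_l2_poly_def scaleR_l2_poly_def cinner_smul_left)
  show "0 \<le> inner p p"
    by (simp add: inner_l2_poly_def cinner_self sum_nonneg)
  show "inner p p = 0 \<longleftrightarrow> p = 0"
  proof
    assume "inner p p = 0"
    then have "\<forall>i\<le>degree (poly_of p). coeff (poly_of p) i = 0"
      by (simp add: inner_l2_poly_def cinner_self sum_nonneg_eq_0_iff)
    then show "p = 0"
      by (simp add: poly_of_eq_iff flip: leading_coeff_0_iff)
  qed (simp add: inner_l2_poly_def cinner_def)
  show "norm p = sqrt (inner p p)"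
    by (simp add: norm_l2_poly_def)
qed

end

lemma norm_l2_poly_sum:
  assumes "degree (poly_of p) \<le> N"
  shows "(norm p)\<^sup>2 = (\<Sum>i\<le>N. (cmod (coeff (poly_of p) i))\<^sup>2)"
proof -
  have "complex_of_real ((norm p)\<^sup>2) = complex_of_real (\<Sum>i\<le>N. (cmod (coeff (poly_of p) i))\<^sup>2)"
    using cinner_self[of p]
    by (simp add: power2_norm_eq_inner[of p] inner_l2_poly_def cinner_cutoff[OF assms]
        complex_norm_square[symmetric])
  then show ?thesis
    by (simp only: of_real_eq_iff)
qed

lemma cinner_self_norm: "cinner p p = of_real ((norm p)\<^sup>2)"
  by (simp only: cinner_self norm_l2_poly_sum[OF order_refl])

lemma euclid_norm_coeff_vec:
  assumes "degree p \<le> l"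
  shows "euclid_norm (coeff_vec l p) = norm (l2 p)"
proof -
  have "(\<Sum>i<dim_vec (coeff_vec l p). (cmod (coeff_vec l p $ i))\<^sup>2) = (\<Sum>i\<le>l. (cmod (coeff p i))\<^sup>2)"
    by (rule sum.cong) (auto simp: coeff_vec_def)
  also have "\<dots> = (norm (l2 p))\<^sup>2"
    using assms by (subst norm_l2_poly_sum[of _ l]) simp_all
  finally show ?thesis
    by (simp add: euclid_norm_def)
qed

lemma poly_norm_eq_norm: "poly_norm p = norm (l2 p)"
  by (simp add: poly_norm_def euclid_norm_coeff_vec)

lemma pair_norm_eq_norm: "pair_norm p q = norm (l2 p, l2 q)"
  by (simp add: pair_norm_def poly_norm_eq_norm norm_Pair)

lemma norm_coeff_le: "norm (coeff (poly_of p) i) \<le> norm p"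
proof -
  have "(cmod (coeff (poly_of p) i))\<^sup>2
      \<le> (\<Sum>j\<le>max i (degree (poly_of p)). (cmod (coeff (poly_of p) j))\<^sup>2)"
    by (rule member_le_sum) auto
  then have "(cmod (coeff (poly_of p) i))\<^sup>2 \<le> (norm p)\<^sup>2"
    by (simp add: norm_l2_poly_sum[of p "max i (degree (poly_of p))"])
  then show ?thesis
    by (rule power2_le_imp_le) simp
qed

lemma norm_smul [simp]: "norm (smul c p) = cmod c * norm p"
proof -
  have "cinner (smul c p) (smul c p) = c * cnj (c * cinner p p)"
    by (subst cinner_smul_left, subst cinner_commute) (simp add: cinner_smul_left)
  also have "\<dots> = (c * cnj c) * cnj (cinner p p)"
    by (simp add: mult.assoc)
  finally have "complex_of_real ((norm (smul c p))\<^sup>2) = of_real ((cmod c * norm p)\<^sup>2)"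
    by (simp only: cinner_self_norm complex_norm_square[symmetric] complex_cnj_complex_of_real
        of_real_mult[symmetric] power_mult_distrib)
  then have "(norm (smul c p))\<^sup>2 = (cmod c * norm p)\<^sup>2"
    by (simp only: of_real_eq_iff)
  then show ?thesis
    by (rule power2_eq_imp_eq) simp_all
qed

lemma smul_simps:
  "smul a (smul b p) = smul (a * b) p" "smul 1 p = p" "smul 0 p = 0" "smul c 0 = 0"
  "smul c (p + q) = smul c p + smul c q" "smul c (p - q) = smul c p - smul c q"
  "smul a p + smul b p = smul (a + b) p" "smul a p - smul b p = smul (a - b) p"
  "smul c p * q = smul c (p * q)" "p * smul c q = smul c (p * q)" "- smul c p = smul (- c) p"
  by (simp_all add: poly_of_eq_iff smult_add_right smult_diff_right smult_add_left smult_diff_left)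

lemma norm_pCons: "norm (l2 (pCons c p)) = norm (c, l2 p)"
proof -
  have "(norm (l2 (pCons c p)))\<^sup>2 = (\<Sum>i\<le>Suc (degree p). (cmod (coeff (pCons c p) i))\<^sup>2)"
    by (subst norm_l2_poly_sum[of _ "Suc (degree p)"]) (simp_all add: degree_pCons_le)
  also have "\<dots> = (cmod c)\<^sup>2 + (norm (l2 p))\<^sup>2"
    using norm_l2_poly_sum[of "l2 p" "degree p"]
    by (simp add: sum.atMost_Suc_shift del: sum.atMost_Suc)
  finally show ?thesis
    by (simp add: norm_Pair real_sqrt_unique)
qed

lemma bounded_linear_smul: "bounded_linear (smul c)"
  by (rule bounded_linear_intro[where K = "cmod c"])
    (simp_all add: smul_simps scaleR_l2_poly_def mult.commute)

text \<open>The modulus of \<open>cinner p q\<close> is the value of the real inner product after one argument is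
  rotated to make it real, hence the Cauchy--Schwarz inequality in its complex form.\<close>

lemma cinner_norm_le: "cmod (cinner p q) \<le> norm p * norm q"
proof (cases "cinner p q = 0")
  case False
  define c where "c = cnj (cinner p q) / of_real (cmod (cinner p q))"
  have "cinner (smul c p) q = of_real (cmod (cinner p q))"
    using False complex_norm_square[of "cinner p q"]
    by (simp add: cinner_smul_left c_def divide_simps power2_eq_square mult.commute)
  then have "cmod (cinner p q) = inner (smul c p) q"
    by (simp add: inner_l2_poly_def)
  also have "\<dots> \<le> norm (smul c p) * norm q"
    by (rule norm_cauchy_schwarz)
  also have "norm (smul c p) = norm p"
    using False by (simp add: c_def norm_divide)
  finally show ?thesis .
qed simp

subsection \<open>Spaces of polynomials of bounded degree\<close>

definition deg_le :: "nat \<Rightarrow> l2_poly set" where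
  "deg_le l = {p. degree (poly_of p) \<le> l}"

lemma l2_in_deg_le [simp]: "l2 p \<in> deg_le l \<longleftrightarrow> degree p \<le> l"
  by (simp add: deg_le_def)

lemma deg_le_closed [intro]:
  "0 \<in> deg_le l"
  "p \<in> deg_le l \<Longrightarrow> q \<in> deg_le l \<Longrightarrow> p + q \<in> deg_le l"
  "p \<in> deg_le l \<Longrightarrow> q \<in> deg_le l \<Longrightarrow> p - q \<in> deg_le l"
  "p \<in> deg_le l \<Longrightarrow> - p \<in> deg_le l"
  "p \<in> deg_le l \<Longrightarrow> smul c p \<in> deg_le l"
  "p \<in> deg_le l \<Longrightarrow> scaleR r p \<in> deg_le l"
  by (auto simp: deg_le_def scaleR_l2_poly_def intro: degree_add_le degree_diff_le
      degree_smult_le[THEN order_trans])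

lemma deg_le_mult: "p \<in> deg_le i \<Longrightarrow> q \<in> deg_le j \<Longrightarrow> p * q \<in> deg_le (i + j)"
  using degree_mult_le[of "poly_of p" "poly_of q"] by (auto simp: deg_le_def)

lemma sum_norm_coeff_le:
  assumes "p \<in> deg_le l"
  shows "(\<Sum>i\<le>l. cmod (coeff (poly_of p) i)) \<le> sqrt (real (l + 1)) * norm p"
proof -
  have "(\<Sum>i\<le>l. 1 * cmod (coeff (poly_of p) i))\<^sup>2
      \<le> (\<Sum>i\<le>l. 1\<^sup>2) * (\<Sum>i\<le>l. (cmod (coeff (poly_of p) i))\<^sup>2)"
    by (rule Cauchy_Schwarz_ineq_sum)
  also have "\<dots> = (sqrt (real (l + 1)) * norm p)\<^sup>2"
    using norm_l2_poly_sum[of p l] assms by (simp add: power_mult_distrib deg_le_def)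
  finally have "(\<Sum>i\<le>l. cmod (coeff (poly_of p) i))\<^sup>2 \<le> (sqrt (real (l + 1)) * norm p)\<^sup>2"
    by simp
  then show ?thesis
    by (rule power2_le_imp_le) simp
qed

lemma norm_monom_mult: "norm (l2 (monom c i * p)) = cmod c * norm (l2 p)"
proof (induction i)
  case 0
  show ?case
    by (simp add: monom_0 l2_simps(5))
next
  case (Suc i)
  have "norm (l2 (monom c (Suc i) * p)) = norm (l2 (pCons 0 (monom c i * p)))"
    by (simp add: monom_Suc)
  then show ?case
    using Suc by (simp add: norm_pCons norm_Pair)
qed

text \<open>Multiplication by a monomial is an isometry, so the norm of the product is at most \<open>\<parallel>q\<parallel>\<close> times
  the sum of the moduli of the coefficients of \<open>p\<close>, to which the Cauchy--Schwarz inequality applies.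
  The factor \<open>\<surd>(l + 1)\<close> is the one in the threshold of the singular value test.\<close>

lemma norm_mult_le:
  assumes "p \<in> deg_le l"
  shows "norm (p * q) \<le> sqrt (real (l + 1)) * norm p * norm q"
proof -
  let ?p = "poly_of p"
  have "(\<Sum>i\<le>l. monom (coeff ?p i) i) = ?p"
    using assms by (intro poly_as_sum_of_monoms') (simp add: deg_le_def)
  then have eq: "p * q = l2 (\<Sum>i\<le>l. monom (coeff ?p i) i * poly_of q)"
    by (simp add: poly_of_eq_iff flip: sum_distrib_right)
  have "norm (l2 (sum f S)) \<le> (\<Sum>i\<in>S. norm (l2 (f i)))" if "finite S"
    for f :: "nat \<Rightarrow> complex poly" and S
    using that by induction (auto simp: l2_simps intro: norm_triangle_le)
  then have "norm (p * q) \<le> (\<Sum>i\<le>l. norm (l2 (monom (coeff ?p i) i * poly_of q)))"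
    unfolding eq by simp
  also have "\<dots> = (\<Sum>i\<le>l. cmod (coeff ?p i)) * norm q"
    by (simp add: norm_monom_mult sum_distrib_right)
  also have "\<dots> \<le> sqrt (real (l + 1)) * norm p * norm q"
    by (rule mult_right_mono[OF sum_norm_coeff_le[OF assms]]) simp
  finally show ?thesis .
qed

text \<open>Multiplication is not continuous on the space of all polynomials, since the constant of
  the norm estimate grows with the degree; a bound on the degree of one factor repairs this.\<close>

lemma tendsto_mult_deg_le:
  assumes "(f \<longlongrightarrow> a) F" "(g \<longlongrightarrow> b) F" "\<forall>\<^sub>F x in F. f x \<in> deg_le l" "a \<in> deg_le l"
  shows "((\<lambda>x. f x * g x) \<longlongrightarrow> a * b) F"
proof -
  let ?K = "sqrt (real (l + 1))"
  have "((\<lambda>x. ?K * norm (f x - a) * norm (g x) + ?K * norm a * norm (g x - b)) \<longlongrightarrow>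
      ?K * norm (a - a) * norm b + ?K * norm a * norm (b - b)) F"
    by (intro tendsto_intros assms)
  then have lim: "((\<lambda>x. ?K * norm (f x - a) * norm (g x) + ?K * norm a * norm (g x - b)) \<longlongrightarrow> 0) F"
    by simp
  have le: "norm (f x * g x - a * b) \<le> ?K * norm (f x - a) * norm (g x) + ?K * norm a * norm (g x - b)"
    if "f x \<in> deg_le l" for x
  proof -
    have "f x * g x - a * b = (f x - a) * g x + a * (g x - b)"
      by (simp add: algebra_simps)
    then show ?thesis
      using norm_triangle_mono norm_mult_le that assms(4) deg_le_closed(3) by metis
  qed
  have "((\<lambda>x. f x * g x - a * b) \<longlongrightarrow> 0) F"
    by (rule Lim_null_comparison[OF _ lim], use assms(3) in eventually_elim) (rule le)
  then show ?thesis
    using LIM_zero_iff by blast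
qed

lemma continuous_on_mult_deg_le:
  assumes "continuous_on S f" "continuous_on S g" "\<And>x. x \<in> S \<Longrightarrow> f x \<in> deg_le l"
  shows "continuous_on S (\<lambda>x. f x * g x)"
  using assms unfolding continuous_on_def
  by (auto intro!: tendsto_mult_deg_le simp: eventually_at_filter)

text \<open>By induction on the degree bound: the map \<open>(c, p) \<mapsto> c + x p\<close> is an isometry onto the
  polynomials that satisfy the next bound.\<close>

lemma compact_deg_le: "compact (deg_le l \<inter> cball 0 R)"
proof (induction l)
  case 0
  have norm_const: "norm (smul c 1) = cmod c" for c
    using norm_pCons[of 1 0] by (simp add: l2_simps norm_Pair flip: one_pCons)
  have "continuous_on (cball 0 R) (\<lambda>c. smul c (1::l2_poly))"
    by (rule continuous_onI) (auto simp: dist_norm smul_simps norm_const simp del: norm_smul)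
  moreover have "deg_le 0 \<inter> cball 0 R = (\<lambda>c. smul c 1) ` cball 0 R"
  proof (intro equalityI subsetI)
    fix p assume p: "p \<in> deg_le 0 \<inter> cball 0 R"
    then obtain c where "poly_of p = [:c:]"
      by (auto simp: deg_le_def elim: degree_eq_zeroE)
    then have "p = smul c 1"
      by (simp add: poly_of_eq_iff)
    moreover have "cmod c \<le> R"
      using p norm_const[of c] \<open>p = smul c 1\<close> by (simp del: norm_smul)
    ultimately show "p \<in> (\<lambda>c. smul c 1) ` cball 0 R"
      by auto
  qed (auto simp: deg_le_def norm_const simp del: norm_smul)
  ultimately show ?case
    by (simp add: compact_continuous_image)
next
  case (Suc l)
  define f where "f = (\<lambda>(c, p). l2 (pCons c (poly_of p)))"
  define K where "K = (cball (0::complex) R \<times> (deg_le l \<inter> cball 0 R)) \<inter> cball 0 R"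
  have f_diff: "f x - f y = f (x - y)" for x y
    by (simp add: f_def split_beta poly_of_eq_iff)
  have norm_f: "norm (f x) = norm x" for x
    by (simp add: f_def split_beta norm_pCons)
  have "compact K"
    unfolding K_def by (intro compact_Int_closed[OF compact_Times[OF compact_cball Suc]] closed_cball)
  moreover have "continuous_on K f"
    by (rule continuous_onI) (auto simp: dist_norm f_diff norm_f)
  moreover have "deg_le (Suc l) \<inter> cball 0 R = f ` K"
  proof (intro equalityI subsetI)
    fix p assume p: "p \<in> deg_le (Suc l) \<inter> cball 0 R"
    obtain c q where q: "poly_of p = pCons c q"
      by (rule pCons_cases)
    then have p_eq: "p = f (c, l2 q)"
      by (simp add: f_def poly_of_eq_iff)
    then have "norm (c, l2 q) \<le> R"
      using p norm_f[of "(c, l2 q)"] by simp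
    moreover have "cmod c \<le> norm (c, l2 q)" "norm (l2 q) \<le> norm (c, l2 q)"
      by (rule norm_fst_le norm_snd_le)+
    moreover have "degree q \<le> l"
      using p q by (cases "q = 0") (auto simp: deg_le_def)
    ultimately have "(c, l2 q) \<in> K"
      by (simp add: K_def)
    with p_eq show "p \<in> f ` K"
      by blast
  next
    fix p assume "p \<in> f ` K"
    then obtain x where x: "x \<in> K" "p = f x"
      by blast
    then have "norm p \<le> R"
      by (simp add: K_def norm_f)
    moreover have "p \<in> deg_le (Suc l)"
      using x by (auto simp: K_def f_def deg_le_def intro: degree_pCons_le[THEN order_trans])
    ultimately show "p \<in> deg_le (Suc l) \<inter> cball 0 R"
      by simp
  qed
  ultimately show ?case
    by (simp add: compact_continuous_image)
qed

section \<open>Least squares problems with a quadratic map\<close>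

text \<open>The square of the right-hand side is a polynomial in \<open>t\<close> whose linear coefficient is
  \<open>2 \<langle>r, j\<rangle>\<close>, and it is minimal at \<open>t = 0\<close>.\<close>

lemma minimizer_orthogonal:
  fixes r j q :: "'a::real_inner"
  assumes "\<And>t::real. norm r \<le> norm (r + scaleR t j + scaleR (t\<^sup>2) q)"
  shows "inner r j = 0"
proof -
  define \<phi> where "\<phi> = (\<lambda>t::real. inner r r + 2 * t * inner r j
    + t\<^sup>2 * (inner j j + 2 * inner r q) + 2 * t^3 * inner j q + t^4 * inner q q)"
  have \<phi>: "\<phi> t = (norm (r + scaleR t j + scaleR (t\<^sup>2) q))\<^sup>2" for t
    unfolding power2_norm_eq_inner \<phi>_def
    by (simp add: inner_add_left inner_add_right inner_commute[of j r] inner_commute[of q r]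
        inner_commute[of q j] algebra_simps power2_eq_square power3_eq_cube power4_eq_xxxx)
  have "(\<phi> has_real_derivative 2 * inner r j) (at 0)"
    unfolding \<phi>_def by (auto intro!: derivative_eq_intros)
  moreover have "\<phi> 0 \<le> \<phi> t" for t
    unfolding \<phi> using assms[of t] by (simp add: power_mono)
  ultimately have "2 * inner r j = 0"
    by (intro DERIV_local_min[of \<phi> _ 0 1]) auto
  then show ?thesis
    by simp
qed

text \<open>Let \<open>z'\<close> be a critical point of \<open>\<parallel>f z - b\<parallel>\<close> and \<open>d\<close> the Gauss--Newton correction at \<open>z\<close>, that is, the
  solution of the linearized least squares problem. For the new error \<open>e = z - d - z'\<close> the normal
  equations for \<open>d\<close> and the criticality of \<open>z'\<close> reduce \<open>\<parallel>J z e\<parallel>\<^sup>2\<close> to two terms. One is the remainder of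
  the linearization, quadratic in the old error \<open>z - z'\<close>. The other is the residual at \<open>z'\<close> tested
  against \<open>J z e - J z' e\<close>; it is linear in the old error, but with the residual as a factor. Hence a
  small residual and a small old error make the step a contraction, and it converges to the critical
  point itself and not merely to its vicinity.\<close>

lemma gauss_newton_contraction:
  fixes f :: "'a::real_normed_vector \<Rightarrow> 'b::real_inner" and J :: "'a \<Rightarrow> 'a \<Rightarrow> 'b"
  assumes diff: "\<And>x y. x \<in> D \<Longrightarrow> y \<in> D \<Longrightarrow> x - y \<in> D"
    and mem: "z \<in> D" "z' \<in> D" "d \<in> D"
    and linear: "\<And>x y. J z (x - y) = J z x - J z y"
    and taylor: "norm (f z' - f z + J z (z - z')) \<le> L * (norm (z - z'))\<^sup>2"
    and lipschitz: "\<And>e. e \<in> D \<Longrightarrow> norm (J z e - J z' e) \<le> 2 * L * norm (z - z') * norm e"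
    and lower: "\<And>e. e \<in> D \<Longrightarrow> \<gamma> * norm e \<le> norm (J z e)"
    and critical: "\<And>e. e \<in> D \<Longrightarrow> inner (f z' - b) (J z' e) = 0"
    and step: "\<And>e. e \<in> D \<Longrightarrow> inner (J z d - (f z - b)) (J z e) = 0"
    and pos: "\<gamma> > 0" "L \<ge> 0"
    and small: "4 * L * norm (f z' - b) \<le> \<gamma>\<^sup>2 / 2" "4 * L * norm (z - z') \<le> \<gamma>"
  shows "norm (z - d - z') \<le> norm (z - z') / 2"
proof -
  define e where "e = z - d - z'"
  have e: "e \<in> D"
    unfolding e_def using diff mem by blast
  define \<rho> where "\<rho> = norm (f z' - b)"
  define \<delta> where "\<delta> = norm (z - z')"
  have J_e: "J z e = J z (z - z') - J z d"
    by (simp add: e_def linear)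
  have "(norm (J z e))\<^sup>2 = inner (J z (z - z') - J z d) (J z e)"
    by (simp add: power2_norm_eq_inner flip: J_e)
  also have "\<dots> = inner (f z' - f z + J z (z - z')) (J z e) - inner (f z' - b) (J z e - J z' e)"
    using step[OF e] critical[OF e] by (simp add: inner_diff_left inner_diff_right inner_add_left)
  also have "\<dots> \<le> (L * \<delta>\<^sup>2) * norm (J z e) + \<rho> * (2 * L * \<delta> * norm e)"
  proof -
    have "inner (f z' - f z + J z (z - z')) (J z e) \<le> (L * \<delta>\<^sup>2) * norm (J z e)"
      using norm_cauchy_schwarz[of "f z' - f z + J z (z - z')" "J z e"]
        mult_right_mono[OF taylor norm_ge_zero[of "J z e"]] by (simp add: \<delta>_def)
    moreover have "- inner (f z' - b) (J z e - J z' e) \<le> \<rho> * (2 * L * \<delta> * norm e)"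
      using Cauchy_Schwarz_ineq2[of "f z' - b" "J z e - J z' e"]
        mult_left_mono[OF lipschitz[OF e] norm_ge_zero[of "f z' - b"]] by (simp add: \<delta>_def \<rho>_def)
    ultimately show ?thesis
      by simp
  qed
  also have "\<rho> * (2 * L * \<delta> * norm e) \<le> \<rho> * (2 * L * \<delta> * (norm (J z e) / \<gamma>))"
    using lower[OF e] pos by (intro mult_left_mono) (auto simp: \<rho>_def \<delta>_def field_simps)
  finally have "norm (J z e) * norm (J z e) \<le> (L * \<delta>\<^sup>2 + 2 * L * \<rho> / \<gamma> * \<delta>) * norm (J z e)"
    by (simp add: power2_eq_square algebra_simps)
  then have "norm (J z e) \<le> L * \<delta>\<^sup>2 + 2 * L * \<rho> / \<gamma> * \<delta>"
    using pos by (cases "norm (J z e) = 0") (auto simp: \<rho>_def \<delta>_def)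
  also have "\<dots> \<le> (\<gamma> / 4) * \<delta> + (\<gamma> / 4) * \<delta>"
  proof (rule add_mono)
    have "L * \<delta> \<le> \<gamma> / 4"
      using small(2) by (simp add: \<delta>_def)
    then have "(L * \<delta>) * \<delta> \<le> (\<gamma> / 4) * \<delta>"
      by (rule mult_right_mono) (simp add: \<delta>_def)
    then show "L * \<delta>\<^sup>2 \<le> (\<gamma> / 4) * \<delta>"
      by (simp add: power2_eq_square mult.assoc)
    have "2 * L * \<rho> / \<gamma> \<le> \<gamma> / 4"
      using small(1) pos by (simp add: \<rho>_def field_simps power2_eq_square)
    then show "2 * L * \<rho> / \<gamma> * \<delta> \<le> (\<gamma> / 4) * \<delta>"
      by (rule mult_right_mono) (simp add: \<delta>_def)
  qed
  finally have "\<gamma> * norm e \<le> \<gamma> * (\<delta> / 2)"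
    using lower[OF e] by (simp add: algebra_simps)
  then show ?thesis
    using pos by (simp add: e_def \<delta>_def)
qed

text \<open>The minimum of \<open>\<parallel>f x\<parallel>\<close> over the compact unit sphere is the constant.\<close>

lemma injective_bounded_below:
  fixes f :: "'a::real_normed_vector \<Rightarrow> 'b::real_normed_vector"
  assumes compact: "compact (D \<inter> sphere 0 1)" and cont: "continuous_on (D \<inter> sphere 0 1) f"
    and scale: "\<And>r x. x \<in> D \<Longrightarrow> scaleR r x \<in> D" "\<And>r x. f (scaleR r x) = scaleR r (f x)"
    and inj: "\<And>x. x \<in> D \<Longrightarrow> f x = 0 \<Longrightarrow> x = 0"
  obtains \<gamma> where "\<gamma> > 0" "\<And>x. x \<in> D \<Longrightarrow> \<gamma> * norm x \<le> norm (f x)"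
proof (cases "D \<inter> sphere 0 1 = {}")
  case True
  have "x = 0" if "x \<in> D" for x
  proof (rule ccontr)
    assume "x \<noteq> 0"
    then have "scaleR (inverse (norm x)) x \<in> D \<inter> sphere 0 1"
      using scale(1)[OF that] by simp
    with True show False
      by blast
  qed
  then have "1 * norm x \<le> norm (f x)" if "x \<in> D" for x
    using that by (metis mult_1 norm_ge_zero norm_zero)
  then show thesis
    using that[of 1] by simp
next
  case False
  obtain x0 where x0: "x0 \<in> D \<inter> sphere 0 1" "\<And>x. x \<in> D \<inter> sphere 0 1 \<Longrightarrow> norm (f x0) \<le> norm (f x)"
    using continuous_attains_inf[OF compact False continuous_on_norm[OF cont]] by blast
  show thesis
  proof (rule that)
    have "x0 \<noteq> 0" using x0(1) by auto
    then show "norm (f x0) > 0"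
      using inj x0(1) by auto
    fix x assume x: "x \<in> D"
    show "norm (f x0) * norm x \<le> norm (f x)"
    proof (cases "x = 0")
      case False
      have "norm (f x0) \<le> norm (f (scaleR (inverse (norm x)) x))"
        using False scale(1)[OF x] by (intro x0) simp
      then show ?thesis
        using False by (simp add: scale(2) field_simps)
    qed simp
  qed
qed

section \<open>The factorization map\<close>

type_synonym trip = "l2_poly \<times> l2_poly \<times> l2_poly"

text \<open>Triplets \<open>(u, v, w)\<close> with the degree bounds of the algorithm stand for candidates for a GCD
  \<open>u\<close> with cofactors \<open>v\<close> and \<open>w\<close>. The map \<open>fac h\<close> sends them to the scaling condition \<open>\<langle>u, h\<rangle>\<close> and
  the two products; \<open>dfac h z\<close> is its derivative at \<open>z\<close>. Since \<open>fac h\<close> is a quadratic map, the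
  expansion stops with the term \<open>qfac\<close>, which depends neither on \<open>h\<close> nor on the base point.\<close>

definition trips :: "nat \<Rightarrow> nat \<Rightarrow> nat \<Rightarrow> trip set" where
  "trips m n k = deg_le k \<times> deg_le (m - k) \<times> deg_le (n - k)"

definition fac :: "l2_poly \<Rightarrow> trip \<Rightarrow> complex \<times> l2_poly \<times> l2_poly" where
  "fac h = (\<lambda>(u, v, w). (cinner u h, u * v, u * w))"

definition dfac :: "l2_poly \<Rightarrow> trip \<Rightarrow> trip \<Rightarrow> complex \<times> l2_poly \<times> l2_poly" where
  "dfac h = (\<lambda>(u, v, w) (a, b, c). (cinner a h, a * v + u * b, a * w + u * c))"

definition qfac :: "trip \<Rightarrow> complex \<times> l2_poly \<times> l2_poly" where
  "qfac = (\<lambda>(a, b, c). (0, a * b, a * c))"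

text \<open>The Gauss--Newton iterate after \<open>z\<close> is \<open>z - d\<close>. The direction \<open>0\<close> is admissible exactly at
  the critical points of the least squares problem (lemma \<open>gn_direction_0\<close> below), so that these
  are the fixed points of the iteration.\<close>

definition gn_direction ::
  "nat \<Rightarrow> nat \<Rightarrow> nat \<Rightarrow> l2_poly \<Rightarrow> l2_poly \<Rightarrow> l2_poly \<Rightarrow> trip \<Rightarrow> trip \<Rightarrow> bool" where
  "gn_direction m n k h p q z d \<longleftrightarrow> d \<in> trips m n k \<and>
     (\<forall>e\<in>trips m n k. inner (dfac h z d - (fac h z - (1, p, q))) (dfac h z e) = 0)"

text \<open>What local convergence requires: the algorithm takes a step only where the Jacobian is
  injective, so from a starting point in such a ball the iteration never breaks down, and it
  converges linearly to the centre.\<close>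

definition gn_basin ::
  "nat \<Rightarrow> nat \<Rightarrow> nat \<Rightarrow> l2_poly \<Rightarrow> l2_poly \<Rightarrow> l2_poly \<Rightarrow> real \<Rightarrow> real \<Rightarrow> trip \<Rightarrow> bool" where
  "gn_basin m n k h p q \<gamma> \<rho> zs \<longleftrightarrow> (\<forall>z\<in>trips m n k. norm (z - zs) \<le> \<rho> \<longrightarrow>
     (\<forall>d\<in>trips m n k. \<gamma> * norm d \<le> norm (dfac h z d)) \<and>
     (\<forall>d. gn_direction m n k h p q z d \<longrightarrow> norm (z - d - zs) \<le> norm (z - zs) / 2))"

text \<open>For \<open>\<bar>\<alpha>\<bar> = 1\<close> this is an isometry that fixes both products. It is the freedom in the phase of
  the singular vector from which the algorithm starts.\<close>

definition rot :: "complex \<Rightarrow> trip \<Rightarrow> trip" where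
  "rot \<alpha> = (\<lambda>(u, v, w). (smul \<alpha> u, smul (cnj \<alpha>) v, smul (cnj \<alpha>) w))"

lemma cinner_diff_right: "cinner p (q - r) = cinner p q - cinner p r"
  by (metis cinner_commute cinner_diff_left complex_cnj_diff)

lemma trips_closed [intro]:
  "x \<in> trips m n k \<Longrightarrow> y \<in> trips m n k \<Longrightarrow> x + y \<in> trips m n k"
  "x \<in> trips m n k \<Longrightarrow> y \<in> trips m n k \<Longrightarrow> x - y \<in> trips m n k"
  "x \<in> trips m n k \<Longrightarrow> scaleR r x \<in> trips m n k"
  "x \<in> trips m n k \<Longrightarrow> rot \<alpha> x \<in> trips m n k"
  by (auto simp: trips_def rot_def)

lemma compact_trips: "compact (trips m n k \<inter> cball 0 R)"
proof -
  have *: "trips m n k \<inter> cball 0 R =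
    ((deg_le k \<inter> cball 0 R) \<times> (deg_le (m - k) \<inter> cball 0 R) \<times> (deg_le (n - k) \<inter> cball 0 R)) \<inter> cball 0 R"
  proof -
    have "norm a \<le> R \<and> norm b \<le> R \<and> norm c \<le> R" if "norm (a, b, c) \<le> R" for a b c :: l2_poly
      using that norm_fst_le[of a "(b, c)"] norm_snd_le[of "(b, c)" a] norm_fst_le[of b c]
        norm_snd_le[of c b] by linarith
    then show ?thesis
      by (auto simp: trips_def)
  qed
  show ?thesis
    unfolding * by (intro compact_Int_closed compact_Times compact_deg_le closed_cball)
qed

lemma compact_trips_sphere: "compact (trips m n k \<inter> sphere 0 1)"
proof -
  have "closed {x::trip. norm x = 1}"
    by (intro closed_Collect_eq continuous_intros)
  moreover have "{x::trip. norm x = 1} = sphere 0 1"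
    by auto
  ultimately have closed_unit: "closed (sphere (0::trip) 1)"
    by simp
  have "trips m n k \<inter> sphere 0 1 = (trips m n k \<inter> cball 0 1) \<inter> sphere 0 1"
    by auto
  then show ?thesis
    using compact_Int_closed[OF compact_trips closed_unit] by simp
qed

lemma rot_simps:
  "rot \<alpha> (x + y) = rot \<alpha> x + rot \<alpha> y" "rot \<alpha> (x - y) = rot \<alpha> x - rot \<alpha> y"
  "rot \<alpha> (rot \<beta> x) = rot (\<alpha> * \<beta>) x" "rot 1 x = x"
  by (simp_all add: rot_def split_beta smul_simps)

lemma norm_rot: "cmod \<alpha> = 1 \<Longrightarrow> norm (rot \<alpha> x) = norm x"
  by (simp add: rot_def split_beta norm_prod_def)

lemma rot_cancel: "cmod \<alpha> = 1 \<Longrightarrow> rot (cnj \<alpha>) (rot \<alpha> x) = x"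
  using complex_norm_square[of \<alpha>] by (simp add: rot_simps mult.commute)

lemma unimodular_cnj: "cmod \<alpha> = 1 \<Longrightarrow> \<alpha> * cnj \<alpha> = 1"
  using complex_norm_square[of \<alpha>] by simp

text \<open>Because of this invariance, lower bounds for the Jacobian at one factorization hold with the
  same constant at all its rotations.\<close>

lemma dfac_rot:
  assumes "cmod \<alpha> = 1"
  shows "dfac (smul \<alpha> h) (rot \<alpha> z) (rot \<alpha> d) = dfac h z d"
proof -
  have "cinner (smul \<alpha> a) (smul \<alpha> h) = cinner a h" for a
    using unimodular_cnj[OF assms]
    by (subst cinner_smul_left, subst cinner_commute)
      (simp add: cinner_smul_left flip: mult.assoc cinner_commute[of a h])
  then show ?thesis
    using unimodular_cnj[OF assms]
    by (simp add: dfac_def rot_def split_beta smul_simps mult.commute[of "cnj \<alpha>"])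
qed

lemma fac_taylor: "fac h (z + d) = fac h z + dfac h z d + qfac d"
  by (simp add: fac_def dfac_def qfac_def split_beta cinner_add_left algebra_simps)

lemma dfac_linear:
  "dfac h z (x - y) = dfac h z x - dfac h z y"
  "dfac h z (scaleR r x) = scaleR r (dfac h z x)"
  "qfac (scaleR r x) = scaleR (r\<^sup>2) (qfac x)"
  by (simp_all add: dfac_def qfac_def split_beta cinner_diff_left cinner_smul_left algebra_simps
      scaleR_l2_poly_def smul_simps power2_eq_square scaleR_conv_of_real)

lemma gn_direction_0:
  "gn_direction m n k h p q z 0 \<longleftrightarrow> (\<forall>e\<in>trips m n k. inner (fac h z - (1, p, q)) (dfac h z e) = 0)"
proof -
  have "0 \<in> trips m n k" "dfac h z 0 = 0"
    using dfac_linear(1)[of h z 0 0] by (auto simp: trips_def zero_prod_def)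
  then show ?thesis
    by (auto simp: gn_direction_def inner_diff_left)
qed

lemma norm_triple_le: "norm (a, b, c) \<le> norm a + norm b + norm c"
  using norm_Pair_le[of a "(b, c)"] norm_Pair_le[of b c] by linarith

lemma norm_triple_components:
  "norm a \<le> norm (a, b, c)" "norm b \<le> norm (a, b, c)" "norm c \<le> norm (a, b, c)"
  by (metis norm_fst_le norm_snd_le order_trans)+

lemma norm_qfac_le:
  assumes "d \<in> trips m n k"
  shows "norm (qfac d) \<le> 2 * sqrt (real (k + 1)) * (norm d)\<^sup>2"
proof -
  obtain a b c where d: "d = (a, b, c)" by (metis prod_cases3)
  let ?K = "sqrt (real (k + 1))"
  have a: "a \<in> deg_le k"
    using assms by (simp add: trips_def d)
  have "?K * norm a * norm b \<le> ?K * norm d * norm d" "?K * norm a * norm c \<le> ?K * norm d * norm d"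
    unfolding d by (intro mult_mono norm_triple_components; simp)+
  then have "norm (a * b) \<le> ?K * (norm d)\<^sup>2" "norm (a * c) \<le> ?K * (norm d)\<^sup>2"
    using norm_mult_le[OF a, of b] norm_mult_le[OF a, of c]
    unfolding power2_eq_square mult.assoc[symmetric] by linarith+
  then show ?thesis
    using norm_triple_le[of "0::complex" "a * b" "a * c"] by (simp add: qfac_def d)
qed

lemma norm_dfac_diff_le:
  assumes "z \<in> trips m n k" "z' \<in> trips m n k" "d \<in> trips m n k"
  shows "norm (dfac h z d - dfac h' z' d)
    \<le> norm (h - h') * norm d + 4 * sqrt (real (k + 1)) * norm (z - z') * norm d"
proof -
  obtain a b c where d: "d = (a, b, c)" by (metis prod_cases3)
  obtain u v w where z: "z = (u, v, w)" by (metis prod_cases3)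
  obtain u' v' w' where z': "z' = (u', v', w')" by (metis prod_cases3)
  let ?K = "sqrt (real (k + 1))"
  have deg: "a \<in> deg_le k" "u - u' \<in> deg_le k"
    using assms by (auto simp: trips_def d z z')
  have eq: "dfac h z d - dfac h' z' d =
    (cinner a (h - h'), a * (v - v') + (u - u') * b, a * (w - w') + (u - u') * c)"
    by (simp add: dfac_def d z z' cinner_diff_right left_diff_distrib right_diff_distrib)
  have "norm (cinner a (h - h')) \<le> norm d * norm (h - h')"
    using cinner_norm_le[of a "h - h'"] mult_right_mono[OF norm_triple_components(1)[of a b c]]
    unfolding d by (meson norm_ge_zero order_trans)
  moreover have prods: "norm (a * x) \<le> ?K * norm d * norm (z - z')"
    if "norm x \<le> norm (z - z')" for x
  proof -
    have "?K * norm a * norm x \<le> ?K * norm d * norm (z - z')"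
      using that unfolding d by (intro mult_mono norm_triple_components; simp)
    then show ?thesis
      using norm_mult_le[OF deg(1), of x] by linarith
  qed
  moreover have prods': "norm ((u - u') * x) \<le> ?K * norm d * norm (z - z')"
    if "norm x \<le> norm d" for x
  proof -
    have "norm (u - u') \<le> norm (z - z')"
      using norm_triple_components(1) by (simp add: z z')
    then have "?K * norm (u - u') * norm x \<le> ?K * norm (z - z') * norm d"
      using that by (intro mult_mono) auto
    also have "\<dots> = ?K * norm d * norm (z - z')"
      by (simp only: mult_ac)
    finally show ?thesis
      using norm_mult_le[OF deg(2), of x] by linarith
  qed
  moreover have comps: "norm (v - v') \<le> norm (z - z')" "norm (w - w') \<le> norm (z - z')"
    "norm b \<le> norm d" "norm c \<le> norm d"
    using norm_triple_components by (simp_all add: z z' d)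
  ultimately have a: "norm (cinner a (h - h')) \<le> norm d * norm (h - h')"
    and b: "norm (a * (v - v')) + norm ((u - u') * b) \<le> 2 * (?K * norm d * norm (z - z'))"
    and c: "norm (a * (w - w')) + norm ((u - u') * c) \<le> 2 * (?K * norm d * norm (z - z'))"
    using prods[OF comps(1)] prods[OF comps(2)] prods'[OF comps(3)] prods'[OF comps(4)] by linarith+
  have "norm (dfac h z d - dfac h' z' d) \<le> norm d * norm (h - h') + 4 * (?K * norm d * norm (z - z'))"
    unfolding eq
    using norm_triple_le[of "cinner a (h - h')" "a * (v - v') + (u - u') * b" "a * (w - w') + (u - u') * c"]
      norm_triangle_ineq[of "a * (v - v')" "(u - u') * b"]
      norm_triangle_ineq[of "a * (w - w')" "(u - u') * c"] a b c by linarith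
  then show ?thesis
    by (simp add: mult_ac)
qed

section \<open>Pairs of polynomials with a common divisor\<close>

text \<open>A common divisor of maximal degree leaves coprime cofactors, as a common factor of these could
  be moved into the divisor.\<close>

lemma ex_poly_gcds:
  fixes p q :: "complex poly"
  assumes "p \<noteq> 0"
  obtains u v w where "p = u * v" "q = u * w" "coprime v w" "u \<in> poly_gcds p q" "u \<noteq> 0"
proof -
  define u where "u = (ARG_MAX degree d. d dvd p \<and> d dvd q)"
  have "(u dvd p \<and> u dvd q) \<and> (\<forall>d. d dvd p \<and> d dvd q \<longrightarrow> degree d \<le> degree u)"
    unfolding u_def
  proof (rule arg_max_nat_lemma[where k = 1 and b = "Suc (degree p)"])
    show "\<forall>d. d dvd p \<and> d dvd q \<longrightarrow> degree d < Suc (degree p)"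
      using assms by (auto simp: less_Suc_eq_le dvd_imp_degree_le)
  qed simp
  then have u: "u \<in> poly_gcds p q" and *: "u dvd p" "u dvd q" "\<And>d. d dvd p \<Longrightarrow> d dvd q \<Longrightarrow> degree d \<le> degree u"
    by (auto simp: poly_gcds_def)
  obtain v w where vw: "p = u * v" "q = u * w"
    using * by (auto elim!: dvdE)
  have "coprime v w"
  proof (rule coprimeI)
    fix d assume d: "d dvd v" "d dvd w"
    have "degree (u * d) \<le> degree u"
      using d by (intro *(3)) (simp_all add: vw)
    moreover have "d \<noteq> 0" "u \<noteq> 0"
      using assms vw d by auto
    ultimately have "degree d = 0"
      by (simp add: degree_mult_eq)
    then show "is_unit d"
      using \<open>d \<noteq> 0\<close> by (auto simp: is_unit_iff_degree)
  qed
  then show thesis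
    using that vw u assms by auto
qed

lemma coprime_imp_poly_gcds:
  fixes u v w :: "complex poly"
  assumes "coprime v w" "u \<noteq> 0"
  shows "u \<in> poly_gcds (u * v) (u * w)"
proof -
  have "d dvd u" if "d dvd u * v" "d dvd u * w" for d
  proof -
    have "d dvd gcd (u * v) (u * w)"
      using that by simp
    also have "gcd (u * v) (u * w) = normalize (u * gcd v w)"
      by (rule gcd_mult_left)
    finally show ?thesis
      using assms(1) by (simp add: coprime_iff_gcd_eq_1)
  qed
  then show ?thesis
    using assms(2) by (auto simp: poly_gcds_def dvd_imp_degree_le)
qed

lemma poly_pairs_gcdI:
  fixes u v w :: "complex poly"
  assumes "coprime v w" "u \<noteq> 0" "v \<noteq> 0" "w \<noteq> 0" "degree u = k" "degree v = m - k" "degree w = n - k"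
    "k \<le> m" "k \<le> n"
  shows "(u * v, u * w) \<in> poly_pairs_gcd m n k"
  using assms coprime_imp_poly_gcds[OF assms(1,2)]
  by (auto simp: poly_pairs_gcd_def poly_pairs_def degree_mult_eq)

lemma poly_pairs_gcdE:
  assumes "(p, q) \<in> poly_pairs_gcd m n k"
  obtains u v w where "p = u * v" "q = u * w" "coprime v w" "u \<noteq> 0" "v \<noteq> 0" "w \<noteq> 0"
    "degree u = k" "degree v = m - k" "degree w = n - k" "k \<le> m" "k \<le> n"
proof -
  have pq: "p \<noteq> 0" "q \<noteq> 0" "degree p = m" "degree q = n"
    and "\<exists>g\<in>poly_gcds p q. degree g = k"
    using assms by (auto simp: poly_pairs_gcd_def poly_pairs_def)
  then obtain g where g: "g \<in> poly_gcds p q" "degree g = k"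
    by blast
  obtain u v w where u: "p = u * v" "q = u * w" "coprime v w" "u \<in> poly_gcds p q" "u \<noteq> 0"
    using ex_poly_gcds[OF pq(1)] by metis
  have "degree u = k"
    using g u(4) by (auto simp: poly_gcds_def intro: antisym)
  then show thesis
    using u pq by (intro that[of u v w]) (auto simp: degree_mult_eq)
qed

lemma poly_pairs_imp_gcd:
  assumes "(p, q) \<in> poly_pairs m n"
  obtains l where "(p, q) \<in> poly_pairs_gcd m n l" "\<And>d. d dvd p \<Longrightarrow> d dvd q \<Longrightarrow> degree d \<le> l"
proof -
  obtain u where "u \<in> poly_gcds p q"
    using ex_poly_gcds[of p q] assms by (auto simp: poly_pairs_def)
  then show thesis
    using assms by (intro that[of "degree u"]) (auto simp: poly_pairs_gcd_def poly_gcds_def)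
qed

text \<open>This describes the kernel of the Sylvester matrix of a pair with cofactors \<open>v\<close> and \<open>w\<close>: it is
  spanned by the cofactors.\<close>

lemma coprime_cross:
  fixes v w b c :: "complex poly"
  assumes "coprime v w" "v \<noteq> 0" "degree b \<le> degree v" "b * w = c * v"
  obtains s where "b = smult s v" "c = smult s w"
proof -
  have "v dvd b * w"
    using assms(4) by simp
  then have "v dvd b"
    using assms(1) by (simp add: coprime_dvd_mult_left_iff)
  then obtain r where r: "b = v * r"
    by (elim dvdE)
  have "degree r = 0"
    using assms(2,3) by (cases "r = 0") (auto simp: r degree_mult_eq)
  then obtain s where s: "r = [:s:]"
    by (elim degree_eq_zeroE)
  have "smult s w * v = c * v"
    using assms(4) by (simp add: r s mult.commute)
  then have "c = smult s w"
    using assms(2) by (metis mult_right_cancel)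
  then show thesis
    using r s by (intro that) simp_all
qed

lemma degree_pos_imp_root:
  fixes d :: "complex poly"
  assumes "degree d > 0"
  obtains z where "poly d z = 0"
  using fundamental_theorem_of_algebra[of d] assms constant_degree[of d] by auto

lemma ex_factor_of_degree:
  fixes u :: "complex poly"
  assumes "i \<le> degree u"
  obtains a b where "u = a * b" "degree a = i"
  using assms
proof (induction "degree u - i" arbitrary: u thesis)
  case 0
  then show ?case
    by (metis diff_is_0_eq le_antisym mult.right_neutral)
next
  case (Suc d)
  then have pos: "degree u > 0" "u \<noteq> 0"
    by auto
  obtain z where "poly u z = 0"
    using degree_pos_imp_root[OF pos(1)] .
  then obtain u' where u': "u = [:- z, 1:] * u'"
    by (auto simp: poly_eq_0_iff_dvd elim: dvdE)
  have "u' \<noteq> 0"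
    using pos u' by auto
  then have "degree u = Suc (degree u')"
    using u' by (simp add: degree_mult_eq del: mult_pCons_left)
  then have "d = degree u' - i" "i \<le> degree u'"
    using Suc.hyps(2) by auto
  then obtain a b where "u' = a * b" "degree a = i"
    using Suc.hyps(1) by metis
  then show ?case
    using u' by (intro Suc.prems(1)[of a "[:- z, 1:] * b"]) (simp_all add: algebra_simps)
qed

subsection \<open>Perturbation to exact degrees and coprime cofactors\<close>

lemma perturb_to_degree:
  assumes "degree p \<le> l" "e > 0"
  obtains p' where "degree p' = l" "p' \<noteq> 0" "norm (l2 p' - l2 p) < e"
proof (cases "coeff p l = 0")
  case True
  define p' where "p' = p + monom (of_real (e / 2)) l"
  have "coeff p' l \<noteq> 0"
    using True assms(2) by (simp add: p'_def)
  moreover have "degree p' \<le> l"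
    using assms(1) by (auto simp: p'_def degree_monom_le intro: degree_add_le)
  moreover have "norm (l2 p' - l2 p) = e / 2"
    using norm_monom_mult[of "of_real (e / 2)" l 1] norm_pCons[of 1 0] assms(2)
    by (simp add: p'_def l2_simps norm_Pair one_pCons)
  ultimately show thesis
    using assms(2) le_degree[of p' l] by (intro that[of p']) auto
next
  case False
  then show thesis
    using assms le_degree[OF False] by (intro that[of p]) auto
qed

text \<open>Adding a constant \<open>s\<close> to \<open>w\<close> creates a common root with \<open>v\<close> only if \<open>-s\<close> is one of the finitely
  many values that \<open>w\<close> takes at the roots of \<open>v\<close>.\<close>

lemma perturb_to_coprime:
  fixes v w :: "complex poly"
  assumes "v \<noteq> 0" "w \<noteq> 0" "e > 0"
  obtains w' where "degree w' = degree w" "w' \<noteq> 0" "coprime v w'" "norm (l2 w' - l2 w) < e"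
proof (cases "degree w = 0")
  case True
  then have "is_unit w"
    using assms(2) by (simp add: is_unit_iff_degree)
  then show thesis
    using assms by (intro that[of w]) (auto simp: is_unit_right_imp_coprime)
next
  case False
  have "finite ((\<lambda>a. - poly w a) ` {a. poly v a = 0})"
    using poly_roots_finite[OF assms(1)] by simp
  then have "finite (complex_of_real -` ((\<lambda>a. - poly w a) ` {a. poly v a = 0}))"
    by (rule finite_vimageI) (simp add: inj_of_real)
  then have "infinite ({0<..<e} - complex_of_real -` ((\<lambda>a. - poly w a) ` {a. poly v a = 0}))"
    using assms(3) by (simp add: Diff_infinite_finite infinite_Ioo)
  then obtain s where s: "0 < s" "s < e" "complex_of_real s \<notin> (\<lambda>a. - poly w a) ` {a. poly v a = 0}"
    by (metis (no_types, lifting) DiffE finite.emptyI greaterThanLessThan_iff not_finite_existsD vimageI2 ex_in_conv)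
  define w' where "w' = w + [:of_real s:]"
  have deg: "degree w' = degree w"
    using False unfolding w'_def by (intro degree_add_eq_left) simp
  have "coprime v w'"
  proof (rule coprimeI, rule ccontr)
    fix d assume d: "d dvd v" "d dvd w'" "\<not> is_unit d"
    then have "degree d > 0"
      using assms(1) by (auto simp: is_unit_iff_degree)
    then obtain z where "poly d z = 0"
      by (rule degree_pos_imp_root)
    then have "poly v z = 0" "poly w' z = 0"
      using d by (auto elim!: dvdE)
    then have "of_real s = - poly w z"
      by (simp add: w'_def add_eq_0_iff)
    with \<open>poly v z = 0\<close> s(3) show False
      by blast
  qed
  moreover have "norm (l2 w' - l2 w) = s"
    using norm_pCons[of "of_real s" 0] s(1) by (simp add: w'_def l2_simps norm_Pair)
  ultimately show thesis
    using deg False s(2) by (intro that[of w']) auto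
qed

section \<open>The distance to the pairs with a GCD of given degree\<close>

lemma theta_le_member:
  "(r, s) \<in> poly_pairs_gcd m n j \<Longrightarrow> theta m n j p q \<le> ereal (pair_norm (p - r) (q - s))"
  unfolding theta_def by (rule INF_lower2) auto

text \<open>The products need not lie in the set over which the distance is taken: degrees may be too
  small and the cofactors may have a common factor. But arbitrarily small changes of \<open>u\<close>, \<open>v\<close> and \<open>w\<close>
  remove both defects, so the products lie in its closure. This one fact turns the distance
  into a least squares problem on a vector space, and it is behind the monotonicity of the distance
  in the degree and the rejection of too large degrees.\<close>

lemma theta_le_factored:
  assumes "degree u \<le> j" "degree v \<le> m - j" "degree w \<le> n - j" "j \<le> m" "j \<le> n"
  shows "theta m n j p q \<le> ereal (pair_norm (p - u * v) (q - u * w))"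
proof -
  have "\<exists>u' v' w'. coprime v' w' \<and> u' \<noteq> 0 \<and> v' \<noteq> 0 \<and> w' \<noteq> 0 \<and>
      degree u' = j \<and> degree v' = m - j \<and> degree w' = n - j \<and>
      norm (l2 u' - l2 u) < e \<and> norm (l2 v' - l2 v) < e \<and> norm (l2 w' - l2 w) < e" if e: "e > 0" for e :: real
  proof -
    obtain u' where u': "degree u' = j" "u' \<noteq> 0" "norm (l2 u' - l2 u) < e"
      using perturb_to_degree[OF assms(1) e] .
    obtain v' where v': "degree v' = m - j" "v' \<noteq> 0" "norm (l2 v' - l2 v) < e"
      using perturb_to_degree[OF assms(2) e] .
    have "e / 2 > 0"
      using e by simp
    obtain w0 where w0: "degree w0 = n - j" "w0 \<noteq> 0" "norm (l2 w0 - l2 w) < e / 2"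
      using perturb_to_degree[OF assms(3) \<open>e / 2 > 0\<close>] .
    obtain w' where w': "degree w' = degree w0" "w' \<noteq> 0" "coprime v' w'" "norm (l2 w' - l2 w0) < e / 2"
      using perturb_to_coprime[OF v'(2) w0(2) \<open>e / 2 > 0\<close>] .
    have "norm (l2 w' - l2 w) < e"
      using norm_triangle_ineq[of "l2 w' - l2 w0" "l2 w0 - l2 w"] w0(3) w'(4) by simp
    then show ?thesis
      using u' v' w0 w' by (intro exI[of _ u'] exI[of _ v'] exI[of _ w']) simp
  qed
  then have "\<exists>u' v' w'. coprime v' w' \<and> u' \<noteq> 0 \<and> v' \<noteq> 0 \<and> w' \<noteq> 0 \<and>
      degree u' = j \<and> degree v' = m - j \<and> degree w' = n - j \<and> norm (l2 u' - l2 u) < inverse (real (Suc i)) \<and>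
      norm (l2 v' - l2 v) < inverse (real (Suc i)) \<and> norm (l2 w' - l2 w) < inverse (real (Suc i))" for i
    by (simp del: of_nat_Suc)
  then obtain U V W where UVW:
    "\<And>i. coprime (V i) (W i)" "\<And>i. U i \<noteq> 0" "\<And>i. V i \<noteq> 0" "\<And>i. W i \<noteq> 0"
    "\<And>i. degree (U i) = j" "\<And>i. degree (V i) = m - j" "\<And>i. degree (W i) = n - j"
    and close: "\<And>i. norm (l2 (U i) - l2 u) < inverse (real (Suc i))"
      "\<And>i. norm (l2 (V i) - l2 v) < inverse (real (Suc i))" "\<And>i. norm (l2 (W i) - l2 w) < inverse (real (Suc i))"
    by metis
  have conv: "(\<lambda>i. l2 (f i)) \<longlonglongrightarrow> l2 a"
    if "\<And>i. norm (l2 (f i) - l2 a) < inverse (real (Suc i))" for f a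
  proof -
    have "(\<lambda>i. l2 (f i) - l2 a) \<longlonglongrightarrow> 0"
      using that less_imp_le
      by (intro Lim_null_comparison[OF always_eventually LIMSEQ_inverse_real_of_nat]) blast
    then show ?thesis
      by (simp add: LIM_zero_iff)
  qed
  have "(\<lambda>i. l2 (U i) * l2 (V i)) \<longlonglongrightarrow> l2 u * l2 v" "(\<lambda>i. l2 (U i) * l2 (W i)) \<longlonglongrightarrow> l2 u * l2 w"
    using assms UVW by (auto intro!: tendsto_mult_deg_le[where l = j] conv close)
  then have "(\<lambda>i. norm (l2 p - l2 (U i) * l2 (V i), l2 q - l2 (U i) * l2 (W i)))
      \<longlonglongrightarrow> norm (l2 p - l2 u * l2 v, l2 q - l2 u * l2 w)"
    by (intro tendsto_intros)
  then have lim: "(\<lambda>i. ereal (pair_norm (p - U i * V i) (q - U i * W i)))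
      \<longlonglongrightarrow> ereal (pair_norm (p - u * v) (q - u * w))"
    by (simp add: pair_norm_eq_norm l2_simps)
  have "theta m n j p q \<le> ereal (pair_norm (p - U i * V i) (q - U i * W i))" for i
    using UVW assms(4,5) by (intro theta_le_member poly_pairs_gcdI)
  then show ?thesis
    by (intro LIMSEQ_le_const[OF lim]) auto
qed

text \<open>Over the complex numbers a part of the GCD of any smaller degree can be split off, and the
  rest be moved into the cofactors.\<close>

lemma theta_mono:
  assumes "i \<le> j"
  shows "theta m n i p q \<le> theta m n j p q"
  unfolding theta_def[of m n j]
proof (rule INF_greatest, clarify)
  fix r s assume "(r, s) \<in> poly_pairs_gcd m n j"
  then obtain u v w where *: "r = u * v" "s = u * w" "u \<noteq> 0" "v \<noteq> 0" "w \<noteq> 0" "degree u = j"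
    "degree v = m - j" "degree w = n - j" "j \<le> m" "j \<le> n"
    by (rule poly_pairs_gcdE)
  obtain a b where ab: "u = a * b" "degree a = i"
    using ex_factor_of_degree[of i u] assms * by metis
  then have "degree a + degree b = j"
    using * by (auto simp: degree_mult_eq)
  then have "theta m n i p q \<le> ereal (pair_norm (p - a * (b * v)) (q - a * (b * w)))"
    using * ab assms
    by (intro theta_le_factored order_trans[OF degree_mult_le]) auto
  then show "theta m n i p q \<le> ereal (pair_norm (p - r) (q - s))"
    by (simp add: * ab mult.assoc)
qed

lemma pair_norm_triangle:
  "pair_norm (p - r) (q - s) \<le> pair_norm (p - p') (q - q') + pair_norm (p' - r) (q' - s)"
  using norm_triangle_ineq[of "(l2 (p - p'), l2 (q - q'))" "(l2 (p' - r), l2 (q' - s))"]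
  by (simp add: pair_norm_eq_norm l2_simps)

lemma pair_norm_commute: "pair_norm (p - r) (q - s) = pair_norm (r - p) (s - q)"
  using norm_minus_cancel[of "(l2 (p - r), l2 (q - s))"]
  by (simp add: pair_norm_eq_norm l2_simps)

lemma theta_triangle:
  "theta m n j p q \<le> ereal (pair_norm (p - p') (q - q')) + theta m n j p' q'"
proof -
  have "theta m n j p q - ereal (pair_norm (p - p') (q - q')) \<le> theta m n j p' q'"
    unfolding theta_def[of m n j p']
  proof (rule INF_greatest, clarify)
    fix r s assume "(r, s) \<in> poly_pairs_gcd m n j"
    then have "theta m n j p q \<le> ereal (pair_norm (p - r) (q - s))"
      by (rule theta_le_member)
    also have "\<dots> \<le> ereal (pair_norm (p - p') (q - q') + pair_norm (p' - r) (q' - s))"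
      by (simp add: pair_norm_triangle)
    finally show "theta m n j p q - ereal (pair_norm (p - p') (q - q')) \<le> ereal (pair_norm (p' - r) (q' - s))"
      by (simp add: ereal_minus_le add.commute)
  qed
  then show ?thesis
    by (simp add: ereal_minus_le add.commute)
qed

lemma num_gcd_degree_eqI:
  assumes "theta m n k p q < ereal \<epsilon>" "\<And>j. j > k \<Longrightarrow> ereal \<epsilon> \<le> theta m n j p q"
  shows "num_gcd_degree m n \<epsilon> p q = k"
proof -
  have le: "j \<le> k" if "theta m n j p q < ereal \<epsilon>" for j
    using assms(2)[of j] that by (meson leD not_le)
  then have "{j. theta m n j p q < ereal \<epsilon>} \<subseteq> {..k}"
    by blast
  then have "finite {j. theta m n j p q < ereal \<epsilon>}"
    by (rule finite_subset) simp
  then show ?thesis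
    unfolding num_gcd_degree_def by (rule Max_eqI) (use le assms(1) in blast)+
qed

section \<open>Best approximation by products\<close>

lemma norm_Pair_mono:
  assumes "norm a \<le> t * norm c" "norm b \<le> t * norm d" "t \<ge> 0"
  shows "norm (a, b) \<le> t * norm (c, d)"
proof -
  have "(norm (a, b))\<^sup>2 \<le> (t * norm (c, d))\<^sup>2"
    using power_mono[OF assms(1), of 2] power_mono[OF assms(2), of 2]
    by (simp add: norm_prod_def power_mult_distrib distrib_left)
  then show ?thesis
    by (rule power2_le_imp_le) (simp add: assms(3))
qed

lemma compact_deg_le_sphere: "compact (deg_le l \<inter> {p. norm p = 1})"
proof -
  have "closed {p::l2_poly. norm p = 1}"
    by (intro closed_Collect_eq continuous_intros)
  then have "compact ((deg_le l \<inter> cball 0 1) \<inter> {p. norm p = 1})"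
    by (intro compact_Int_closed compact_deg_le)
  moreover have "(deg_le l \<inter> cball 0 1) \<inter> {p. norm p = 1} = deg_le l \<inter> {p. norm p = 1}"
    by auto
  ultimately show ?thesis
    by simp
qed

lemma norm_one_l2: "norm (1 :: l2_poly) = 1"
  using norm_pCons[of 1 0] by (simp add: l2_simps norm_Pair one_pCons[symmetric])

text \<open>The product of two polynomials on the unit spheres never vanishes, and the spheres are compact
  once the degrees are bounded.\<close>

lemma norm_mult_ge:
  obtains c where "c > 0" "\<And>a b. a \<in> deg_le i \<Longrightarrow> b \<in> deg_le j \<Longrightarrow> c * norm a * norm b \<le> norm (a * b)"
proof -
  define S where "S = (deg_le i \<inter> {p. norm p = 1}) \<times> (deg_le j \<inter> {p. norm p = 1})"
  have "compact S"
    unfolding S_def by (intro compact_Times compact_deg_le_sphere)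
  moreover have "(1, 1) \<in> S"
    by (simp add: S_def deg_le_def norm_one_l2)
  then have "S \<noteq> {}"
    by blast
  moreover have "continuous_on S (\<lambda>x. norm (fst x * snd x))"
    by (intro continuous_on_norm continuous_on_mult_deg_le[where l = i] continuous_intros) (auto simp: S_def)
  ultimately obtain x where x: "x \<in> S" "\<And>y. y \<in> S \<Longrightarrow> norm (fst x * snd x) \<le> norm (fst y * snd y)"
    using continuous_attains_inf[of S "\<lambda>x. norm (fst x * snd x)"] by blast
  show thesis
  proof (rule that)
    have "fst x \<noteq> 0" "snd x \<noteq> 0"
      using x(1) by (auto simp: S_def)
    then show "norm (fst x * snd x) > 0"
      by simp
    fix a b assume ab: "a \<in> deg_le i" "b \<in> deg_le j"
    show "norm (fst x * snd x) * norm a * norm b \<le> norm (a * b)"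
    proof (cases "a = 0 \<or> b = 0")
      case False
      let ?a = "scaleR (inverse (norm a)) a" and ?b = "scaleR (inverse (norm b)) b"
      have "(?a, ?b) \<in> S"
        using ab False by (auto simp: S_def)
      then have "norm (fst x * snd x) \<le> norm (?a * ?b)"
        using x(2) by fastforce
      also have "?a * ?b = scaleR (inverse (norm a) * inverse (norm b)) (a * b)"
        by (simp add: scaleR_l2_poly_def smul_simps mult.commute)
      finally show ?thesis
        using False by (simp add: field_simps)
    qed auto
  qed
qed

lemma norm_Pair_mult_ge:
  obtains c where "c > 0" "\<And>u v w. (u, v, w) \<in> trips m n k \<Longrightarrow>
    c * norm u * norm (v, w) \<le> norm (u * v, u * w)"
proof -
  obtain c1 where c1: "c1 > 0" "\<And>a b. a \<in> deg_le k \<Longrightarrow> b \<in> deg_le (m - k) \<Longrightarrow> c1 * norm a * norm b \<le> norm (a * b)"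
    using norm_mult_ge by blast
  obtain c2 where c2: "c2 > 0" "\<And>a b. a \<in> deg_le k \<Longrightarrow> b \<in> deg_le (n - k) \<Longrightarrow> c2 * norm a * norm b \<le> norm (a * b)"
    using norm_mult_ge by blast
  show thesis
  proof (rule that)
    show "min c1 c2 > 0"
      using c1(1) c2(1) by simp
    fix u v w assume "(u, v, w) \<in> trips m n k"
    then have t: "u \<in> deg_le k" "v \<in> deg_le (m - k)" "w \<in> deg_le (n - k)"
      by (auto simp: trips_def)
    have "min c1 c2 * norm u * norm v \<le> c1 * norm u * norm v"
      "min c1 c2 * norm u * norm w \<le> c2 * norm u * norm w"
      by (intro mult_right_mono; simp)+
    then have le: "min c1 c2 * norm u * norm v \<le> norm (u * v)" "min c1 c2 * norm u * norm w \<le> norm (u * w)"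
      using c1(2)[OF t(1,2)] c2(2)[OF t(1,3)] by linarith+
    let ?t = "min c1 c2 * norm u"
    have nonneg: "0 \<le> ?t * norm v" "0 \<le> ?t * norm w"
      using c1(1) c2(1) by auto
    have "(?t * norm (v, w))\<^sup>2 = (?t * norm v)\<^sup>2 + (?t * norm w)\<^sup>2"
      by (simp add: norm_prod_def power_mult_distrib distrib_left)
    also have "\<dots> \<le> (norm (u * v, u * w))\<^sup>2"
      using power_mono[OF le(1) nonneg(1), of 2] power_mono[OF le(2) nonneg(2), of 2]
      by (simp add: norm_prod_def)
    finally show "?t * norm (v, w) \<le> norm (u * v, u * w)"
      by (rule power2_le_imp_le) simp
  qed
qed

text \<open>The products grow at least linearly with \<open>\<parallel>u\<parallel>\<close>, so outside a large ball the choice \<open>0\<close> is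
  better, and inside the ball compactness applies.\<close>

lemma ex_best_cofactor:
  assumes "v \<in> deg_le (m - k)" "w \<in> deg_le (n - k)" "(v, w) \<noteq> 0"
  obtains u where "u \<in> deg_le k"
    "\<And>u'. u' \<in> deg_le k \<Longrightarrow> norm (u * v - p, u * w - q) \<le> norm (u' * v - p, u' * w - q)"
proof -
  obtain c where c: "c > 0" "\<And>u v w. (u, v, w) \<in> trips m n k \<Longrightarrow>
      c * norm u * norm (v, w) \<le> norm (u * v, u * w)"
    using norm_Pair_mult_ge[where m = m and n = n and k = k] by blast
  define c' where "c' = c * norm (v, w)"
  have c': "c' > 0" "\<And>u. u \<in> deg_le k \<Longrightarrow> c' * norm u \<le> norm (u * v, u * w)"
    using c(1) assms(3) c(2)[of _ v w] assms(1,2) by (simp_all add: c'_def trips_def mult_ac)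
  define R where "R = 2 * norm (p, q) / c'"
  define T where "T = deg_le k \<inter> cball 0 R"
  define f where "f = (\<lambda>u. norm (u * v - p, u * w - q))"
  have "compact T"
    unfolding T_def by (rule compact_deg_le)
  moreover have "0 \<in> T"
    using c'(1) by (auto simp: T_def R_def)
  moreover have "continuous_on T f"
    unfolding f_def
    by (intro continuous_on_norm continuous_on_Pair continuous_on_diff continuous_on_mult_deg_le
        continuous_on_id continuous_on_const) (auto simp: T_def)
  ultimately obtain u where u: "u \<in> T" "\<And>u'. u' \<in> T \<Longrightarrow> f u \<le> f u'"
    using continuous_attains_inf by (metis empty_iff)
  show thesis
  proof (rule that)
    show "u \<in> deg_le k"
      using u(1) by (simp add: T_def)
    fix u' assume u': "u' \<in> deg_le k"
    have "f u \<le> f u'"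
    proof (cases "u' \<in> T")
      case False
      then have "R < norm u'"
        using u' by (auto simp: T_def)
      then have "2 * norm (p, q) < c' * norm u'"
        using c'(1) by (simp add: R_def field_simps)
      then have "2 * norm (p, q) < norm (u' * v, u' * w)"
        using c'(2)[OF u'] by linarith
      then have "norm (p, q) \<le> f u'"
        using norm_triangle_ineq2[of "(u' * v, u' * w)" "(p, q)"] by (simp add: f_def)
      moreover have "f u \<le> norm (p, q)"
        using u(2)[OF \<open>0 \<in> T\<close>] norm_minus_cancel[of "(p, q)"] by (simp add: f_def)
      ultimately show ?thesis
        by simp
    qed (rule u(2))
    then show "norm (u * v - p, u * w - q) \<le> norm (u' * v - p, u' * w - q)"
      by (simp add: f_def)
  qed
qed

text \<open>The scaling \<open>(u, v, w) \<mapsto> (u / c, c v, c w)\<close> leaves the products unchanged; fixing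
  \<open>\<parallel>(v, w)\<parallel> = 1\<close> and discarding large \<open>u\<close>, which are worse than \<open>u = 0\<close>, leaves a compact set.\<close>

lemma ex_best_factorization:
  obtains u v w where "(u, v, w) \<in> trips m n k" "norm (v, w) = 1"
    "\<And>u' v' w'. (u', v', w') \<in> trips m n k \<Longrightarrow>
      norm (u * v - p, u * w - q) \<le> norm (u' * v' - p, u' * w' - q)"
proof -
  obtain c where c: "c > 0" "\<And>u v w. (u, v, w) \<in> trips m n k \<Longrightarrow>
      c * norm u * norm (v, w) \<le> norm (u * v, u * w)"
    using norm_Pair_mult_ge[where m = m and n = n and k = k] by blast
  define R where "R = 2 * norm (p, q) / c"
  define T where "T = (trips m n k \<inter> cball 0 (R + 1)) \<inter> ({t. norm (snd t) = 1} \<inter> {t. norm (fst t) \<le> R})"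
  define f where "f = (\<lambda>(u::l2_poly, v, w). norm (u * v - p, u * w - q))"
  have "closed {t::trip. norm (snd t) = 1}" "closed {t::trip. norm (fst t) \<le> R}"
    by (intro closed_Collect_eq closed_Collect_le continuous_intros)+
  then have "compact T"
    unfolding T_def by (intro compact_Int_closed compact_trips closed_Int)
  have R: "R \<ge> 0"
    using c(1) by (simp add: R_def)
  have T_I: "(u, v, w) \<in> T" if "(u, v, w) \<in> trips m n k" "norm (v, w) = 1" "norm u \<le> R" for u v w
    using that norm_Pair_le[of u "(v, w)"] by (simp add: T_def)
  have zero_in_T: "(0, v, w) \<in> T" if "(u, v, w) \<in> trips m n k" "norm (v, w) = 1" for u v w
    using that R by (intro T_I) (auto simp: trips_def)
  have "(0, 1, 0) \<in> T"
    using R by (intro T_I) (auto simp: trips_def deg_le_def norm_one_l2 norm_Pair)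
  moreover have "continuous_on T f"
    unfolding f_def split_beta
    by (intro continuous_on_norm continuous_on_Pair continuous_on_diff
        continuous_on_mult_deg_le[where l = k] continuous_intros) (auto simp: T_def trips_def)
  ultimately obtain t where t: "t \<in> T" "\<And>t'. t' \<in> T \<Longrightarrow> f t \<le> f t'"
    using continuous_attains_inf[OF \<open>compact T\<close>] by (metis empty_iff)
  obtain u v w where uvw: "t = (u, v, w)"
    by (metis prod_cases3)
  have tT: "(u, v, w) \<in> trips m n k" "norm (v, w) = 1"
    using t(1) by (auto simp: T_def uvw)
  have le0: "f t \<le> norm (p, q)"
    using t(2)[OF zero_in_T[OF tT]] norm_minus_cancel[of "(p, q)"] by (simp add: f_def)
  show thesis
  proof (rule that[OF tT])
    fix u' v' w' assume t': "(u', v', w') \<in> trips m n k"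
    let ?N = "norm (v', w')"
    \<comment> \<open>Either the candidate is no better than \<open>u = 0\<close>, or it can be rescaled into the compact set.\<close>
    have "f t \<le> f (u', v', w')"
    proof (cases "?N = 0 \<or> norm u' * ?N > R")
      case True
      then have "norm (p, q) \<le> f (u', v', w')"
      proof
        assume "?N = 0"
        then have "v' = 0" "w' = 0"
          by (auto simp: prod_eq_iff zero_prod_def)
        then show ?thesis
          using norm_minus_cancel[of "(p, q)"] by (simp add: f_def)
      next
        assume "norm u' * ?N > R"
        then have "2 * norm (p, q) < c * norm u' * ?N"
          using c(1) by (simp add: R_def field_simps)
        then show ?thesis
          using c(2)[OF t'] norm_triangle_ineq2[of "(u' * v', u' * w')" "(p, q)"] by (simp add: f_def)
      qed
      then show ?thesis
        using le0 by simp
    next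
      case False
      let ?t = "(scaleR ?N u', scaleR (1 / ?N) v', scaleR (1 / ?N) w')"
      have "norm (scaleR (1 / ?N) (v', w')) = 1"
        using False by (simp only: norm_scaleR) simp
      then have "?t \<in> T"
        using t' False by (intro T_I) (auto simp: trips_def mult.commute)
      moreover have "f ?t = f (u', v', w')"
        using False by (simp add: f_def scaleR_l2_poly_def smul_simps flip: of_real_mult)
      ultimately show ?thesis
        using t(2) by metis
    qed
    then show "norm (u * v - p, u * w - q) \<le> norm (u' * v' - p, u' * w' - q)"
      by (simp add: f_def uvw)
  qed
qed

section \<open>Stability of the factorization\<close>

text \<open>The rescaling that the algorithm applies to its initial triplet.\<close>

definition normalize_trip :: "trip \<Rightarrow> trip" where
  "normalize_trip = (\<lambda>(u, v, w). (scaleR (1 / norm u) u, scaleR (norm u) v, scaleR (norm u) w))"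

lemma normalize_trip_rot: "cmod \<alpha> = 1 \<Longrightarrow> normalize_trip (rot \<alpha> t) = rot \<alpha> (normalize_trip t)"
  by (simp add: normalize_trip_def rot_def split_beta scaleR_l2_poly_def smul_simps mult.commute)

text \<open>An exact pair \<open>(uh vh, uh wh)\<close> with its GCD \<open>uh\<close> scaled to norm 1, as the algorithm scales its
  first component.\<close>

locale reference_factorization =
  fixes m n k :: nat and uh vh wh :: "complex poly"
  assumes degrees: "degree uh = k" "degree vh = m - k" "degree wh = n - k" "k \<le> m" "k \<le> n"
    and cofactors: "coprime vh wh" "vh \<noteq> 0" "wh \<noteq> 0"
    and unit: "norm (l2 uh) = 1"
begin

definition zh :: trip where
  "zh = (l2 uh, l2 vh, l2 wh)"

text \<open>One constant that dominates the factors \<open>\<surd>(l + 1)\<close> of the product estimate for all degrees in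
  play.\<close>

definition K :: real where
  "K = sqrt (real (m + n + 1))"

lemma K_ge: "K \<ge> 1" "sqrt (real (k + 1)) \<le> K" "sqrt (real (m - k + 1)) \<le> K" "sqrt (real (n - k + 1)) \<le> K"
  using degrees(4) by (auto simp: K_def)

lemma zh_in_trips: "zh \<in> trips m n k"
  using degrees by (simp add: zh_def trips_def)

lemma uh_nonzero: "uh \<noteq> 0"
  using unit by (auto simp: l2_simps)

lemma kernel:
  assumes "b \<in> deg_le (m - k)" "b * l2 wh = c * l2 vh"
  obtains s where "b = smul s (l2 vh)" "c = smul s (l2 wh)"
proof -
  have eq: "poly_of b * wh = poly_of c * vh"
    using arg_cong[OF assms(2), of poly_of] by simp
  have deg: "degree (poly_of b) \<le> degree vh"
    using assms(1) degrees by (simp add: deg_le_def)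
  obtain s where "poly_of b = smult s vh" "poly_of c = smult s wh"
    using coprime_cross[OF cofactors(1,2) deg eq] .
  then show thesis
    by (intro that[of s]) (simp_all add: poly_of_eq_iff)
qed

text \<open>If \<open>(a, b, c)\<close> is in the kernel, then \<open>a\<close> can be eliminated from the two product equations,
  which shows that \<open>(b, c)\<close> is a multiple \<open>s (vh, wh)\<close>; then \<open>a = -s uh\<close>. This is the tangent to the scaling
  orbit, which the equation \<open>\<langle>a, uh\<rangle> = 0\<close> excludes.\<close>

lemma dfac_injective:
  assumes "d \<in> trips m n k" "dfac (l2 uh) zh d = 0"
  shows "d = 0"
proof -
  obtain a b c where d: "d = (a, b, c)" by (metis prod_cases3)
  have eqs: "cinner a (l2 uh) = 0" "a * l2 vh + l2 uh * b = 0" "a * l2 wh + l2 uh * c = 0"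
    using assms(2) by (auto simp: dfac_def d zh_def prod_eq_iff)
  have "l2 uh * (b * l2 wh - c * l2 vh) = (a * l2 vh + l2 uh * b) * l2 wh - (a * l2 wh + l2 uh * c) * l2 vh"
    by (simp add: algebra_simps)
  then have "l2 uh * (b * l2 wh - c * l2 vh) = 0"
    by (simp only: eqs mult_zero_left diff_self)
  then have "b * l2 wh = c * l2 vh"
    using unit by auto
  moreover have "b \<in> deg_le (m - k)"
    using assms(1) by (simp add: trips_def d)
  ultimately obtain s where s: "b = smul s (l2 vh)" "c = smul s (l2 wh)"
    using kernel by metis
  have "(a + smul s (l2 uh)) * l2 vh = 0"
    using eqs(2) by (simp add: s smul_simps distrib_right)
  moreover have "l2 vh \<noteq> 0"
    using cofactors(2) by (simp flip: l2_simps(6))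
  ultimately have a: "a = - smul s (l2 uh)"
    by (simp add: eq_neg_iff_add_eq_0)
  then have "s = 0"
    using eqs(1) by (simp add: smul_simps cinner_smul_left cinner_self_norm unit)
  then show ?thesis
    by (simp add: a s d smul_simps zero_prod_def)
qed

lemma bounded_linear_cinner: "bounded_linear (\<lambda>a. cinner a h)"
  by (rule bounded_linear_intro[where K = "norm h"])
    (simp_all add: cinner_add_left cinner_smul_left scaleR_l2_poly_def cinner_norm_le scaleR_conv_of_real)

lemma dfac_bounded_below:
  obtains \<gamma> where "\<gamma> > 0" "\<And>d. d \<in> trips m n k \<Longrightarrow> \<gamma> * norm d \<le> norm (dfac (l2 uh) zh d)"
proof (rule injective_bounded_below[where f = "dfac (l2 uh) zh", OF compact_trips_sphere])
  show "continuous_on (trips m n k \<inter> sphere 0 1) (dfac (l2 uh) zh)"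
    unfolding dfac_def zh_def split_beta prod.sel
    by (intro continuous_on_Pair continuous_on_add continuous_on_mult_deg_le[where l = k]
        bounded_linear.continuous_on[OF bounded_linear_cinner] continuous_intros)
      (use degrees in \<open>auto simp: trips_def\<close>)
qed (use dfac_injective in \<open>auto simp: dfac_linear that\<close>)

definition Nh :: real where
  "Nh = norm (l2 vh, l2 wh)"

lemma Nh_pos: "Nh > 0"
  using cofactors(2) unfolding Nh_def by (simp add: zero_prod_def flip: l2_simps(6))

lemma normalize_zh: "normalize_trip (scaleR Nh (l2 uh), scaleR (1 / Nh) (l2 vh), scaleR (1 / Nh) (l2 wh)) = zh"
  using Nh_pos by (simp add: normalize_trip_def zh_def unit)

text \<open>The unit vectors at distance at least \<open>\<kappa>\<close> from all rotations of the unit cofactor vector form a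
  compact set that does not meet the kernel of the Sylvester matrix of the exact pair, hence
  the minimum of the norm of the image over this set is positive.\<close>

lemma kernel_stable:
  assumes "\<kappa> > 0"
  obtains c where "c > 0"
    "\<And>v w. v \<in> deg_le (m - k) \<Longrightarrow> w \<in> deg_le (n - k) \<Longrightarrow> norm (v, w) = 1 \<Longrightarrow>
      norm (v * l2 wh - w * l2 vh) < c \<Longrightarrow>
      \<exists>\<alpha>. cmod \<alpha> = 1 \<and> norm ((smul \<alpha> v, smul \<alpha> w) - scaleR (1 / Nh) (l2 vh, l2 wh)) < \<kappa>"
proof -
  define xh where "xh = scaleR (1 / Nh) (l2 vh, l2 wh)"
  define X where "X = ((deg_le (m - k) \<inter> cball 0 1) \<times> (deg_le (n - k) \<inter> cball 0 1)) \<inter>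
    ({x. norm x = 1} \<inter> (\<Inter>\<alpha>\<in>{\<alpha>. cmod \<alpha> = 1}. {x. \<kappa> \<le> norm ((smul \<alpha> (fst x), smul \<alpha> (snd x)) - xh)}))"
  define f where "f = (\<lambda>x. norm (fst x * l2 wh - snd x * l2 vh))"
  have "closed {x. \<kappa> \<le> norm ((smul \<alpha> (fst x), smul \<alpha> (snd x)) - xh)}" for \<alpha>
    by (intro closed_Collect_le continuous_on_norm continuous_on_diff continuous_on_Pair
        bounded_linear.continuous_on[OF bounded_linear_smul] continuous_intros)
  moreover have "closed {x::l2_poly \<times> l2_poly. norm x = 1}"
    by (intro closed_Collect_eq continuous_intros)
  ultimately have compact: "compact X"
    unfolding X_def
    by (intro compact_Int_closed compact_Times compact_deg_le closed_Int closed_INT ballI)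
  have cont: "continuous_on X f"
    unfolding f_def
    by (intro continuous_on_norm continuous_on_diff continuous_on_mult_deg_le[where l = "m - k"]
        continuous_on_mult_deg_le[where l = "n - k"] continuous_intros) (auto simp: X_def)
  have in_X: "(v, w) \<in> X" if "v \<in> deg_le (m - k)" "w \<in> deg_le (n - k)" "norm (v, w) = 1"
    "\<not> (\<exists>\<alpha>. cmod \<alpha> = 1 \<and> norm ((smul \<alpha> v, smul \<alpha> w) - xh) < \<kappa>)" for v w
    using that norm_fst_le[of v w] norm_snd_le[of w v] by (auto simp: X_def not_less)
  have pos: "f x > 0" if "x \<in> X" for x
  proof (rule ccontr)
    assume "\<not> f x > 0"
    then have "fst x * l2 wh = snd x * l2 vh"
      by (simp add: f_def)
    moreover have "fst x \<in> deg_le (m - k)"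
      using that by (auto simp: X_def)
    ultimately obtain s where s: "fst x = smul s (l2 vh)" "snd x = smul s (l2 wh)"
      using kernel by blast
    then have x: "x = (smul s (l2 vh), smul s (l2 wh))"
      by (simp add: prod_eq_iff)
    have "norm x = cmod s * Nh"
      by (simp add: x Nh_def norm_prod_def power_mult_distrib real_sqrt_mult flip: distrib_left)
    moreover have "norm x = 1"
      using that by (simp add: X_def)
    ultimately have s_Nh: "cmod s * Nh = 1"
      by simp
    define \<alpha> where "\<alpha> = cnj s * of_real Nh"
    have \<alpha>: "cmod \<alpha> = 1"
      using s_Nh Nh_pos by (simp add: \<alpha>_def norm_mult)
    have "\<alpha> * s = of_real (1 / Nh)"
    proof -
      have "\<alpha> * s = of_real Nh * of_real ((cmod s)\<^sup>2)"
        by (simp only: \<alpha>_def complex_norm_square mult_ac)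
      also have "\<dots> = of_real (Nh * (cmod s)\<^sup>2)"
        by simp
      also have "Nh * (cmod s)\<^sup>2 = 1 / Nh"
        using s_Nh Nh_pos by (simp add: field_simps power2_eq_square)
      finally show ?thesis .
    qed
    then have "(smul \<alpha> (fst x), smul \<alpha> (snd x)) - xh = 0"
      by (simp add: x xh_def smul_simps scaleR_l2_poly_def zero_prod_def)
    then show False
      using that \<alpha> assms by (auto simp: X_def dest!: bspec[of _ _ \<alpha>])
  qed
  show thesis
  proof (cases "X = {}")
    case True
    show thesis
      by (rule that[of 1]) (use in_X True in \<open>auto simp: xh_def\<close>)
  next
    case False
    obtain x0 where x0: "x0 \<in> X" "\<And>x. x \<in> X \<Longrightarrow> f x0 \<le> f x"
      using continuous_attains_inf[OF compact False cont] by blast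
    show thesis
    proof (rule that[of "f x0"])
      show "f x0 > 0"
        using pos x0(1) .
      fix v w assume vw: "v \<in> deg_le (m - k)" "w \<in> deg_le (n - k)" "norm (v, w) = 1"
        "norm (v * l2 wh - w * l2 vh) < f x0"
      then have "f (v, w) < f x0"
        by (simp add: f_def)
      then have "(v, w) \<notin> X"
        using x0(2)[of "(v, w)"] by linarith
      then show "\<exists>\<alpha>. cmod \<alpha> = 1 \<and> norm ((smul \<alpha> v, smul \<alpha> w) - scaleR (1 / Nh) (l2 vh, l2 wh)) < \<kappa>"
        using in_X[OF vw(1-3)] by (auto simp: xh_def)
    qed
  qed
qed

lemma norm_uh_mult: "norm (l2 uh * x) \<le> K * norm x" "norm (l2 uh * x, l2 uh * y) \<le> K * norm (x, y)"
proof -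
  have *: "norm (l2 uh * x) \<le> K * norm x" for x
  proof -
    have "norm (l2 uh * x) \<le> sqrt (real (k + 1)) * norm (l2 uh) * norm x"
      by (rule norm_mult_le) (simp add: degrees)
    also have "\<dots> \<le> K * norm x"
      unfolding unit mult_1_right by (intro mult_right_mono K_ge) simp
    finally show ?thesis .
  qed
  show "norm (l2 uh * x) \<le> K * norm x"
    by (rule *)
  show "norm (l2 uh * x, l2 uh * y) \<le> K * norm (x, y)"
    using K_ge(1) by (intro norm_Pair_mono *) simp
qed

lemma normalize_trip_continuous:
  assumes "\<kappa> > 0"
  obtains \<kappa>' where "\<kappa>' > 0" "\<And>u v w. norm ((u, v, w) - (scaleR Nh (l2 uh), scaleR (1 / Nh) (l2 vh, l2 wh))) < \<kappa>'
    \<Longrightarrow> u \<noteq> 0 \<and> norm (normalize_trip (u, v, w) - zh) < \<kappa>"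
proof -
  define t0 where "t0 = (scaleR Nh (l2 uh), scaleR (1 / Nh) (l2 vh, l2 wh))"
  have fst0: "norm (fst t0) = Nh"
    using Nh_pos unit by (simp add: t0_def)
  have "continuous (at t0) normalize_trip"
    unfolding normalize_trip_def split_beta using fst0 Nh_pos by (intro continuous_intros) auto
  then obtain d where d: "d > 0" "\<And>t. dist t t0 < d \<Longrightarrow> dist (normalize_trip t) (normalize_trip t0) < \<kappa>"
    using assms unfolding continuous_at_eps_delta by blast
  have 0: "normalize_trip t0 = zh"
    using normalize_zh by (simp add: t0_def)
  show thesis
  proof (rule that[of "min d Nh"])
    show "min d Nh > 0"
      using d(1) Nh_pos by simp
    fix u v w assume *: "norm ((u, v, w) - (scaleR Nh (l2 uh), scaleR (1 / Nh) (l2 vh, l2 wh))) < min d Nh"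
    then have "dist (u, v, w) t0 < d"
      unfolding t0_def dist_norm by simp
    moreover have "u \<noteq> 0"
    proof
      assume "u = 0"
      have "norm (fst ((u, v, w) - t0)) \<le> norm ((u, v, w) - t0)"
        by (metis norm_fst_le prod.collapse)
      then show False
        using * fst0 \<open>u = 0\<close> by (simp add: t0_def)
    qed
    ultimately show "u \<noteq> 0 \<and> norm (normalize_trip (u, v, w) - zh) < \<kappa>"
      using d(2) 0 by (simp add: dist_norm)
  qed
qed

text \<open>An almost singular unit vector of the Sylvester matrix of a nearby pair is almost in the
  kernel for the exact pair, hence almost a rotation of its cofactors, and then the least squares
  problem for \<open>u\<close> is a small perturbation of the one solved exactly by \<open>uh\<close>. The lemma serves
  twice: for the starting point of the algorithm, and, with an exact nearby pair in the place of
  \<open>(p, q)\<close>, to show that exact factorizations depend continuously on the products.\<close>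

lemma initial_triplet_near:
  assumes "\<kappa> > 0"
  obtains \<eta> where "\<eta> > 0"
    "\<And>p q u v w. norm (p - l2 (uh * vh), q - l2 (uh * wh)) < \<eta> \<Longrightarrow> (u, v, w) \<in> trips m n k \<Longrightarrow>
      norm (v, w) = 1 \<Longrightarrow> norm (p * w - q * v) < \<eta> \<Longrightarrow>
      (\<And>u'. u' \<in> deg_le k \<Longrightarrow> norm (u * v - p, u * w - q) \<le> norm (u' * v - p, u' * w - q)) \<Longrightarrow>
      u \<noteq> 0 \<and> (\<exists>\<alpha>. cmod \<alpha> = 1 \<and> norm (rot \<alpha> (normalize_trip (u, v, w)) - zh) < \<kappa>)"
proof -
  obtain \<kappa>' where \<kappa>': "\<kappa>' > 0"
    "\<And>u v w. norm ((u, v, w) - (scaleR Nh (l2 uh), scaleR (1 / Nh) (l2 vh, l2 wh))) < \<kappa>'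
      \<Longrightarrow> u \<noteq> 0 \<and> norm (normalize_trip (u, v, w) - zh) < \<kappa>"
    using normalize_trip_continuous[OF assms] by blast
  obtain c where c: "c > 0" "\<And>u v w. (u, v, w) \<in> trips m n k \<Longrightarrow>
      c * norm u * norm (v, w) \<le> norm (u * v, u * w)"
    using norm_Pair_mult_ge[where m = m and n = n and k = k] by blast
  \<comment> \<open>\<open>B \<kappa>2\<close> will bound the least squares residual, which the constant \<open>c\<close> turns into a bound for \<open>u\<close>;
    \<open>cu\<close> serves to cancel the factor \<open>uh\<close> from the Sylvester residual.\<close>
  define B where "B = K * Nh + 1"
  have B: "B > 0"
    using K_ge(1) Nh_pos by (simp add: B_def add_pos_pos)
  define \<kappa>2 where "\<kappa>2 = min (\<kappa>' / 2) (c * \<kappa>' / (4 * B))"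
  have \<kappa>2: "\<kappa>2 > 0" "\<kappa>2 \<le> \<kappa>' / 2" "2 * B * \<kappa>2 \<le> c * (\<kappa>' / 2)"
    using \<kappa>'(1) c(1) B by (simp_all add: \<kappa>2_def min_def field_simps)
  obtain c5 where c5: "c5 > 0"
    "\<And>v w. v \<in> deg_le (m - k) \<Longrightarrow> w \<in> deg_le (n - k) \<Longrightarrow> norm (v, w) = 1 \<Longrightarrow>
      norm (v * l2 wh - w * l2 vh) < c5 \<Longrightarrow>
      \<exists>\<alpha>. cmod \<alpha> = 1 \<and> norm ((smul \<alpha> v, smul \<alpha> w) - scaleR (1 / Nh) (l2 vh, l2 wh)) < \<kappa>2"
    using kernel_stable[OF \<kappa>2(1)] by blast
  obtain cu where cu: "cu > 0" "\<And>a b. a \<in> deg_le k \<Longrightarrow> b \<in> deg_le (m + n) \<Longrightarrow> cu * norm a * norm b \<le> norm (a * b)"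
    using norm_mult_ge by blast
  define \<eta> where "\<eta> = min \<kappa>2 (cu * c5 / (1 + 2 * K))"
  have K_pos: "1 + 2 * K > 0"
    using K_ge(1) by simp
  then have \<eta>: "\<eta> > 0" "\<eta> \<le> \<kappa>2"
    using \<kappa>2(1) cu(1) c5(1) by (simp_all add: \<eta>_def)
  have "\<eta> \<le> cu * c5 / (1 + 2 * K)"
    by (simp add: \<eta>_def)
  then have \<eta>_le: "(1 + 2 * K) * \<eta> \<le> cu * c5"
    using K_pos by (simp add: pos_le_divide_eq mult.commute)
  show thesis
  proof (rule that[OF \<eta>(1)])
    fix p q u v w
    assume close: "norm (p - l2 (uh * vh), q - l2 (uh * wh)) < \<eta>" and t: "(u, v, w) \<in> trips m n k"
      and vw: "norm (v, w) = 1" and small: "norm (p * w - q * v) < \<eta>"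
      and best: "\<And>u'. u' \<in> deg_le k \<Longrightarrow> norm (u * v - p, u * w - q) \<le> norm (u' * v - p, u' * w - q)"
    have deg: "u \<in> deg_le k" "v \<in> deg_le (m - k)" "w \<in> deg_le (n - k)"
      using t by (auto simp: trips_def)
    define dp dq where "dp = p - l2 uh * l2 vh" and "dq = q - l2 uh * l2 wh"
    have close': "norm (dp, dq) < \<eta>"
      using close by (simp add: dp_def dq_def l2_simps)
    have v1: "norm v \<le> 1" "norm w \<le> 1"
      using vw norm_fst_le[of v w] norm_snd_le[of w v] by simp_all
    have d1: "norm dp < \<eta>" "norm dq < \<eta>"
      using close' norm_fst_le[of dp dq] norm_snd_le[of dq dp] by simp_all
    have wp: "norm (w * dp) \<le> K * \<eta>"
    proof -
      have "norm (w * dp) \<le> sqrt (real (n - k + 1)) * norm w * norm dp"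
        by (rule norm_mult_le[OF deg(3)])
      also have "\<dots> \<le> K * 1 * \<eta>"
        using K_ge v1 d1 \<eta>(1) by (intro mult_mono) auto
      finally show ?thesis by simp
    qed
    have vq: "norm (v * dq) \<le> K * \<eta>"
    proof -
      have "norm (v * dq) \<le> sqrt (real (m - k + 1)) * norm v * norm dq"
        by (rule norm_mult_le[OF deg(2)])
      also have "\<dots> \<le> K * 1 * \<eta>"
        using K_ge v1 d1 \<eta>(1) by (intro mult_mono) auto
      finally show ?thesis by simp
    qed
    have "l2 uh * (v * l2 wh - w * l2 vh) = (w * dp - v * dq) - (p * w - q * v)"
      by (simp add: dp_def dq_def algebra_simps)
    then have "norm (l2 uh * (v * l2 wh - w * l2 vh)) < (1 + 2 * K) * \<eta>"
      using norm_triangle_ineq4[of "w * dp - v * dq" "p * w - q * v"]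
        norm_triangle_ineq4[of "w * dp" "v * dq"] wp vq small by (simp add: distrib_right)
    moreover have "v * l2 wh - w * l2 vh \<in> deg_le (m + n)"
    proof -
      have "v * l2 wh \<in> deg_le ((m - k) + (n - k))" "w * l2 vh \<in> deg_le ((n - k) + (m - k))"
        using deg degrees by (intro deg_le_mult; simp)+
      then show ?thesis
        by (intro deg_le_closed) (auto simp: deg_le_def)
    qed
    ultimately have "cu * norm (v * l2 wh - w * l2 vh) < cu * c5"
      using cu(2)[of "l2 uh" "v * l2 wh - w * l2 vh"] degrees(1) unit \<eta>_le by simp
    then have "norm (v * l2 wh - w * l2 vh) < c5"
      using cu(1) by simp
    then obtain \<alpha> where \<alpha>: "cmod \<alpha> = 1"
      "norm ((smul \<alpha> v, smul \<alpha> w) - scaleR (1 / Nh) (l2 vh, l2 wh)) < \<kappa>2"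
      using c5(2)[OF deg(2,3) vw] by blast
    define u' v' w' where "u' = smul (cnj \<alpha>) u" and "v' = smul \<alpha> v" and "w' = smul \<alpha> w"
    define u1 where "u1 = scaleR Nh (l2 uh)"
    have rot: "rot (cnj \<alpha>) (u, v, w) = (u', v', w')"
      by (simp add: rot_def u'_def v'_def w'_def)
    have \<alpha>\<alpha>: "\<alpha> * cnj \<alpha> = 1"
      using unimodular_cnj[OF \<alpha>(1)] .
    have u1: "u1 \<in> deg_le k" "norm (u1 * x, u1 * y) \<le> K * Nh * norm (x, y)" for x y
    proof -
      show "u1 \<in> deg_le k"
        using degrees(1) by (auto simp: u1_def)
      have "(u1 * x, u1 * y) = scaleR Nh (l2 uh * x, l2 uh * y)"
        by (simp add: u1_def scaleR_l2_poly_def smul_simps)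
      then show "norm (u1 * x, u1 * y) \<le> K * Nh * norm (x, y)"
        using norm_uh_mult(2)[of x y] Nh_pos mult_left_mono[of _ _ Nh] by (simp only: norm_scaleR) (simp add: mult_ac)
    qed
    have n1: "norm (u1 * v' - p, u1 * w' - q) \<le> B * \<kappa>2"
    proof -
      have "scaleR (1 / Nh) (l2 vh) = smul (1 / of_real Nh) (l2 vh)" "scaleR (1 / Nh) (l2 wh) = smul (1 / of_real Nh) (l2 wh)"
        by (simp_all add: scaleR_l2_poly_def)
      moreover have "u1 = smul (of_real Nh) (l2 uh)"
        by (simp add: u1_def scaleR_l2_poly_def)
      ultimately have eq: "(u1 * v' - p, u1 * w' - q) =
          (u1 * (v' - scaleR (1 / Nh) (l2 vh)), u1 * (w' - scaleR (1 / Nh) (l2 wh))) - (dp, dq)"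
        using Nh_pos by (simp add: dp_def dq_def right_diff_distrib smul_simps)
      have "norm (u1 * v' - p, u1 * w' - q) \<le>
          K * Nh * norm (v' - scaleR (1 / Nh) (l2 vh), w' - scaleR (1 / Nh) (l2 wh)) + norm (dp, dq)"
        unfolding eq
        using norm_triangle_ineq4[of "(u1 * (v' - scaleR (1 / Nh) (l2 vh)), u1 * (w' - scaleR (1 / Nh) (l2 wh)))" "(dp, dq)"]
          u1(2)[of "v' - scaleR (1 / Nh) (l2 vh)" "w' - scaleR (1 / Nh) (l2 wh)"] by linarith
      also have "\<dots> \<le> K * Nh * \<kappa>2 + \<kappa>2"
        using \<alpha>(2) close' \<eta>(2) K_ge(1) Nh_pos
        by (intro add_mono mult_left_mono) (auto simp: v'_def w'_def)
      finally show ?thesis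
        by (simp add: B_def distrib_right)
    qed
    have n2: "norm (u * v - p, u * w - q) \<le> norm (u1 * v' - p, u1 * w' - q)"
      using best[of "smul \<alpha> u1"] u1(1) by (auto simp: v'_def w'_def smul_simps)
    have e1: "(u * v - p, u * w - q) = (u' * v' - p, u' * w' - q)"
      using \<alpha>\<alpha> by (simp add: u'_def v'_def w'_def smul_simps mult.commute[of "cnj \<alpha>"])
    have e2: "((u' - u1) * v', (u' - u1) * w') = (u' * v' - p, u' * w' - q) - (u1 * v' - p, u1 * w' - q)"
      by (simp add: left_diff_distrib)
    have "norm ((u' - u1) * v', (u' - u1) * w') \<le> 2 * B * \<kappa>2"
      unfolding e2 using norm_triangle_ineq4[of "(u' * v' - p, u' * w' - q)" "(u1 * v' - p, u1 * w' - q)"]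
        n1 n2[unfolded e1] by linarith
    moreover have "c * norm (u' - u1) \<le> norm ((u' - u1) * v', (u' - u1) * w')"
    proof -
      have "norm (v', w') = 1"
        using vw \<alpha>(1) by (simp add: v'_def w'_def norm_prod_def)
      then show ?thesis
        using c(2)[of "u' - u1" v' w'] deg u1(1) by (auto simp: trips_def u'_def v'_def w'_def)
    qed
    ultimately have "c * norm (u' - u1) \<le> c * (\<kappa>' / 2)"
      using \<kappa>2(3) by linarith
    then have "norm (u' - u1) \<le> \<kappa>' / 2"
      using c(1) by simp
    moreover have "norm ((v', w') - scaleR (1 / Nh) (l2 vh, l2 wh)) < \<kappa>' / 2"
      using \<alpha>(2) \<kappa>2(2) by (simp only: v'_def w'_def)
    ultimately have "norm ((u', v', w') - (u1, scaleR (1 / Nh) (l2 vh, l2 wh))) < \<kappa>'"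
      using norm_Pair_le[of "u' - u1" "(v', w') - scaleR (1 / Nh) (l2 vh, l2 wh)"] by simp
    then have "u' \<noteq> 0 \<and> norm (normalize_trip (u', v', w') - zh) < \<kappa>"
      unfolding u1_def by (rule \<kappa>'(2))
    then have "u \<noteq> 0" "norm (rot (cnj \<alpha>) (normalize_trip (u, v, w)) - zh) < \<kappa>"
      using normalize_trip_rot[of "cnj \<alpha>" "(u, v, w)"] \<alpha>(1) by (auto simp: rot u'_def smul_simps)
    then show "u \<noteq> 0 \<and> (\<exists>\<alpha>. cmod \<alpha> = 1 \<and> norm (rot \<alpha> (normalize_trip (u, v, w)) - zh) < \<kappa>)"
      using \<alpha>(1) by (intro conjI exI[of _ "cnj \<alpha>"]) auto
  qed
qed

end

section \<open>Local convergence of the Gauss--Newton iteration\<close>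

lemma norm_smul_triple_le:
  assumes "cmod a \<le> t" "cmod b \<le> t"
  shows "norm (smul a u, smul b v, smul b w) \<le> t * norm (u, v, w)"
proof -
  have "t \<ge> 0"
    using assms(1) norm_ge_zero order_trans by blast
  then show ?thesis
    using assms by (intro norm_Pair_mono) (auto intro: mult_right_mono)
qed

text \<open>Among triplets that satisfy the scaling condition exactly, a best approximation by products
  also minimizes the full residual over all triplets, because the first component of the residual
  can only add to the norm.\<close>

lemma factorization_critical:
  assumes z: "(u, v, w) \<in> trips m n k" "cinner u h = 1"
    and best: "\<And>u' v' w'. (u', v', w') \<in> trips m n k \<Longrightarrow>
      norm (u * v - p, u * w - q) \<le> norm (u' * v' - p, u' * w' - q)"
  shows "gn_direction m n k h p q (u, v, w) 0"
  unfolding gn_direction_0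
proof (intro ballI minimizer_orthogonal)
  fix e and t :: real
  assume e: "e \<in> trips m n k"
  let ?z = "(u, v, w)"
  have "?z + scaleR t e \<in> trips m n k"
    using z(1) e by blast
  obtain u' v' w' where z': "?z + scaleR t e = (u', v', w')"
    by (metis prod_cases3)
  have "fac h ?z - (1, p, q) = (0, u * v - p, u * w - q)"
    using z(2) by (simp add: fac_def)
  then have "norm (fac h ?z - (1, p, q)) = norm (u * v - p, u * w - q)"
    by (simp add: norm_Pair)
  also have "\<dots> \<le> norm (u' * v' - p, u' * w' - q)"
    using \<open>?z + scaleR t e \<in> trips m n k\<close> z' by (intro best) simp
  also have "\<dots> \<le> norm (fac h (?z + scaleR t e) - (1, p, q))"
    by (simp add: z' fac_def norm_snd_le)
  also have "fac h (?z + scaleR t e) - (1, p, q) =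
      fac h ?z - (1, p, q) + scaleR t (dfac h ?z e) + scaleR (t\<^sup>2) (qfac e)"
    by (simp only: fac_taylor dfac_linear) (simp only: algebra_simps)
  finally show "norm (fac h ?z - (1, p, q))
    \<le> norm (fac h ?z - (1, p, q) + scaleR t (dfac h ?z e) + scaleR (t\<^sup>2) (qfac e))" .
qed

context reference_factorization
begin

text \<open>Any factorization close to the reference up to phase has a rescaled version with the same
  products, but with the phase and scaling condition dictated by the starting point \<open>z0\<close>: first rotate,
  then divide by \<open>\<langle>u, h\<rangle>\<close>, which is close to \<open>\<langle>h, h\<rangle> = 1\<close>.\<close>

lemma align_factorization:
  assumes z0: "norm (rot \<alpha> z0 - zh) < \<kappa>" "cmod \<alpha> = 1" "fst z0 = h" "norm h = 1"
    and z1: "(u1, v1, w1) \<in> trips m n k" "norm (rot \<beta> (u1, v1, w1) - zh) < \<kappa>" "cmod \<beta> = 1"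
    and \<kappa>: "\<kappa> \<le> 1 / 4"
  obtains u v w where "(u, v, w) \<in> trips m n k" "cinner u h = 1" "u * v = u1 * v1" "u * w = u1 * w1"
    "norm (z0 - (u, v, w)) \<le> 6 * (norm zh + 1) * \<kappa>"
proof -
  define z2 where "z2 = rot (cnj \<alpha> * \<beta>) (u1, v1, w1)"
  define u2 v2 w2 where "u2 = smul (cnj \<alpha> * \<beta>) u1" and "v2 = smul (cnj (cnj \<alpha> * \<beta>)) v1"
    and "w2 = smul (cnj (cnj \<alpha> * \<beta>)) w1"
  have z2: "z2 = (u2, v2, w2)"
    by (simp add: z2_def u2_def v2_def w2_def rot_def)
  have mod: "cmod (cnj \<alpha> * \<beta>) = 1"
    using z0(2) z1(3) by (simp add: norm_mult)
  have z2_rot: "z2 = rot (cnj \<alpha>) (rot \<beta> (u1, v1, w1))"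
    by (simp add: z2_def rot_simps)
  have "z2 - z0 = rot (cnj \<alpha>) (rot \<beta> (u1, v1, w1) - rot \<alpha> z0)"
    unfolding rot_simps(2) z2_rot rot_cancel[OF z0(2)] ..
  then have "norm (z2 - z0) = norm (rot \<beta> (u1, v1, w1) - rot \<alpha> z0)"
    using z0(2) by (simp add: norm_rot)
  then have z20: "norm (z2 - z0) \<le> 2 * \<kappa>"
    using norm_triangle_ineq4[of "rot \<beta> (u1, v1, w1) - zh" "rot \<alpha> z0 - zh"] z0(1) z1(2) by simp
  have "norm z2 = norm (rot \<beta> (u1, v1, w1))"
    using z0(2) by (simp add: z2_rot norm_rot)
  then have norm_z2: "norm z2 \<le> norm zh + 1"
    using norm_triangle_sub[of "rot \<beta> (u1, v1, w1)" zh] z1(2) \<kappa> by simp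
  define c where "c = cinner u2 h"
  have "fst (z2 - z0) = u2 - h"
    by (simp add: z2 z0(3))
  then have "norm (u2 - h) \<le> norm (z2 - z0)"
    by (metis norm_fst_le prod.collapse)
  then have "norm (u2 - h) \<le> 2 * \<kappa>"
    using z20 by simp
  moreover have "c - 1 = cinner (u2 - h) h"
    by (simp add: c_def cinner_diff_left cinner_self_norm z0(4))
  ultimately have c1: "cmod (c - 1) \<le> 2 * \<kappa>"
    using cinner_norm_le[of "u2 - h" h] z0(4) by simp
  have c_ge: "cmod c \<ge> 1 / 2"
    using norm_triangle_ineq3[of c 1] c1 \<kappa> by simp
  then have c0: "c \<noteq> 0"
    by auto
  have c2: "cmod (1 / c - 1) \<le> 4 * \<kappa>"
  proof -
    have "1 / c - 1 = (1 - c) / c"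
      using c0 by (simp add: field_simps)
    then have "cmod (1 / c - 1) = cmod (c - 1) / cmod c"
      by (simp add: norm_divide norm_minus_commute)
    also have "\<dots> \<le> cmod (c - 1) / (1 / 2)"
      using c_ge by (intro divide_left_mono) auto
    finally show ?thesis
      using c1 by simp
  qed
  have kappa_pos: "\<kappa> > 0"
    using z0(1) norm_ge_zero le_less_trans by blast
  show thesis
  proof (rule that[of "smul (1 / c) u2" "smul c v2" "smul c w2"])
    show "(smul (1 / c) u2, smul c v2, smul c w2) \<in> trips m n k"
      using z1(1) by (auto simp: trips_def u2_def v2_def w2_def)
    show "cinner (smul (1 / c) u2) h = 1"
      using c0 by (simp add: cinner_smul_left flip: c_def)
    have "(cnj \<alpha> * \<beta>) * cnj (cnj \<alpha> * \<beta>) = 1"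
      using unimodular_cnj[OF mod] .
    then have *: "smul (cnj \<alpha> * \<beta>) a * smul (cnj (cnj \<alpha> * \<beta>)) b = a * b" for a b
      by (simp only: smul_simps) (simp only: smul_simps mult.commute[of "cnj (cnj \<alpha> * \<beta>)"])
    show "smul (1 / c) u2 * smul c v2 = u1 * v1" "smul (1 / c) u2 * smul c w2 = u1 * w1"
      using c0 *[of u1 v1] *[of u1 w1] by (simp_all add: smul_simps(1,2,9,10) u2_def v2_def w2_def del: complex_cnj_mult)
    have "z2 - (smul (1 / c) u2, smul c v2, smul c w2) = (smul (1 - 1 / c) u2, smul (1 - c) v2, smul (1 - c) w2)"
      using smul_simps(2) smul_simps(8) by (metis (no_types) diff_Pair z2)
    then have "norm (z2 - (smul (1 / c) u2, smul c v2, smul c w2)) \<le> 4 * \<kappa> * norm z2"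
      using norm_smul_triple_le[of "1 - 1 / c" "4 * \<kappa>" "1 - c" u2 v2 w2] c1 c2 kappa_pos
      by (simp add: z2 norm_minus_commute)
    also have "\<dots> \<le> 4 * \<kappa> * (norm zh + 1)"
      using norm_z2 kappa_pos by (intro mult_left_mono) auto
    finally have "norm (z0 - (smul (1 / c) u2, smul c v2, smul c w2)) \<le> 2 * \<kappa> + 4 * \<kappa> * (norm zh + 1)"
      using z20 dist_triangle[of z0 "(smul (1 / c) u2, smul c v2, smul c w2)" z2]
      unfolding dist_norm norm_minus_commute[of z0 z2] by linarith
    also have "2 * \<kappa> \<le> 2 * \<kappa> * (norm zh + 1)"
      using kappa_pos by (simp add: distrib_left)
    finally show "norm (z0 - (smul (1 / c) u2, smul c v2, smul c w2)) \<le> 6 * (norm zh + 1) * \<kappa>"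
      by (simp add: algebra_simps)
  qed
qed

text \<open>A starting point \<open>z0\<close> close to the reference up to phase, and any best approximation by products
  that is close to the reference up to phase: the latter, once aligned with \<open>z0\<close>, is a
  critical point with a basin that contains \<open>z0\<close>. The phases are arbitrary, yet the constants do not
  depend on them, because the Jacobian is bounded below at the reference and is invariant under rotations.
  The scaling vector \<open>h\<close> is the first component of the starting point.\<close>

lemma gauss_newton_local:
  obtains \<kappa> \<eta> \<rho> \<gamma> where "\<kappa> > 0" "\<eta> > 0" "\<gamma> > 0"
    "\<And>p q z0 \<alpha> u1 v1 w1 \<beta>. z0 \<in> trips m n k \<Longrightarrow> norm (fst z0) = 1 \<Longrightarrow>
      norm (rot \<alpha> z0 - zh) < \<kappa> \<Longrightarrow> cmod \<alpha> = 1 \<Longrightarrow>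
      (u1, v1, w1) \<in> trips m n k \<Longrightarrow> norm (rot \<beta> (u1, v1, w1) - zh) < \<kappa> \<Longrightarrow> cmod \<beta> = 1 \<Longrightarrow>
      (\<And>u v w. (u, v, w) \<in> trips m n k \<Longrightarrow>
        norm (u1 * v1 - p, u1 * w1 - q) \<le> norm (u * v - p, u * w - q)) \<Longrightarrow>
      norm (u1 * v1 - p, u1 * w1 - q) < \<eta> \<Longrightarrow>
      \<exists>u v w. (u, v, w) \<in> trips m n k \<and> u * v = u1 * v1 \<and> u * w = u1 * w1 \<and>
        norm (z0 - (u, v, w)) \<le> \<rho> / 2 \<and> gn_direction m n k (fst z0) p q (u, v, w) 0 \<and>
        gn_basin m n k (fst z0) p q \<gamma> \<rho> (u, v, w)"
proof -
  obtain \<gamma>0 where \<gamma>0: "\<gamma>0 > 0" "\<And>d. d \<in> trips m n k \<Longrightarrow> \<gamma>0 * norm d \<le> norm (dfac (l2 uh) zh d)"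
    using dfac_bounded_below by blast
  \<comment> \<open>In \<open>\<kappa>\<close>, the first bound keeps the aligned scaling factor away from 0, the second one loses at most
    half of the lower bound \<open>\<gamma>0\<close> of the Jacobian within the ball of radius \<open>\<rho>\<close>, and the third one
    together with \<open>\<eta>\<close> provides the smallness conditions of the contraction lemma for \<open>L = 2 K\<close>.\<close>
  define M where "M = norm zh + 1"
  define \<gamma> where "\<gamma> = \<gamma>0 / 2"
  define \<kappa> where "\<kappa> = min (1 / 4) (min (\<gamma> / (1 + 76 * K * M)) (\<gamma> / (96 * K * M)))"
  define \<eta> where "\<eta> = \<gamma>\<^sup>2 / (16 * K)"
  define \<rho> where "\<rho> = 12 * M * \<kappa>"
  have M: "M \<ge> 1"
    by (simp add: M_def)
  have \<gamma>: "\<gamma> > 0"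
    using \<gamma>0(1) by (simp add: \<gamma>_def)
  have KM: "K * M > 0"
    using K_ge(1) M by simp
  have "\<kappa> > 0"
    using \<gamma> KM by (auto simp: \<kappa>_def mult.assoc intro!: divide_pos_pos add_pos_pos)
  moreover have "\<kappa> \<le> 1 / 4"
    unfolding \<kappa>_def by (rule min.cobounded1)
  ultimately have \<kappa>: "\<kappa> > 0" "\<kappa> \<le> 1 / 4" .
  have "\<kappa> \<le> \<gamma> / (1 + 76 * K * M)" "\<kappa> \<le> \<gamma> / (96 * K * M)"
    by (simp_all add: \<kappa>_def)
  moreover have "1 + 76 * K * M > 0" "96 * K * M > 0"
    using KM by (simp_all add: mult.assoc)
  ultimately have \<kappa>_small: "\<kappa> * (1 + 76 * K * M) \<le> \<gamma>" "\<kappa> * (96 * K * M) \<le> \<gamma>"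
    by (simp_all add: pos_le_divide_eq)
  have \<eta>: "\<eta> > 0" "8 * K * \<eta> = \<gamma>\<^sup>2 / 2"
    using \<gamma> K_ge(1) by (simp_all add: \<eta>_def)
  show thesis
  proof (rule that[OF \<kappa>(1) \<eta>(1) \<gamma>])
    fix p q z0 \<alpha> u1 v1 w1 \<beta>
    assume z0: "z0 \<in> trips m n k" "norm (fst z0) = 1" "norm (rot \<alpha> z0 - zh) < \<kappa>" "cmod \<alpha> = 1"
      and z1: "(u1, v1, w1) \<in> trips m n k" "norm (rot \<beta> (u1, v1, w1) - zh) < \<kappa>" "cmod \<beta> = 1"
      and best: "\<And>u v w. (u, v, w) \<in> trips m n k \<Longrightarrow>
        norm (u1 * v1 - p, u1 * w1 - q) \<le> norm (u * v - p, u * w - q)"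
      and res: "norm (u1 * v1 - p, u1 * w1 - q) < \<eta>"
    define h where "h = fst z0"
    obtain u v w where z: "(u, v, w) \<in> trips m n k" "cinner u h = 1"
      "u * v = u1 * v1" "u * w = u1 * w1" and near: "norm (z0 - (u, v, w)) \<le> 6 * (norm zh + 1) * \<kappa>"
      using align_factorization[OF z0(3,4) refl z0(2) z1 \<kappa>(2)] unfolding h_def .
    define zs where "zs = (u, v, w)"
    have zs: "zs \<in> trips m n k" "norm (z0 - zs) \<le> \<rho> / 2"
      using z(1) near by (simp_all add: zs_def \<rho>_def M_def algebra_simps)
    have crit: "gn_direction m n k h p q zs 0"
      unfolding zs_def by (rule factorization_critical[OF z(1,2)]) (simp add: z(3,4) best)
    have resid: "norm (fac h zs - (1, p, q)) < \<eta>"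
    proof -
      have "fac h zs - (1, p, q) = (0, u1 * v1 - p, u1 * w1 - q)"
        using z by (simp add: fac_def zs_def)
      then show ?thesis
        using res by (simp add: norm_Pair)
    qed
    have lower: "\<gamma> * norm d \<le> norm (dfac h y d)"
      if y: "y \<in> trips m n k" "norm (y - zs) \<le> \<rho>" and d: "d \<in> trips m n k" for y d
    proof -
      have "norm (y - z0) \<le> \<rho> + \<rho> / 2"
        using norm_triangle_ineq[of "y - zs" "zs - z0"] y(2) zs(2) by (simp add: norm_minus_commute)
      moreover have "norm (rot \<alpha> y - rot \<alpha> z0) = norm (y - z0)"
        using z0(4) by (simp add: norm_rot flip: rot_simps(2))
      ultimately have "norm (rot \<alpha> y - zh) \<le> 18 * M * \<kappa> + \<kappa>"
        using norm_triangle_ineq[of "rot \<alpha> y - rot \<alpha> z0" "rot \<alpha> z0 - zh"] z0(3) by (simp add: \<rho>_def)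
      also have "\<dots> \<le> 19 * M * \<kappa>"
        using M \<kappa>(1) by simp
      finally have y_near: "norm (rot \<alpha> y - zh) \<le> 19 * M * \<kappa>" .
      have h_near: "norm (smul \<alpha> h - l2 uh) \<le> \<kappa>"
      proof -
        have "smul \<alpha> h - l2 uh = fst (rot \<alpha> z0 - zh)"
          by (simp add: h_def rot_def zh_def split_beta)
        also have "norm \<dots> \<le> norm (rot \<alpha> z0 - zh)"
          by (metis norm_fst_le prod.collapse)
        finally show ?thesis
          using z0(3) by simp
      qed
      let ?d = "rot \<alpha> d"
      have d': "?d \<in> trips m n k" "norm ?d = norm d"
        using d z0(4) by (auto simp: norm_rot)
      have "norm (dfac (smul \<alpha> h) (rot \<alpha> y) ?d - dfac (l2 uh) zh ?d)
          \<le> norm (smul \<alpha> h - l2 uh) * norm ?d + 4 * sqrt (real (k + 1)) * norm (rot \<alpha> y - zh) * norm ?d"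
        using y(1) zh_in_trips d'(1) by (intro norm_dfac_diff_le) auto
      also have "\<dots> \<le> \<kappa> * norm d + 4 * K * (19 * M * \<kappa>) * norm d"
        unfolding d'(2) using h_near y_near K_ge
        by (intro add_mono mult_right_mono mult_mono) auto
      also have "\<dots> = \<kappa> * (1 + 76 * K * M) * norm d"
        by (simp add: algebra_simps)
      also have "\<dots> \<le> \<gamma> * norm d"
        using \<kappa>_small(1) by (rule mult_right_mono) simp
      finally have "norm (dfac h y d - dfac (l2 uh) zh ?d) \<le> \<gamma> * norm d"
        by (simp only: dfac_rot[OF z0(4)])
      moreover have "2 * \<gamma> * norm d \<le> norm (dfac (l2 uh) zh ?d)"
        using \<gamma>0(2)[OF d'(1)] d'(2) by (simp add: \<gamma>_def)
      ultimately show ?thesis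
        using norm_triangle_ineq2[of "dfac (l2 uh) zh ?d" "dfac h y d"] by (simp add: norm_minus_commute)
    qed
    have contraction: "norm (y - d - zs) \<le> norm (y - zs) / 2"
      if y: "y \<in> trips m n k" "norm (y - zs) \<le> \<rho>" and d: "gn_direction m n k h p q y d" for y d
    proof (rule gauss_newton_contraction[where D = "trips m n k" and f = "fac h" and J = "dfac h"
          and b = "(1, p, q)" and L = "2 * K" and \<gamma> = \<gamma>])
      show "x - y \<in> trips m n k" if "x \<in> trips m n k" "y \<in> trips m n k" for x y
        using that by blast
      show "norm (fac h zs - fac h y + dfac h y (y - zs)) \<le> 2 * K * (norm (y - zs))\<^sup>2"
      proof -
        have "dfac h y (zs - y) = - dfac h y (y - zs)"
          by (simp add: dfac_linear(1))
        then have "fac h zs - fac h y + dfac h y (y - zs) = qfac (zs - y)"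
          using fac_taylor[of h y "zs - y"] by simp
        also have "norm \<dots> \<le> 2 * sqrt (real (k + 1)) * (norm (zs - y))\<^sup>2"
          using zs(1) y(1) by (intro norm_qfac_le) auto
        also have "\<dots> \<le> 2 * K * (norm (y - zs))\<^sup>2"
          using K_ge by (simp add: norm_minus_commute mult_right_mono)
        finally show ?thesis .
      qed
      show "norm (dfac h y e - dfac h zs e) \<le> 2 * (2 * K) * norm (y - zs) * norm e" if "e \<in> trips m n k" for e
      proof -
        have "norm (dfac h y e - dfac h zs e) \<le> 4 * sqrt (real (k + 1)) * norm (y - zs) * norm e"
          using norm_dfac_diff_le[OF y(1) zs(1) that, of h h] by simp
        also have "\<dots> \<le> 4 * K * norm (y - zs) * norm e"
          using K_ge by (intro mult_right_mono) auto
        finally show ?thesis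
          by simp
      qed
      have "4 * (2 * K) * norm (fac h zs - (1, p, q)) \<le> 8 * K * \<eta>"
        using resid K_ge(1) by simp
      then show "4 * (2 * K) * norm (fac h zs - (1, p, q)) \<le> \<gamma>\<^sup>2 / 2"
        using \<eta>(2) by simp
      have "4 * (2 * K) * norm (y - zs) \<le> 4 * (2 * K) * (12 * M * \<kappa>)"
        using y(2) K_ge(1) unfolding \<rho>_def by (intro mult_left_mono) auto
      then show "4 * (2 * K) * norm (y - zs) \<le> \<gamma>"
        using \<kappa>_small(2) by (simp add: mult_ac)
    qed (use y d[unfolded gn_direction_def] zs \<gamma> K_ge(1) lower crit[unfolded gn_direction_0] dfac_linear
        in auto)
    have "gn_basin m n k h p q \<gamma> \<rho> zs"
      unfolding gn_basin_def using lower contraction by blast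
    then show "\<exists>u v w. (u, v, w) \<in> trips m n k \<and> u * v = u1 * v1 \<and> u * w = u1 * w1 \<and>
        norm (z0 - (u, v, w)) \<le> \<rho> / 2 \<and> gn_direction m n k (fst z0) p q (u, v, w) 0 \<and>
        gn_basin m n k (fst z0) p q \<gamma> \<rho> (u, v, w)"
      using z(1,3,4) zs(2) crit unfolding zs_def h_def by blast
  qed
qed

end

section \<open>Coefficient vectors and convolution matrices\<close>

lemma coeff_vec_carrier [simp]: "coeff_vec l f \<in> carrier_vec (l + 1)"
  "coeff_vec l f \<in> carrier_vec (Suc l)" "dim_vec (coeff_vec l f) = l + 1"
  by (simp_all add: coeff_vec_def)

lemma coeff_vec_index [simp]: "i < l + 1 \<Longrightarrow> coeff_vec l f $ i = coeff f i"
  by (simp add: coeff_vec_def)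

lemma coeff_vec_poly: "coeff (vec_poly x) i = (if i < dim_vec x then x $ i else 0)"
  by (simp add: vec_poly_def coeff_Poly nth_default_def list_of_vec_index)

lemma degree_vec_poly: "x \<in> carrier_vec (l + 1) \<Longrightarrow> degree (vec_poly x) \<le> l"
  by (auto intro!: degree_le simp: coeff_vec_poly)

lemma coeff_vec_vec_poly: "x \<in> carrier_vec (l + 1) \<Longrightarrow> coeff_vec l (vec_poly x) = x"
  by (intro eq_vecI) (auto simp: coeff_vec_poly)

lemma vec_poly_coeff_vec: "degree f \<le> l \<Longrightarrow> vec_poly (coeff_vec l f) = f"
  by (rule poly_eqI) (auto simp: coeff_vec_poly coeff_eq_0)

lemma coeff_vec_add: "coeff_vec l (f + g) = coeff_vec l f + coeff_vec l g"
  and coeff_vec_diff: "coeff_vec l (f - g) = coeff_vec l f - coeff_vec l g"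
  by (auto intro!: eq_vecI simp: coeff_vec_def)

lemma conv_mat_carrier [simp]:
  "conv_mat l j f \<in> carrier_mat (l + j + 1) (j + 1)" "dim_row (conv_mat l j f) = l + j + 1"
  "dim_col (conv_mat l j f) = j + 1"
  by (simp_all add: conv_mat_def)

lemma conv_mat_mult:
  assumes "degree g \<le> j" "N = l + j"
  shows "conv_mat l j f *\<^sub>v coeff_vec j g = coeff_vec N (f * g)"
proof (rule eq_vecI)
  fix r assume "r < dim_vec (coeff_vec N (f * g))"
  then have r: "r < l + j + 1"
    by (simp add: assms(2))
  have "f * g = (\<Sum>c\<le>j. smult (coeff g c) (f * monom 1 c))"
    using poly_as_sum_of_monoms'[OF assms(1)]
    by (metis (no_types, lifting) sum.cong sum_distrib_left mult_smult_right smult_monom mult.right_neutral)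
  then have "coeff (f * g) r = (\<Sum>c\<le>j. coeff g c * coeff (f * monom 1 c) r)"
    by (simp add: coeff_sum)
  also have "\<dots> = (\<Sum>c\<in>{0..<j + 1}. coeff (f * monom 1 c) r * coeff g c)"
    by (intro sum.cong) auto
  finally show "(conv_mat l j f *\<^sub>v coeff_vec j g) $ r = coeff_vec N (f * g) $ r"
    using r by (simp add: assms(2) scalar_prod_def conv_mat_def)
qed (simp add: assms(2))

lemma append_cols_carrier [simp]:
  "A \<in> carrier_mat nr n1 \<Longrightarrow> B \<in> carrier_mat nr n2 \<Longrightarrow> A @\<^sub>c B \<in> carrier_mat nr (n1 + n2)"
  by (auto simp: append_cols_def)

lemma append_cols_mult:
  assumes "A \<in> carrier_mat nr n1" "B \<in> carrier_mat nr n2" "x \<in> carrier_vec n1" "y \<in> carrier_vec n2"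
  shows "(A @\<^sub>c B) *\<^sub>v (x @\<^sub>v y) = A *\<^sub>v x + B *\<^sub>v y"
proof -
  have "(A @\<^sub>c B) *\<^sub>v (x @\<^sub>v y) = (A *\<^sub>v x + B *\<^sub>v y) @\<^sub>v (0\<^sub>m 0 n1 *\<^sub>v x + 0\<^sub>m 0 n2 *\<^sub>v y)"
    using assms unfolding append_cols_def
    by (subst four_block_mat_mult_vec[of A nr n1 B n2 _ 0]) auto
  also have "\<dots> = A *\<^sub>v x + B *\<^sub>v y"
    using assms by (intro eq_vecI) auto
  finally show ?thesis .
qed

lemma zero_mat_mult_vec: "x \<in> carrier_vec nc \<Longrightarrow> 0\<^sub>m nr nc *\<^sub>v x = 0\<^sub>v nr"
  by (intro eq_vecI) auto

lemma euclid_norm_append: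
  "euclid_norm (x @\<^sub>v y) = sqrt ((euclid_norm x)\<^sup>2 + (euclid_norm y)\<^sup>2)"
proof -
  have "(\<Sum>i<dim_vec x + dim_vec y. (cmod ((x @\<^sub>v y) $ i))\<^sup>2) =
      (\<Sum>i<dim_vec x. (cmod (x $ i))\<^sup>2) + (\<Sum>i<dim_vec y. (cmod (y $ i))\<^sup>2)"
  proof -
    have "(\<Sum>i<a + b. f i) = (\<Sum>i<a. f i) + (\<Sum>i<b. f (a + i))" for a b and f :: "nat \<Rightarrow> real"
      by (induction b) simp_all
    then show ?thesis
      by simp
  qed
  then show ?thesis
    by (simp add: euclid_norm_def sum_nonneg)
qed

lemma euclid_norm_uminus: "euclid_norm (- x) = euclid_norm x"
  by (simp add: euclid_norm_def)

lemma euclid_norm_nonneg: "0 \<le> euclid_norm x"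
  by (simp add: euclid_norm_def sum_nonneg)

lemma append_vec_diff:
  "dim_vec a = dim_vec c \<Longrightarrow> dim_vec b = dim_vec d \<Longrightarrow>
    (a @\<^sub>v b) - (c @\<^sub>v d) = (a - c) @\<^sub>v (b - d)" for a b c d :: "complex Matrix.vec"
  by (intro eq_vecI) auto

section \<open>Adjoints and normal equations\<close>

lemma mat_adjoint_carrier [simp]: "A \<in> carrier_mat r c \<Longrightarrow> mat_adjoint A \<in> carrier_mat c r"
  by (auto simp: mat_adjoint_def)

lemma mat_adjoint_index:
  assumes "A \<in> carrier_mat r c" "i < c" "j < r"
  shows "mat_adjoint A $$ (i, j) = cnj (A $$ (j, i))"
  using assms by (simp add: mat_adjoint_def mat_of_rows_index)

lemma adjoint_scalar_prod:
  fixes A :: "complex mat"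
  assumes "A \<in> carrier_mat r c" "z \<in> carrier_vec r" "e \<in> carrier_vec c"
  shows "(mat_adjoint A *\<^sub>v z) \<bullet>c e = z \<bullet>c (A *\<^sub>v e)"
proof -
  have dims: "dim_row (mat_adjoint A) = c" "dim_col (mat_adjoint A) = r"
    using mat_adjoint_carrier[OF assms(1)] by auto
  have "(mat_adjoint A *\<^sub>v z) $ i = (\<Sum>j\<in>{0..<r}. cnj (A $$ (j, i)) * z $ j)" if "i < c" for i
    using that assms mat_adjoint_index[OF assms(1) that] dims by (simp add: scalar_prod_def)
  then have "(mat_adjoint A *\<^sub>v z) \<bullet>c e = (\<Sum>i\<in>{0..<c}. (\<Sum>j\<in>{0..<r}. cnj (A $$ (j, i)) * z $ j) * cnj (e $ i))"
    using assms(3) by (simp add: scalar_prod_def)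
  also have "\<dots> = (\<Sum>i\<in>{0..<c}. \<Sum>j\<in>{0..<r}. z $ j * (cnj (A $$ (j, i)) * cnj (e $ i)))"
    unfolding sum_distrib_right by (intro sum.cong refl) (simp only: mult_ac)
  also have "\<dots> = (\<Sum>j\<in>{0..<r}. \<Sum>i\<in>{0..<c}. z $ j * (cnj (A $$ (j, i)) * cnj (e $ i)))"
    by (rule sum.swap)
  also have "\<dots> = z \<bullet>c (A *\<^sub>v e)"
    using assms by (simp add: scalar_prod_def sum_distrib_left)
  finally show ?thesis .
qed

lemma scalar_prod_euclid_norm: "x \<bullet>c x = of_real ((euclid_norm x)\<^sup>2)"
  by (simp add: scalar_prod_def euclid_norm_def sum_nonneg atLeast0LessThan complex_norm_square del: of_real_power)

text \<open>For an injective matrix the Gram matrix is invertible, because \<open>\<langle>A\<^sup>H A v, v\<rangle> = \<parallel>A v\<parallel>\<^sup>2\<close>.\<close>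

lemma pinv_normal_equations:
  assumes A: "A \<in> carrier_mat r c" and inj: "injective_mat A" and b: "b \<in> carrier_vec r"
  shows "pinv A *\<^sub>v b \<in> carrier_vec c" "mat_adjoint A *\<^sub>v (A *\<^sub>v (pinv A *\<^sub>v b) - b) = 0\<^sub>v c"
proof -
  define G where "G = mat_adjoint A * A"
  have aA: "mat_adjoint A \<in> carrier_mat c r"
    using A by simp
  have G: "G \<in> carrier_mat c c"
    unfolding G_def using mult_carrier_mat[OF aA A] .
  have "det G \<noteq> 0"
  proof
    assume "det G = 0"
    then obtain v where v: "v \<in> carrier_vec c" "v \<noteq> 0\<^sub>v c" "G *\<^sub>v v = 0\<^sub>v c"
      using det_0_iff_vec_prod_zero_field[OF G] by blast
    have Av: "A *\<^sub>v v \<in> carrier_vec r"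
      using A v(1) by simp
    have "mat_adjoint A *\<^sub>v (A *\<^sub>v v) = 0\<^sub>v c"
      using v(3) assoc_mult_mat_vec[OF aA A v(1)] by (simp add: G_def)
    then have "(A *\<^sub>v v) \<bullet>c (A *\<^sub>v v) = 0"
      using adjoint_scalar_prod[OF A Av v(1)] v(1) by simp
    then have "A *\<^sub>v v = 0\<^sub>v r"
      using conjugate_square_eq_0_vec[OF Av] by simp
    also have "\<dots> = A *\<^sub>v 0\<^sub>v c"
      using A by auto
    finally have "v = 0\<^sub>v c"
      using inj v(1) A unfolding injective_mat_def by (auto dest: inj_onD)
    with v(2) show False
      by simp
  qed
  then have "G \<in> Units (ring_mat TYPE(complex) c ())"
    by (rule det_non_zero_imp_unit[OF G])
  then obtain B where B: "mat_inverse G = Some B"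
    using mat_inverse(1)[OF G, of "()"] by (cases "mat_inverse G") auto
  then have GB: "G * B = 1\<^sub>m c" "B \<in> carrier_mat c c"
    using mat_inverse(2)[OF G B] by auto
  have d: "pinv A *\<^sub>v b = B *\<^sub>v (mat_adjoint A *\<^sub>v b)"
    unfolding pinv_def G_def[symmetric] B option.sel using GB(2) aA b by simp
  then show dc: "pinv A *\<^sub>v b \<in> carrier_vec c"
    using GB(2) aA b by simp
  have "mat_adjoint A *\<^sub>v (A *\<^sub>v (pinv A *\<^sub>v b)) = G *\<^sub>v (pinv A *\<^sub>v b)"
    using assoc_mult_mat_vec[OF aA A dc] by (simp add: G_def)
  also have "\<dots> = (G * B) *\<^sub>v (mat_adjoint A *\<^sub>v b)"
    unfolding d using assoc_mult_mat_vec[OF G GB(2)] aA b by simp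
  also have "\<dots> = mat_adjoint A *\<^sub>v b"
    unfolding GB(1) using aA b by simp
  finally have eq: "mat_adjoint A *\<^sub>v (A *\<^sub>v (pinv A *\<^sub>v b)) = mat_adjoint A *\<^sub>v b" .
  have "mat_adjoint A *\<^sub>v (A *\<^sub>v (pinv A *\<^sub>v b) - b)
      = mat_adjoint A *\<^sub>v (A *\<^sub>v (pinv A *\<^sub>v b)) - mat_adjoint A *\<^sub>v b"
    using mult_minus_distrib_mat_vec[OF aA] A dc b by simp
  then show "mat_adjoint A *\<^sub>v (A *\<^sub>v (pinv A *\<^sub>v b) - b) = 0\<^sub>v c"
    unfolding eq using aA b by simp
qed

section \<open>Smallest singular values\<close>

lemma nonneg_quadratic_imp_linear_zero:
  fixes a b :: real
  assumes "\<And>t. 0 \<le> 2 * t * a + t\<^sup>2 * b"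
  shows "a = 0"
proof -
  have "((\<lambda>t. 2 * t * a + t\<^sup>2 * b) has_real_derivative 2 * a) (at 0)"
    by (auto intro!: derivative_eq_intros)
  then have "2 * a = 0"
    using assms by (intro DERIV_local_min[of "\<lambda>t. 2 * t * a + t\<^sup>2 * b" _ 0 1]) auto
  then show ?thesis
    by simp
qed

lemma coeff_vec_scalar_prod:
  assumes "degree f \<le> l"
  shows "coeff_vec l f \<bullet>c coeff_vec l g = cinner (l2 f) (l2 g)"
proof -
  have "coeff_vec l f \<bullet>c coeff_vec l g = (\<Sum>i\<in>{0..<l + 1}. coeff f i * cnj (coeff g i))"
    by (simp add: scalar_prod_def)
  also have "\<dots> = (\<Sum>i\<le>l. coeff f i * cnj (coeff g i))"
    by (intro sum.cong) auto
  also have "\<dots> = cinner (l2 f) (l2 g)"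
    using assms by (subst cinner_cutoff[of _ l]) simp_all
  finally show ?thesis .
qed

text \<open>A minimizer of \<open>\<parallel>A x\<parallel>\<close> on the compact unit sphere is an eigenvector of the Gram matrix, because
  the quadratic form \<open>\<parallel>A x\<parallel>\<^sup>2 - \<lambda> \<parallel>x\<parallel>\<^sup>2\<close> is minimal there.\<close>

lemma ex_rayleigh_minimizer:
  fixes A :: "complex mat"
  assumes A: "A \<in> carrier_mat r (N + 1)"
  obtains x where "x \<in> carrier_vec (N + 1)" "euclid_norm x = 1"
    "(mat_adjoint A * A) *\<^sub>v x = of_real ((euclid_norm (A *\<^sub>v x))\<^sup>2) \<cdot>\<^sub>v x"
    "\<And>y. y \<in> carrier_vec (N + 1) \<Longrightarrow> euclid_norm (A *\<^sub>v x) * euclid_norm y \<le> euclid_norm (A *\<^sub>v y)"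
proof -
  \<comment> \<open>The matrix as a linear map between polynomials, where compactness of spheres is available.\<close>
  define g where "g = (\<lambda>P. \<Sum>j\<le>N. smul (coeff (poly_of P) j) (l2 (vec_poly (col A j))))"
  have poly_of_sum: "poly_of (sum f S) = (\<Sum>i\<in>S. poly_of (f i))" if "finite S" for f :: "nat \<Rightarrow> l2_poly" and S
    using that by induction simp_all
  have g_add: "g (P + Q) = g P + g Q" and g_scale: "g (smul c P) = smul c (g P)" for P Q c
    unfolding g_def poly_of_eq_iff
    by (simp_all add: poly_of_sum smult_add_left sum.distrib smult_sum2)
  have g_vec: "A *\<^sub>v coeff_vec N f = coeff_vec (r - 1) (poly_of (g (l2 f)))" if "r > 0" for f
  proof (rule eq_vecI)
    fix i assume "i < dim_vec (coeff_vec (r - 1) (poly_of (g (l2 f))))"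
    then have i: "i < r"
      using that by simp
    have "(A *\<^sub>v coeff_vec N f) $ i = (\<Sum>j\<in>{0..<N + 1}. A $$ (i, j) * coeff f j)"
      using A i by (simp add: scalar_prod_def)
    also have "\<dots> = (\<Sum>j\<le>N. coeff f j * A $$ (i, j))"
      by (intro sum.cong) auto
    also have "\<dots> = coeff (poly_of (g (l2 f))) i"
      using A i by (simp add: g_def poly_of_sum coeff_sum coeff_vec_poly)
    finally show "(A *\<^sub>v coeff_vec N f) $ i = coeff_vec (r - 1) (poly_of (g (l2 f))) $ i"
      using i by simp
  qed (use A that in simp)
  have g_deg: "degree (poly_of (g P)) \<le> r - 1" for P
    unfolding g_def poly_of_sum[OF finite_atMost] poly_of_simps
    using A by (intro degree_sum_le order_trans[OF degree_smult_le])
      (auto intro!: degree_le simp: coeff_vec_poly)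
  have g_norm: "euclid_norm (A *\<^sub>v coeff_vec N f) = norm (g (l2 f))" for f
  proof (cases "r = 0")
    case True
    have "vec_poly (col A j) = 0" for j
      using A True by (intro poly_eqI) (simp add: coeff_vec_poly)
    then show ?thesis
      using A True by (simp add: g_def euclid_norm_def l2_simps smul_simps)
  next
    case False
    then show ?thesis
      using g_deg[of "l2 f"] by (simp add: g_vec euclid_norm_coeff_vec)
  qed
  have "bounded_linear (\<lambda>P. coeff (poly_of P) j)" for j
    by (rule bounded_linear_intro[where K = 1])
      (simp_all add: scaleR_l2_poly_def norm_coeff_le scaleR_conv_of_real)
  moreover have "bounded_linear (\<lambda>c. smul c Q)" for Q
    by (rule bounded_linear_intro[where K = "norm Q"])
      (simp_all add: scaleR_l2_poly_def smul_simps scaleR_conv_of_real)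
  ultimately have "continuous_on S (\<lambda>P. smul (coeff (poly_of P) j) Q)" for S j Q
    using bounded_linear_compose linear_continuous_on by blast
  then have cont: "continuous_on S (\<lambda>P. norm (g P))" for S
    unfolding g_def by (intro continuous_on_norm continuous_on_sum)
  have "1 \<in> deg_le N \<inter> {p. norm p = 1}"
    by (simp add: deg_le_def norm_one_l2)
  then obtain P where P: "P \<in> deg_le N" "norm P = 1"
    and min: "\<And>Q. Q \<in> deg_le N \<Longrightarrow> norm Q = 1 \<Longrightarrow> norm (g P) \<le> norm (g Q)"
    using continuous_attains_inf[OF compact_deg_le_sphere _ cont, of N] by blast
  define lam where "lam = norm (g P)"
  have g_ge: "lam * norm Q \<le> norm (g Q)" if Q: "Q \<in> deg_le N" for Q
  proof (cases "Q = 0")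
    case False
    let ?Q = "smul (of_real (inverse (norm Q))) Q"
    have "lam \<le> norm (g ?Q)"
      unfolding lam_def using Q False by (intro min) (auto simp: norm_inverse)
    also have "norm (g ?Q) = norm (g Q) / norm Q"
      by (simp add: g_scale norm_inverse divide_inverse mult.commute)
    finally show ?thesis
      using False by (simp add: field_simps)
  qed simp
  define x where "x = coeff_vec N (poly_of P)"
  have x: "x \<in> carrier_vec (N + 1)" "euclid_norm x = 1" "euclid_norm (A *\<^sub>v x) = lam"
    using P by (simp_all add: x_def g_norm lam_def euclid_norm_coeff_vec deg_le_def)
  have stationary: "inner (g P) (g E) = lam\<^sup>2 * inner P E" if E: "E \<in> deg_le N" for E
  proof -
    have "0 \<le> 2 * t * (inner (g P) (g E) - lam\<^sup>2 * inner P E)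
        + t\<^sup>2 * ((norm (g E))\<^sup>2 - lam\<^sup>2 * (norm E)\<^sup>2)" for t :: real
    proof -
      have "lam * norm (P + scaleR t E) \<le> norm (g (P + scaleR t E))"
        using E P by (intro g_ge) auto
      then have "(lam * norm (P + scaleR t E))\<^sup>2 \<le> (norm (g (P + scaleR t E)))\<^sup>2"
        by (rule power_mono) (simp add: lam_def)
      moreover have "g (P + scaleR t E) = g P + scaleR t (g E)"
        by (simp add: g_add g_scale scaleR_l2_poly_def)
      moreover have "(norm (a + scaleR t b))\<^sup>2 = (norm a)\<^sup>2 + 2 * t * inner a b + t\<^sup>2 * (norm b)\<^sup>2"
        for a b :: l2_poly
        unfolding power2_norm_eq_inner
        by (simp add: inner_add_left inner_add_right inner_commute[of b a] power2_eq_square algebra_simps)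
      ultimately show ?thesis
        using P(2) by (simp add: power_mult_distrib lam_def algebra_simps)
    qed
    then show ?thesis
      using nonneg_quadratic_imp_linear_zero by fastforce
  qed
  have cstationary: "cinner (g P) (g E) = of_real (lam\<^sup>2) * cinner P E" if E: "E \<in> deg_le N" for E
  proof (rule complex_eqI)
    show "Re (cinner (g P) (g E)) = Re (of_real (lam\<^sup>2) * cinner P E)"
      using stationary[OF E] by (simp add: inner_l2_poly_def)
    \<comment> \<open>The imaginary part is the real part for the direction rotated by \<open>\<i>\<close>.\<close>
    have Im: "Im (cinner a b) = Re (cinner a (smul \<i> b))" for a b
      by (subst (2) cinner_commute, subst cinner_smul_left, subst (2) cinner_commute) simp
    show "Im (cinner (g P) (g E)) = Im (of_real (lam\<^sup>2) * cinner P E)"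
      using stationary[of "smul \<i> E"] E
      by (auto simp: inner_l2_poly_def Im g_scale)
  qed
  have aA: "mat_adjoint A \<in> carrier_mat (N + 1) r"
    using A by simp
  define y where "y = (mat_adjoint A * A) *\<^sub>v x - of_real (lam\<^sup>2) \<cdot>\<^sub>v x"
  have gram: "(mat_adjoint A * A) *\<^sub>v x = mat_adjoint A *\<^sub>v (A *\<^sub>v x)"
    using assoc_mult_mat_vec[OF aA A x(1)] .
  have Ax: "A *\<^sub>v x \<in> carrier_vec r"
    using mult_mat_vec_carrier[OF A x(1)] .
  have aAx: "mat_adjoint A *\<^sub>v (A *\<^sub>v x) \<in> carrier_vec (N + 1)"
    using mult_mat_vec_carrier[OF aA Ax] .
  have y: "y \<in> carrier_vec (N + 1)"
    unfolding y_def gram using aAx x(1) by (intro minus_carrier_vec smult_carrier_vec[THEN iffD2])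
  have "y \<bullet>c y = 0"
  proof -
    let ?E = "vec_poly y"
    have E: "coeff_vec N ?E = y" "degree ?E \<le> N"
      using y by (simp_all add: coeff_vec_vec_poly degree_vec_poly)
    have "y \<bullet>c y = (mat_adjoint A *\<^sub>v (A *\<^sub>v x)) \<bullet>c y - (of_real (lam\<^sup>2) \<cdot>\<^sub>v x) \<bullet>c y"
      unfolding y_def[folded gram, unfolded gram]
      using minus_scalar_prod_distrib[OF aAx, of "of_real (lam\<^sup>2) \<cdot>\<^sub>v x" "conjugate y"] x(1) y
      by (simp add: y_def gram)
    also have "(mat_adjoint A *\<^sub>v (A *\<^sub>v x)) \<bullet>c y = (A *\<^sub>v x) \<bullet>c (A *\<^sub>v y)"
      by (rule adjoint_scalar_prod[OF A Ax y])
    also have "\<dots> = cinner (g P) (g (l2 ?E))"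
    proof (cases "r = 0")
      case True
      have "vec_poly (col A j) = 0" for j
        using A True by (intro poly_eqI) (simp add: coeff_vec_poly)
      then show ?thesis
        using A True by (simp add: g_def scalar_prod_def l2_simps smul_simps cinner_def)
    next
      case False
      then have "A *\<^sub>v x = coeff_vec (r - 1) (poly_of (g P))"
        "A *\<^sub>v y = coeff_vec (r - 1) (poly_of (g (l2 ?E)))"
        using g_vec[of "poly_of P"] g_vec[of ?E] by (simp_all add: x_def E(1))
      then show ?thesis
        using coeff_vec_scalar_prod[OF g_deg[of P]] by simp
    qed
    also have "(of_real (lam\<^sup>2) \<cdot>\<^sub>v x) \<bullet>c y = of_real (lam\<^sup>2) * cinner P (l2 ?E)"
      using P(1) coeff_vec_scalar_prod[of "poly_of P" N ?E] y
      by (simp add: E(1) x_def deg_le_def del: of_real_power)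
    also have "cinner (g P) (g (l2 ?E)) = of_real (lam\<^sup>2) * cinner P (l2 ?E)"
      using E(2) by (intro cstationary) simp
    finally show ?thesis
      by simp
  qed
  then have "y = 0\<^sub>v (N + 1)"
    using conjugate_square_eq_0_vec[OF y] by simp
  then have eig: "(mat_adjoint A * A) *\<^sub>v x = of_real (lam\<^sup>2) \<cdot>\<^sub>v x"
  proof -
    have *: "(mat_adjoint A * A) *\<^sub>v x \<in> carrier_vec (N + 1)"
      unfolding gram by (rule aAx)
    show ?thesis
    proof (rule eq_vecI)
      fix i assume "i < dim_vec (of_real (lam\<^sup>2) \<cdot>\<^sub>v x)"
      then have "i < N + 1"
        using x(1) by simp
      then have "y $ i = 0"
        using \<open>y = 0\<^sub>v (N + 1)\<close> by simp
      then show "((mat_adjoint A * A) *\<^sub>v x) $ i = (of_real (lam\<^sup>2) \<cdot>\<^sub>v x) $ i"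
        using * x(1) \<open>i < N + 1\<close> by (simp add: y_def)
    qed (use carrier_vecD[OF *] x(1) in simp)
  qed
  show thesis
  proof (rule that[OF x(1,2)])
    show "(mat_adjoint A * A) *\<^sub>v x = of_real ((euclid_norm (A *\<^sub>v x))\<^sup>2) \<cdot>\<^sub>v x"
      using eig by (simp add: x(3))
    fix z :: "complex Matrix.vec" assume z: "z \<in> carrier_vec (N + 1)"
    then show "euclid_norm (A *\<^sub>v x) * euclid_norm z \<le> euclid_norm (A *\<^sub>v z)"
      using g_ge[of "l2 (vec_poly z)"] g_norm[of "vec_poly z"] euclid_norm_coeff_vec[of "vec_poly z" N]
      by (simp add: x(3) coeff_vec_vec_poly degree_vec_poly)
  qed
qed

lemma gram_eigenvector_norm:
  assumes A: "A \<in> carrier_mat r c" and x: "x \<in> carrier_vec c"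
    and eig: "(mat_adjoint A * A) *\<^sub>v x = of_real (\<sigma>\<^sup>2) \<cdot>\<^sub>v x" and "\<sigma> \<ge> 0"
  shows "euclid_norm (A *\<^sub>v x) = \<sigma> * euclid_norm x"
proof -
  have aA: "mat_adjoint A \<in> carrier_mat c r"
    using A by simp
  have "complex_of_real ((euclid_norm (A *\<^sub>v x))\<^sup>2) = (A *\<^sub>v x) \<bullet>c (A *\<^sub>v x)"
    by (simp only: scalar_prod_euclid_norm)
  also have "\<dots> = ((mat_adjoint A * A) *\<^sub>v x) \<bullet>c x"
    using A x by (subst adjoint_scalar_prod[symmetric]) (auto simp: assoc_mult_mat_vec[OF aA A x])
  also have "\<dots> = of_real (\<sigma>\<^sup>2) * (x \<bullet>c x)"
    unfolding eig using x by simp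
  also have "\<dots> = of_real ((\<sigma> * euclid_norm x)\<^sup>2)"
    by (simp add: scalar_prod_euclid_norm power_mult_distrib)
  finally have "(euclid_norm (A *\<^sub>v x))\<^sup>2 = (\<sigma> * euclid_norm x)\<^sup>2"
    by (simp only: of_real_eq_iff)
  then show ?thesis
    by (rule power2_eq_imp_eq) (simp_all add: euclid_norm_nonneg assms(4))
qed

text \<open>Every eigenvalue of the Gram matrix is a Rayleigh quotient, so the minimal one found on the unit
  sphere is the smallest of them.\<close>

lemma sigma_min_properties:
  fixes A :: "complex mat"
  assumes A: "A \<in> carrier_mat r (N + 1)"
  shows "\<exists>x. min_right_singular_vector A x"
    and "min_right_singular_vector A x \<Longrightarrow> euclid_norm (A *\<^sub>v x) = sigma_min A"
    and "y \<in> carrier_vec (N + 1) \<Longrightarrow> sigma_min A * euclid_norm y \<le> euclid_norm (A *\<^sub>v y)"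
proof -
  obtain x0 where x0: "x0 \<in> carrier_vec (N + 1)" "euclid_norm x0 = 1"
    "(mat_adjoint A * A) *\<^sub>v x0 = of_real ((euclid_norm (A *\<^sub>v x0))\<^sup>2) \<cdot>\<^sub>v x0"
    and min: "\<And>y. y \<in> carrier_vec (N + 1) \<Longrightarrow> euclid_norm (A *\<^sub>v x0) * euclid_norm y \<le> euclid_norm (A *\<^sub>v y)"
    using ex_rayleigh_minimizer[OF A] by blast
  define G where "G = mat_adjoint A * A"
  have G: "G \<in> carrier_mat (N + 1) (N + 1)"
    unfolding G_def using A by (intro mult_carrier_mat[of _ _ r]) auto
  define \<Sigma> where "\<Sigma> = {\<sigma>. 0 \<le> \<sigma> \<and> eigenvalue G (complex_of_real (\<sigma>\<^sup>2))}"
  have "finite (Collect (eigenvalue G))"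
    using card_finite_spectrum(1)[OF G] by (simp add: spectrum_def)
  moreover have "inj_on (\<lambda>\<sigma>. complex_of_real (\<sigma>\<^sup>2)) {0..}"
    by (auto intro!: inj_onI simp del: of_real_power)
  ultimately have "finite ((\<lambda>\<sigma>. complex_of_real (\<sigma>\<^sup>2)) -` Collect (eigenvalue G) \<inter> {0..})"
    by (rule finite_vimage_IntI)
  then have fin: "finite \<Sigma>"
    by (rule rev_finite_subset) (auto simp: \<Sigma>_def)
  have x0_nonzero: "x0 \<noteq> 0\<^sub>v (N + 1)"
    using x0(2) by (auto simp: euclid_norm_def)
  have "eigenvector G x0 (of_real ((euclid_norm (A *\<^sub>v x0))\<^sup>2))"
    unfolding eigenvector_def carrier_matD(1)[OF G] unfolding G_def using x0(1,3) x0_nonzero by blast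
  then have "euclid_norm (A *\<^sub>v x0) \<in> \<Sigma>"
    unfolding \<Sigma>_def eigenvalue_def using euclid_norm_nonneg by blast
  moreover have "euclid_norm (A *\<^sub>v x0) \<le> \<sigma>" if "\<sigma> \<in> \<Sigma>" for \<sigma>
  proof -
    have "\<sigma> \<ge> 0" "eigenvalue G (complex_of_real (\<sigma>\<^sup>2))"
      using that by (simp_all add: \<Sigma>_def)
    then obtain y where y: "y \<in> carrier_vec (N + 1)" "y \<noteq> 0\<^sub>v (N + 1)" "G *\<^sub>v y = complex_of_real (\<sigma>\<^sup>2) \<cdot>\<^sub>v y"
      unfolding eigenvalue_def eigenvector_def carrier_matD(1)[OF G] by blast
    have "euclid_norm y \<noteq> 0"
    proof
      assume "euclid_norm y = 0"
      then have "y \<bullet>c y = 0"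
        by (simp add: scalar_prod_euclid_norm)
      then show False
        using conjugate_square_eq_0_vec[OF y(1)] y(2) by simp
    qed
    then show ?thesis
      using min[OF y(1)] gram_eigenvector_norm[OF A y(1) y(3)[unfolded G_def] \<open>\<sigma> \<ge> 0\<close>]
        euclid_norm_nonneg[of y] by simp
  qed
  ultimately have sigma: "sigma_min A = euclid_norm (A *\<^sub>v x0)"
    unfolding sigma_min_def G_def[symmetric] \<Sigma>_def[symmetric] using fin by (intro Min_eqI) auto
  show "\<exists>x. min_right_singular_vector A x"
    using x0 A by (intro exI[of _ x0]) (simp add: min_right_singular_vector_def sigma)
  show "y \<in> carrier_vec (N + 1) \<Longrightarrow> sigma_min A * euclid_norm y \<le> euclid_norm (A *\<^sub>v y)"
    unfolding sigma by (rule min)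
  show "euclid_norm (A *\<^sub>v x) = sigma_min A" if "min_right_singular_vector A x"
    using that A gram_eigenvector_norm[OF A, of x "sigma_min A"]
    by (simp add: min_right_singular_vector_def sigma euclid_norm_nonneg)
qed

section \<open>The algorithm in terms of the factorization map\<close>

text \<open>The stacked vector \<open>[c; p; q]\<close> in the range of the residual of the algorithm.\<close>

definition out_vec :: "nat \<Rightarrow> nat \<Rightarrow> complex \<times> l2_poly \<times> l2_poly \<Rightarrow> complex Matrix.vec" where
  "out_vec m n = (\<lambda>(c, P, Q). Matrix.vec 1 (\<lambda>_. c) @\<^sub>v coeff_vec m (poly_of P) @\<^sub>v coeff_vec n (poly_of Q))"

definition out_space :: "nat \<Rightarrow> nat \<Rightarrow> (complex \<times> l2_poly \<times> l2_poly) set" where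
  "out_space m n = UNIV \<times> deg_le m \<times> deg_le n"

definition polys :: "trip \<Rightarrow> triplet" where
  "polys = (\<lambda>(u, v, w). (poly_of u, poly_of v, poly_of w))"

lemma vec_of_list_single: "vec_of_list [c] = Matrix.vec 1 (\<lambda>_. c)"
  by (rule eq_vecI) (simp_all add: vec_of_list_index del: vec_of_list_Cons)

lemma out_vec_carrier [simp]: "out_vec m n x \<in> carrier_vec (1 + ((m + 1) + (n + 1)))"
  unfolding out_vec_def split_beta by (intro append_carrier_vec) simp_all

lemma out_vec_diff: "out_vec m n (x - y) = out_vec m n x - out_vec m n y"
proof -
  have "Matrix.vec 1 (\<lambda>_. a - b) = Matrix.vec 1 (\<lambda>_. a) - Matrix.vec 1 (\<lambda>_. b)" for a b :: complex
    by (rule eq_vecI) auto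
  then show ?thesis
    by (simp add: out_vec_def split_beta append_vec_diff coeff_vec_diff)
qed

lemma out_vec_scalar_prod:
  assumes "x \<in> out_space m n"
  shows "out_vec m n x \<bullet>c out_vec m n y =
    fst x * cnj (fst y) + cinner (fst (snd x)) (fst (snd y)) + cinner (snd (snd x)) (snd (snd y))"
proof -
  obtain a P Q where x: "x = (a, P, Q)" by (metis prod_cases3)
  obtain b P' Q' where y: "y = (b, P', Q')" by (metis prod_cases3)
  have deg: "degree (poly_of P) \<le> m" "degree (poly_of Q) \<le> n"
    using assms by (auto simp: out_space_def deg_le_def x)
  have split: "(v1 @\<^sub>v v2) \<bullet>c (w1 @\<^sub>v w2) = v1 \<bullet>c w1 + v2 \<bullet>c w2"
    if "v1 \<in> carrier_vec n1" "v2 \<in> carrier_vec n2" "w1 \<in> carrier_vec n1" "w2 \<in> carrier_vec n2"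
    for v1 v2 w1 w2 :: "complex Matrix.vec" and n1 n2
  proof -
    have "conjugate (w1 @\<^sub>v w2) = conjugate w1 @\<^sub>v conjugate w2"
      using that by (intro eq_vecI) auto
    then show ?thesis
      using that by (simp add: scalar_prod_append[of _ n1 _ n2])
  qed
  have first: "Matrix.vec 1 (\<lambda>_. a) \<bullet>c Matrix.vec 1 (\<lambda>_. b) = a * cnj b"
    by (simp add: scalar_prod_def)
  have tail: "coeff_vec m f @\<^sub>v coeff_vec n g \<in> carrier_vec ((m + 1) + (n + 1))" for f g
    by (intro append_carrier_vec) simp_all
  have "out_vec m n x \<bullet>c out_vec m n y = Matrix.vec 1 (\<lambda>_. a) \<bullet>c Matrix.vec 1 (\<lambda>_. b) +
      (coeff_vec m (poly_of P) @\<^sub>v coeff_vec n (poly_of Q)) \<bullet>c (coeff_vec m (poly_of P') @\<^sub>v coeff_vec n (poly_of Q'))"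
    unfolding out_vec_def x y prod.case by (rule split[OF _ tail _ tail]) simp_all
  also have "(coeff_vec m (poly_of P) @\<^sub>v coeff_vec n (poly_of Q)) \<bullet>c (coeff_vec m (poly_of P') @\<^sub>v coeff_vec n (poly_of Q'))
      = cinner P P' + cinner Q Q'"
    by (subst split[of _ "m + 1" _ "n + 1"])
      (simp_all add: coeff_vec_scalar_prod[OF deg(1)] coeff_vec_scalar_prod[OF deg(2)])
  finally show ?thesis
    by (simp add: first[unfolded One_nat_def] x y)
qed

lemma inner_out_vec:
  assumes "x \<in> out_space m n"
  shows "inner x y = Re (out_vec m n x \<bullet>c out_vec m n y)"
  by (simp add: out_vec_scalar_prod[OF assms] inner_prod_def inner_l2_poly_def inner_complex_def)

lemma euclid_norm_out_vec:
  assumes "x \<in> out_space m n"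
  shows "euclid_norm (out_vec m n x) = norm x"
proof -
  have "(euclid_norm (out_vec m n x))\<^sup>2 = Re (out_vec m n x \<bullet>c out_vec m n x)"
    by (simp only: scalar_prod_euclid_norm Re_complex_of_real)
  also have "\<dots> = (norm x)\<^sup>2"
    by (simp only: inner_out_vec[OF assms, symmetric] power2_norm_eq_inner)
  finally show ?thesis
    by (rule power2_eq_imp_eq) (simp_all add: euclid_norm_nonneg)
qed

lemma out_space_diff: "x \<in> out_space m n \<Longrightarrow> y \<in> out_space m n \<Longrightarrow> x - y \<in> out_space m n"
  by (auto simp: out_space_def)

lemma out_vec_eq_imp_eq:
  assumes "x \<in> out_space m n" "y \<in> out_space m n" "out_vec m n x = out_vec m n y"
  shows "x = y"
proof -
  have "norm (x - y) = euclid_norm (out_vec m n x - out_vec m n y)"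
    using assms by (simp only: euclid_norm_out_vec[OF out_space_diff, symmetric] out_vec_diff)
  also have "\<dots> = 0"
    by (simp add: assms(3) euclid_norm_def)
  finally show ?thesis
    by simp
qed

lemma fac_in_out_space:
  assumes "z \<in> trips m n k" "k \<le> m" "k \<le> n"
  shows "fac h z \<in> out_space m n"
  using assms deg_le_mult[of _ k _ "m - k"] deg_le_mult[of _ k _ "n - k"]
  by (fastforce simp: trips_def fac_def out_space_def)

lemma dfac_in_out_space:
  assumes "z \<in> trips m n k" "d \<in> trips m n k" "k \<le> m" "k \<le> n"
  shows "dfac h z d \<in> out_space m n"
proof -
  have "a * b \<in> deg_le m" if "a \<in> deg_le k" "b \<in> deg_le (m - k)" for a b
    using deg_le_mult[OF that] assms(3) by simp
  moreover have "a * b \<in> deg_le n" if "a \<in> deg_le k" "b \<in> deg_le (n - k)" for a b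
    using deg_le_mult[OF that] assms(4) by simp
  ultimately show ?thesis
    using assms by (auto simp: trips_def dfac_def out_space_def)
qed

subsection \<open>Triplets and their coefficient vectors\<close>

lemma triplet_vec_carrier [simp]:
  "triplet_vec m n k t \<in> carrier_vec ((k + 1) + ((m - k + 1) + (n - k + 1)))"
  unfolding triplet_vec_def split_beta by (intro append_carrier_vec) simp_all

lemma triplet_vec_diff:
  "triplet_vec m n k (polys (z - d)) = triplet_vec m n k (polys z) - triplet_vec m n k (polys d)"
  by (simp add: triplet_vec_def polys_def split_beta append_vec_diff coeff_vec_diff)

lemma vec_triplet_triplet_vec:
  assumes "z \<in> trips m n k"
  shows "vec_triplet m n k (triplet_vec m n k (polys z)) = polys z"
proof -
  obtain u v w where z: "z = (u, v, w)" by (metis prod_cases3)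
  let ?x = "triplet_vec m n k (polys z)"
  have "Matrix.vec (k + 1) (\<lambda>i. ?x $ i) = coeff_vec k (poly_of u)"
    "Matrix.vec (m - k + 1) (\<lambda>i. ?x $ (k + 1 + i)) = coeff_vec (m - k) (poly_of v)"
    "Matrix.vec (n - k + 1) (\<lambda>i. ?x $ (k + 1 + (m - k + 1) + i)) = coeff_vec (n - k) (poly_of w)"
    by (auto intro!: eq_vecI simp: triplet_vec_def polys_def z)
  then show ?thesis
    unfolding vec_triplet_def using assms
    by (simp only:) (simp add: vec_poly_coeff_vec trips_def deg_le_def z polys_def)
qed

lemma triplet_vec_surj:
  assumes "x \<in> carrier_vec ((k + 1) + ((m - k + 1) + (n - k + 1)))"
  obtains z where "z \<in> trips m n k" "x = triplet_vec m n k (polys z)"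
proof -
  define a where "a = vec_first x (k + 1)"
  define y where "y = vec_last x ((m - k + 1) + (n - k + 1))"
  define b where "b = vec_first y (m - k + 1)"
  define c where "c = vec_last y (n - k + 1)"
  have x: "x = a @\<^sub>v y"
    unfolding a_def y_def using assms by simp
  have "y \<in> carrier_vec ((m - k + 1) + (n - k + 1))"
    unfolding y_def by simp
  then have y: "y = b @\<^sub>v c"
    unfolding b_def c_def by simp
  have carr: "a \<in> carrier_vec (k + 1)" "b \<in> carrier_vec (m - k + 1)" "c \<in> carrier_vec (n - k + 1)"
    unfolding a_def b_def c_def by simp_all
  show thesis
  proof (rule that[of "(l2 (vec_poly a), l2 (vec_poly b), l2 (vec_poly c))"])
    show "(l2 (vec_poly a), l2 (vec_poly b), l2 (vec_poly c)) \<in> trips m n k"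
      using carr by (simp add: trips_def degree_vec_poly)
    show "x = triplet_vec m n k (polys (l2 (vec_poly a), l2 (vec_poly b), l2 (vec_poly c)))"
      using carr by (simp add: triplet_vec_def polys_def coeff_vec_vec_poly x y)
  qed
qed

subsection \<open>The residual and its Jacobian\<close>

lemma adjoint_row_carrier [simp]: "adjoint_row (coeff_vec k h) \<in> carrier_mat 1 (k + 1)"
  by (simp add: adjoint_row_def)

lemma adjoint_row_mult:
  assumes "degree u \<le> k"
  shows "adjoint_row (coeff_vec k h) *\<^sub>v coeff_vec k u = Matrix.vec 1 (\<lambda>_. cinner (l2 u) (l2 h))"
proof (rule eq_vecI)
  fix i assume "i < dim_vec (Matrix.vec 1 (\<lambda>_. cinner (l2 u) (l2 h)))"
  then have i: "i = 0"
    by simp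
  have "(adjoint_row (coeff_vec k h) *\<^sub>v coeff_vec k u) $ 0 = conjugate (coeff_vec k h) \<bullet> coeff_vec k u"
    by (simp add: adjoint_row_def)
  also have "\<dots> = coeff_vec k u \<bullet>c coeff_vec k h"
    by (rule comm_scalar_prod[of _ "k + 1"]) simp_all
  finally show "(adjoint_row (coeff_vec k h) *\<^sub>v coeff_vec k u) $ i = Matrix.vec 1 (\<lambda>_. cinner (l2 u) (l2 h)) $ i"
    using coeff_vec_scalar_prod[OF assms] by (simp add: i)
qed (simp add: adjoint_row_def)

lemma gn_fun_eq:
  assumes "z \<in> trips m n k" "k \<le> m" "k \<le> n"
  shows "gn_fun m n k (coeff_vec k h) (polys z) = out_vec m n (fac (l2 h) z)"
proof -
  obtain u v w where z: "z = (u, v, w)" by (metis prod_cases3)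
  have "degree (poly_of u) \<le> k"
    using assms(1) by (simp add: trips_def deg_le_def z)
  then show ?thesis
    using assms(2,3)
    by (simp add: gn_fun_def polys_def z out_vec_def fac_def adjoint_row_mult
        conv_mat_mult[of _ k m "m - k"] conv_mat_mult[of _ k n "n - k"] mult.commute)
qed

lemma gn_rhs_eq: "gn_rhs m n p q = out_vec m n (1, l2 p, l2 q)"
  by (simp add: gn_rhs_def out_vec_def vec_of_list_single del: vec_of_list_Cons)

lemma gn_jacobian_carrier:
  assumes "k \<le> m" "k \<le> n"
  shows "gn_jacobian m n k (coeff_vec k h) t
    \<in> carrier_mat (1 + ((m + 1) + (n + 1))) ((k + 1) + ((m - k + 1) + (n - k + 1)))"
proof -
  have "conv_mat (m - k) k f \<in> carrier_mat (m + 1) (k + 1)"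
    "conv_mat k (m - k) f \<in> carrier_mat (m + 1) (m - k + 1)"
    "conv_mat (n - k) k f \<in> carrier_mat (n + 1) (k + 1)"
    "conv_mat k (n - k) f \<in> carrier_mat (n + 1) (n - k + 1)" for f
    using conv_mat_carrier(1)[of "m - k" k f] conv_mat_carrier(1)[of k "m - k" f]
      conv_mat_carrier(1)[of "n - k" k f] conv_mat_carrier(1)[of k "n - k" f] assms by simp_all
  then show ?thesis
    unfolding gn_jacobian_def split_beta
    by (intro carrier_append_rows append_cols_carrier adjoint_row_carrier zero_carrier_mat)
qed

lemma gn_jacobian_mult:
  assumes z: "z \<in> trips m n k" and d: "d \<in> trips m n k" and k: "k \<le> m" "k \<le> n"
  shows "gn_jacobian m n k (coeff_vec k h) (polys z) *\<^sub>v triplet_vec m n k (polys d) = out_vec m n (dfac (l2 h) z d)"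
proof -
  obtain u v w where zz: "z = (u, v, w)" by (metis prod_cases3)
  obtain a b c where dd: "d = (a, b, c)" by (metis prod_cases3)
  have deg: "degree (poly_of a) \<le> k" "degree (poly_of b) \<le> m - k" "degree (poly_of c) \<le> n - k"
    using d by (simp_all add: trips_def deg_le_def dd)
  let ?h = "adjoint_row (coeff_vec k h)"
  let ?a = "coeff_vec k (poly_of a)" and ?b = "coeff_vec (m - k) (poly_of b)"
    and ?c = "coeff_vec (n - k) (poly_of c)"
  let ?Cv = "conv_mat (m - k) k (poly_of v)" and ?Cw = "conv_mat (n - k) k (poly_of w)"
    and ?Dm = "conv_mat k (m - k) (poly_of u)" and ?Dn = "conv_mat k (n - k) (poly_of u)"
  have C: "?Cv \<in> carrier_mat (m + 1) (k + 1)" "?Cw \<in> carrier_mat (n + 1) (k + 1)"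
    "?Dm \<in> carrier_mat (m + 1) (m - k + 1)" "?Dn \<in> carrier_mat (n + 1) (n - k + 1)"
    using conv_mat_carrier(1)[of "m - k" k] conv_mat_carrier(1)[of k "m - k"]
      conv_mat_carrier(1)[of "n - k" k] conv_mat_carrier(1)[of k "n - k"] k by simp_all
  have v: "?a \<in> carrier_vec (k + 1)" "?b \<in> carrier_vec (m - k + 1)" "?c \<in> carrier_vec (n - k + 1)"
    by simp_all
  have bc: "?b @\<^sub>v ?c \<in> carrier_vec ((m - k + 1) + (n - k + 1))"
    by (intro append_carrier_vec v)
  have abc: "?a @\<^sub>v (?b @\<^sub>v ?c) \<in> carrier_vec ((k + 1) + ((m - k + 1) + (n - k + 1)))"
    by (intro append_carrier_vec v)
  have row: "(X @\<^sub>c (Y @\<^sub>c Z)) *\<^sub>v (?a @\<^sub>v (?b @\<^sub>v ?c)) = X *\<^sub>v ?a + (Y *\<^sub>v ?b + Z *\<^sub>v ?c)"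
    and row_carrier: "X @\<^sub>c (Y @\<^sub>c Z) \<in> carrier_mat nr ((k + 1) + ((m - k + 1) + (n - k + 1)))"
    if "X \<in> carrier_mat nr (k + 1)" "Y \<in> carrier_mat nr (m - k + 1)" "Z \<in> carrier_mat nr (n - k + 1)" for X Y Z nr
    using append_cols_mult[OF that(1) append_cols_carrier[OF that(2,3)] v(1) bc]
      append_cols_mult[OF that(2,3) v(2,3)] append_cols_carrier[OF that(1) append_cols_carrier[OF that(2,3)]]
    by simp_all
  let ?R1 = "?h @\<^sub>c (0\<^sub>m 1 (m - k + 1) @\<^sub>c 0\<^sub>m 1 (n - k + 1))"
  let ?R2 = "?Cv @\<^sub>c (?Dm @\<^sub>c 0\<^sub>m (m + 1) (n - k + 1))"
  let ?R3 = "?Cw @\<^sub>c (0\<^sub>m (n + 1) (m - k + 1) @\<^sub>c ?Dn)"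
  have R: "?R1 \<in> carrier_mat 1 ((k + 1) + ((m - k + 1) + (n - k + 1)))"
    "?R2 \<in> carrier_mat (m + 1) ((k + 1) + ((m - k + 1) + (n - k + 1)))"
    "?R3 \<in> carrier_mat (n + 1) ((k + 1) + ((m - k + 1) + (n - k + 1)))"
    by (intro row_carrier adjoint_row_carrier C zero_carrier_mat)+
  have "gn_jacobian m n k (coeff_vec k h) (polys z) *\<^sub>v triplet_vec m n k (polys d) =
      (?R1 *\<^sub>v (?a @\<^sub>v (?b @\<^sub>v ?c))) @\<^sub>v (?R2 *\<^sub>v (?a @\<^sub>v (?b @\<^sub>v ?c))) @\<^sub>v (?R3 *\<^sub>v (?a @\<^sub>v (?b @\<^sub>v ?c)))"
    using mat_mult_append[OF R(1) carrier_append_rows[OF R(2,3)] abc] mat_mult_append[OF R(2,3) abc]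
    by (simp add: gn_jacobian_def triplet_vec_def polys_def zz dd)
  also have "?R1 *\<^sub>v (?a @\<^sub>v (?b @\<^sub>v ?c)) = Matrix.vec 1 (\<lambda>_. cinner a (l2 h))"
    using row[OF adjoint_row_carrier zero_carrier_mat zero_carrier_mat]
      zero_mat_mult_vec[OF v(2), of 1] zero_mat_mult_vec[OF v(3), of 1] adjoint_row_mult[OF deg(1)]
    by simp
  also have "?R2 *\<^sub>v (?a @\<^sub>v (?b @\<^sub>v ?c)) = coeff_vec m (poly_of (a * v + u * b))"
    using row[OF C(1,3) zero_carrier_mat] zero_mat_mult_vec[OF v(3), of "m + 1"]
      conv_mat_mult[OF deg(1), of m "m - k"] conv_mat_mult[OF deg(2), of m k] k
    by (simp add: coeff_vec_add mult.commute[of "poly_of a"])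
  also have "?R3 *\<^sub>v (?a @\<^sub>v (?b @\<^sub>v ?c)) = coeff_vec n (poly_of (a * w + u * c))"
    using row[OF C(2) zero_carrier_mat C(4)] zero_mat_mult_vec[OF v(2), of "n + 1"]
      conv_mat_mult[OF deg(1), of n "n - k"] conv_mat_mult[OF deg(3), of n k] k
    by (simp add: coeff_vec_add mult.commute[of "poly_of a"])
  finally show ?thesis
    by (simp add: out_vec_def dfac_def zz dd)
qed

text \<open>The step with the pseudoinverse goes along a Gauss--Newton direction: the normal equations say
  that its linearized residual is orthogonal to the range of the Jacobian.\<close>

lemma gn_step_eq:
  assumes z: "z \<in> trips m n k" and k: "k \<le> m" "k \<le> n" and pq: "degree p \<le> m" "degree q \<le> n"
    and lower: "\<And>d. d \<in> trips m n k \<Longrightarrow> \<gamma> * norm d \<le> norm (dfac (l2 h) z d)" "\<gamma> > 0"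
  obtains d where "gn_direction m n k (l2 h) (l2 p) (l2 q) z d"
    "gn_step m n k p q (coeff_vec k h) (polys z) = Some (polys (z - d))"
proof -
  let ?r = "1 + ((m + 1) + (n + 1))" and ?c = "(k + 1) + ((m - k + 1) + (n - k + 1))"
  define J where "J = gn_jacobian m n k (coeff_vec k h) (polys z)"
  have J: "J \<in> carrier_mat ?r ?c"
    unfolding J_def using k by (rule gn_jacobian_carrier)
  have J_mult: "J *\<^sub>v triplet_vec m n k (polys d) = out_vec m n (dfac (l2 h) z d)" if "d \<in> trips m n k" for d
    unfolding J_def by (rule gn_jacobian_mult[OF z that k])
  have inj: "injective_mat J"
    unfolding injective_mat_def carrier_matD(2)[OF J]
  proof (rule inj_onI)
    fix x y :: "complex Matrix.vec"
    assume x: "x \<in> carrier_vec ?c" and y: "y \<in> carrier_vec ?c" and eq: "J *\<^sub>v x = J *\<^sub>v y"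
    obtain a where a: "a \<in> trips m n k" "x = triplet_vec m n k (polys a)"
      using triplet_vec_surj[OF x] .
    obtain b where b: "b \<in> trips m n k" "y = triplet_vec m n k (polys b)"
      using triplet_vec_surj[OF y] .
    have "dfac (l2 h) z a = dfac (l2 h) z b"
      using eq J_mult[OF a(1)] J_mult[OF b(1)] a(2) b(2)
      by (intro out_vec_eq_imp_eq[OF dfac_in_out_space[OF z a(1) k] dfac_in_out_space[OF z b(1) k]]) simp
    then have "\<gamma> * norm (a - b) \<le> 0"
      using lower(1)[OF trips_closed(2)[OF a(1) b(1)]] by (simp add: dfac_linear)
    then have "a = b"
      using lower(2) by (simp add: mult_le_0_iff)
    then show "x = y"
      using a(2) b(2) by simp
  qed
  define b where "b = fac (l2 h) z - (1, l2 p, l2 q)"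
  have rhs_space: "(1, l2 p, l2 q) \<in> out_space m n"
    using pq by (simp add: out_space_def)
  have b: "b \<in> out_space m n"
    unfolding b_def by (rule out_space_diff[OF fac_in_out_space[OF z k] rhs_space])
  have b_vec: "gn_fun m n k (coeff_vec k h) (polys z) - gn_rhs m n p q = out_vec m n b"
    by (simp add: gn_fun_eq[OF z k] gn_rhs_eq b_def out_vec_diff)
  have pinv: "pinv J *\<^sub>v out_vec m n b \<in> carrier_vec ?c"
    "mat_adjoint J *\<^sub>v (J *\<^sub>v (pinv J *\<^sub>v out_vec m n b) - out_vec m n b) = 0\<^sub>v ?c"
    using pinv_normal_equations[OF J inj out_vec_carrier] .
  obtain d where d: "d \<in> trips m n k" "pinv J *\<^sub>v out_vec m n b = triplet_vec m n k (polys d)"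
    using triplet_vec_surj[OF pinv(1)] .
  show thesis
  proof (rule that)
    show "gn_step m n k p q (coeff_vec k h) (polys z) = Some (polys (z - d))"
      using inj d vec_triplet_triplet_vec[OF trips_closed(2)[OF z d(1)]]
      by (simp add: gn_step_def J_def[symmetric] b_vec triplet_vec_diff)
    show "gn_direction m n k (l2 h) (l2 p) (l2 q) z d"
      unfolding gn_direction_def
    proof (intro conjI ballI d(1))
      fix e assume e: "e \<in> trips m n k"
      let ?res = "dfac (l2 h) z d - b"
      have res: "?res \<in> out_space m n"
        by (rule out_space_diff[OF dfac_in_out_space[OF z d(1) k] b])
      have zero: "mat_adjoint J *\<^sub>v out_vec m n ?res = 0\<^sub>v ?c"
        using pinv(2) unfolding d(2) J_mult[OF d(1)] out_vec_diff .
      have "inner ?res (dfac (l2 h) z e) = Re (out_vec m n ?res \<bullet>c out_vec m n (dfac (l2 h) z e))"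
        by (rule inner_out_vec[OF res])
      also have "out_vec m n ?res \<bullet>c out_vec m n (dfac (l2 h) z e)
          = (mat_adjoint J *\<^sub>v out_vec m n ?res) \<bullet>c triplet_vec m n k (polys e)"
        unfolding J_mult[OF e, symmetric]
        by (rule adjoint_scalar_prod[OF J out_vec_carrier triplet_vec_carrier, symmetric])
      also have "\<dots> = 0"
        unfolding zero by (rule scalar_prod_left_zero) (simp only: carrier_vec_conjugate triplet_vec_carrier)
      finally show "inner (dfac (l2 h) z d - (fac (l2 h) z - (1, l2 p, l2 q))) (dfac (l2 h) z e) = 0"
        by (simp add: b_def)
    qed
  qed
qed

lemma gauss_newton_converges:
  assumes k: "k \<le> m" "k \<le> n" and pq: "degree p \<le> m" "degree q \<le> n"
    and z0: "z0 \<in> trips m n k" "norm (z0 - zs) \<le> \<rho>" and "\<gamma> > 0"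
    and basin: "gn_basin m n k (l2 h) (l2 p) (l2 q) \<gamma> \<rho> zs"
  obtains Z where "\<And>i. gauss_newton m n k p q (coeff_vec k h) (polys z0) i = Some (polys (Z i))"
    "\<And>i. Z i \<in> trips m n k" "Z \<longlonglongrightarrow> zs"
proof -
  have "\<exists>z. gauss_newton m n k p q (coeff_vec k h) (polys z0) i = Some (polys z) \<and>
      z \<in> trips m n k \<and> norm (z - zs) \<le> norm (z0 - zs) * (1 / 2) ^ i" for i
  proof (induction i)
    case 0
    then show ?case
      using z0 by (intro exI[of _ z0]) simp
  next
    case (Suc i)
    then obtain z where z: "gauss_newton m n k p q (coeff_vec k h) (polys z0) i = Some (polys z)"
      "z \<in> trips m n k" "norm (z - zs) \<le> norm (z0 - zs) * (1 / 2) ^ i"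
      by blast
    have "norm (z0 - zs) * (1 / 2) ^ i \<le> norm (z0 - zs) * 1"
      by (intro mult_left_mono power_le_one) auto
    then have near: "norm (z - zs) \<le> \<rho>"
      using z(3) z0(2) by simp
    have "\<And>d. d \<in> trips m n k \<Longrightarrow> \<gamma> * norm d \<le> norm (dfac (l2 h) z d)"
      using basin z(2) near unfolding gn_basin_def by blast
    then obtain d where d: "gn_direction m n k (l2 h) (l2 p) (l2 q) z d"
      "gn_step m n k p q (coeff_vec k h) (polys z) = Some (polys (z - d))"
      using gn_step_eq[OF z(2) k pq _ \<open>\<gamma> > 0\<close>] by blast
    then have d_in: "d \<in> trips m n k"
      by (simp add: gn_direction_def)
    have "norm (z - d - zs) \<le> norm (z - zs) / 2"
      using basin z(2) near d(1) unfolding gn_basin_def by blast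
    then have "norm (z - d - zs) \<le> norm (z0 - zs) * (1 / 2) ^ Suc i"
      using z(3) by simp
    then show ?case
      using z(1,2) d_in d(2) by (intro exI[of _ "z - d"]) auto
  qed
  then obtain Z where Z: "\<And>i. gauss_newton m n k p q (coeff_vec k h) (polys z0) i = Some (polys (Z i))"
    "\<And>i. Z i \<in> trips m n k" "\<And>i. norm (Z i - zs) \<le> norm (z0 - zs) * (1 / 2) ^ i"
    by metis
  have "(\<lambda>i. norm (z0 - zs) * (1 / 2) ^ i) \<longlonglongrightarrow> norm (z0 - zs) * 0"
    by (intro tendsto_mult_left LIMSEQ_power_zero) simp
  then have lim: "(\<lambda>i. norm (z0 - zs) * (1 / 2) ^ i) \<longlonglongrightarrow> 0"
    by simp
  have "(\<lambda>i. Z i - zs) \<longlonglongrightarrow> 0"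
    by (rule Lim_null_comparison[OF always_eventually lim]) (use Z(3) in blast)
  then have "Z \<longlonglongrightarrow> zs"
    by (simp add: LIM_zero_iff)
  with Z(1,2) show thesis
    by (rule that)
qed

lemma gauss_newton_in_trips:
  assumes "gauss_newton m n k p q h t i = Some t'" "t = polys z" "z \<in> trips m n k"
  obtains z' where "t' = polys z'" "z' \<in> trips m n k"
proof (cases i)
  case 0
  then show thesis
    using assms that[of z] by simp
next
  case (Suc j)
  then obtain x where "t' = vec_triplet m n k x"
    using assms(1) by (auto simp: gn_step_def bind_eq_Some_conv split: if_splits)
  then show thesis
    by (intro that[of "(case t' of (u, v, w) \<Rightarrow> (l2 u, l2 v, l2 w))"])
      (auto simp: vec_triplet_def polys_def trips_def intro!: degree_vec_poly)
qed

section \<open>The starting point of the iteration\<close>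

lemma sylvester_carrier:
  assumes "k \<le> m" "k \<le> n"
  shows "sylvester m n k p q \<in> carrier_mat (m + n - k + 1) ((n - k) + (m - k) + 1 + 1)"
proof -
  have "conv_mat m (n - k) p \<in> carrier_mat (m + n - k + 1) (n - k + 1)"
    "conv_mat n (m - k) q \<in> carrier_mat (m + n - k + 1) (m - k + 1)"
    using conv_mat_carrier(1)[of m "n - k" p] conv_mat_carrier(1)[of n "m - k" q] assms by (simp_all add: add.commute)
  then have "sylvester m n k p q \<in> carrier_mat (m + n - k + 1) ((n - k + 1) + (m - k + 1))"
    unfolding sylvester_def by (rule append_cols_carrier)
  then show ?thesis
    by simp
qed

lemma sylvester_mult:
  assumes "degree v \<le> m - k" "degree w \<le> n - k" "k \<le> m" "k \<le> n"
  shows "sylvester m n k p q *\<^sub>v (coeff_vec (n - k) w @\<^sub>v - coeff_vec (m - k) v) = coeff_vec (m + n - k) (p * w - q * v)"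
proof -
  have C: "conv_mat m (n - k) p \<in> carrier_mat (m + n - k + 1) (n - k + 1)"
    "conv_mat n (m - k) q \<in> carrier_mat (m + n - k + 1) (m - k + 1)"
    using conv_mat_carrier(1)[of m "n - k" p] conv_mat_carrier(1)[of n "m - k" q] assms by (simp_all add: add.commute)
  have neg: "- coeff_vec (m - k) v = coeff_vec (m - k) (- v)"
    by (auto intro!: eq_vecI simp: coeff_vec_def)
  have "sylvester m n k p q *\<^sub>v (coeff_vec (n - k) w @\<^sub>v - coeff_vec (m - k) v) =
      conv_mat m (n - k) p *\<^sub>v coeff_vec (n - k) w + conv_mat n (m - k) q *\<^sub>v coeff_vec (m - k) (- v)"
    unfolding sylvester_def neg by (intro append_cols_mult[OF C]) simp_all
  also have "\<dots> = coeff_vec (m + n - k) (p * w) + coeff_vec (m + n - k) (q * (- v))"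
  proof -
    have "m + n - k = m + (n - k)" "m + n - k = n + (m - k)"
      using assms by simp_all
    then show ?thesis
      using conv_mat_mult[of w "n - k" "m + n - k" m p] conv_mat_mult[of "- v" "m - k" "m + n - k" n q] assms(1,2)
      by (simp only: degree_minus)
  qed
  finally show ?thesis
    by (simp flip: coeff_vec_add)
qed

lemma euclid_norm_cofactor_vec:
  assumes "degree v \<le> m - k" "degree w \<le> n - k"
  shows "euclid_norm (coeff_vec (n - k) w @\<^sub>v - coeff_vec (m - k) v) = norm (l2 v, l2 w)"
  using assms by (simp add: euclid_norm_append euclid_norm_uminus euclid_norm_coeff_vec norm_Pair add.commute)

lemma cofactor_vec_surj:
  assumes "x \<in> carrier_vec ((n - k) + (m - k) + 1 + 1)"
  obtains v w where "degree v \<le> m - k" "degree w \<le> n - k"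
    "x = coeff_vec (n - k) w @\<^sub>v - coeff_vec (m - k) v"
proof -
  define a where "a = vec_first x (n - k + 1)"
  define b where "b = vec_last x (m - k + 1)"
  have x: "x = a @\<^sub>v b"
    unfolding a_def b_def using assms by (subst vec_first_last_append) auto
  have carr: "a \<in> carrier_vec (n - k + 1)" "- b \<in> carrier_vec (m - k + 1)"
    unfolding a_def b_def by simp_all
  show thesis
    using carr x by (intro that[of "vec_poly (- b)" "vec_poly a"])
      (simp_all add: degree_vec_poly coeff_vec_vec_poly)
qed

lemma sylvester_mult_norm:
  assumes "degree v \<le> m - k" "degree w \<le> n - k" "k \<le> m" "k \<le> n" "degree p \<le> m" "degree q \<le> n"
  shows "euclid_norm (sylvester m n k p q *\<^sub>v (coeff_vec (n - k) w @\<^sub>v - coeff_vec (m - k) v))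
    = norm (l2 p * l2 w - l2 q * l2 v)"
proof -
  have "degree (p * w - q * v) \<le> m + n - k"
    using assms by (intro degree_diff_le order_trans[OF degree_mult_le]) auto
  then show ?thesis
    using assms by (simp add: sylvester_mult euclid_norm_coeff_vec l2_simps)
qed

lemma sigma_min_sylvester_le:
  assumes "degree v \<le> m - k" "degree w \<le> n - k" "k \<le> m" "k \<le> n" "degree p \<le> m" "degree q \<le> n"
    "norm (l2 v, l2 w) = 1"
  shows "sigma_min (sylvester m n k p q) \<le> norm (l2 p * l2 w - l2 q * l2 v)"
proof -
  let ?x = "coeff_vec (n - k) w @\<^sub>v - coeff_vec (m - k) v"
  have "?x \<in> carrier_vec ((n - k + 1) + (m - k + 1))"
    by (intro append_carrier_vec) simp_all
  then have x: "?x \<in> carrier_vec ((n - k) + (m - k) + 1 + 1)"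
    by simp
  show ?thesis
    using sigma_min_properties(3)[OF sylvester_carrier[OF assms(3,4)] x, of p q]
    by (simp add: euclid_norm_cofactor_vec sylvester_mult_norm assms)
qed

lemma least_squares_solution_iff:
  assumes "degree u \<le> k" "k \<le> m" "k \<le> n" "degree v \<le> m - k" "degree w \<le> n - k" "degree p \<le> m" "degree q \<le> n"
  shows "least_squares_solution (conv_mat (m - k) k v @\<^sub>r conv_mat (n - k) k w)
      (coeff_vec m p @\<^sub>v coeff_vec n q) (coeff_vec k u) \<longleftrightarrow>
    (\<forall>u'\<in>deg_le k. norm (l2 u * l2 v - l2 p, l2 u * l2 w - l2 q) \<le> norm (u' * l2 v - l2 p, u' * l2 w - l2 q))"
proof -
  let ?M = "conv_mat (m - k) k v @\<^sub>r conv_mat (n - k) k w"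
  let ?b = "coeff_vec m p @\<^sub>v coeff_vec n q"
  have C: "conv_mat (m - k) k v \<in> carrier_mat (m + 1) (k + 1)" "conv_mat (n - k) k w \<in> carrier_mat (n + 1) (k + 1)"
    using conv_mat_carrier(1)[of "m - k" k v] conv_mat_carrier(1)[of "n - k" k w] assms by simp_all
  have M: "?M \<in> carrier_mat ((m + 1) + (n + 1)) (k + 1)"
    using C by (rule carrier_append_rows)
  have norm_eq: "euclid_norm (?M *\<^sub>v coeff_vec k f - ?b) = norm (l2 f * l2 v - l2 p, l2 f * l2 w - l2 q)"
    if f: "degree f \<le> k" for f
  proof -
    have deg: "degree (v * f - p) \<le> m" "degree (w * f - q) \<le> n"
      using assms f by (auto intro!: degree_diff_le order_trans[OF degree_mult_le])
    have "?M *\<^sub>v coeff_vec k f - ?b = coeff_vec m (v * f - p) @\<^sub>v coeff_vec n (w * f - q)"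
      using mat_mult_append[OF C coeff_vec_carrier(1)] assms
        conv_mat_mult[OF f, of m "m - k" v] conv_mat_mult[OF f, of n "n - k" w]
      by (simp add: append_vec_diff coeff_vec_diff)
    then show ?thesis
      using deg by (simp add: euclid_norm_append euclid_norm_coeff_vec norm_Pair l2_simps mult.commute)
  qed
  show ?thesis
  proof
    assume ls: "least_squares_solution ?M ?b (coeff_vec k u)"
    show "\<forall>u'\<in>deg_le k. norm (l2 u * l2 v - l2 p, l2 u * l2 w - l2 q) \<le> norm (u' * l2 v - l2 p, u' * l2 w - l2 q)"
    proof
      fix u' assume "u' \<in> deg_le k"
      then have u': "degree (poly_of u') \<le> k"
        by (simp add: deg_le_def)
      have "coeff_vec k (poly_of u') \<in> carrier_vec (dim_col ?M)"
        unfolding carrier_matD(2)[OF M] by simp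
      then have "euclid_norm (?M *\<^sub>v coeff_vec k u - ?b) \<le> euclid_norm (?M *\<^sub>v coeff_vec k (poly_of u') - ?b)"
        using ls unfolding least_squares_solution_def by blast
      then show "norm (l2 u * l2 v - l2 p, l2 u * l2 w - l2 q) \<le> norm (u' * l2 v - l2 p, u' * l2 w - l2 q)"
        by (simp add: norm_eq assms(1) u')
    qed
  next
    assume best: "\<forall>u'\<in>deg_le k. norm (l2 u * l2 v - l2 p, l2 u * l2 w - l2 q) \<le> norm (u' * l2 v - l2 p, u' * l2 w - l2 q)"
    show "least_squares_solution ?M ?b (coeff_vec k u)"
      unfolding least_squares_solution_def carrier_matD(2)[OF M]
    proof (intro conjI ballI)
      fix y :: "complex Matrix.vec" assume y: "y \<in> carrier_vec (k + 1)"
      then have "l2 (vec_poly y) \<in> deg_le k"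
        by (simp add: degree_vec_poly)
      then show "euclid_norm (?M *\<^sub>v coeff_vec k u - ?b) \<le> euclid_norm (?M *\<^sub>v y - ?b)"
        using best norm_eq[OF assms(1)] norm_eq[OF degree_vec_poly[OF y]] y by (simp add: coeff_vec_vec_poly)
    qed simp
  qed
qed

lemma uvGCD_initialD:
  assumes "(u, v, w) \<in> uvGCD_initial m n k p q" "k \<le> m" "k \<le> n" "degree p \<le> m" "degree q \<le> n"
  shows "(l2 u, l2 v, l2 w) \<in> trips m n k" "norm (l2 v, l2 w) = 1"
    "norm (l2 p * l2 w - l2 q * l2 v) = sigma_min (sylvester m n k p q)"
    "\<And>u'. u' \<in> deg_le k \<Longrightarrow>
      norm (l2 u * l2 v - l2 p, l2 u * l2 w - l2 q) \<le> norm (u' * l2 v - l2 p, u' * l2 w - l2 q)"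
proof -
  have deg: "degree u \<le> k" "degree v \<le> m - k" "degree w \<le> n - k"
    and sv: "min_right_singular_vector (sylvester m n k p q) (coeff_vec (n - k) w @\<^sub>v - coeff_vec (m - k) v)"
    and ls: "least_squares_solution (conv_mat (m - k) k v @\<^sub>r conv_mat (n - k) k w)
       (coeff_vec m p @\<^sub>v coeff_vec n q) (coeff_vec k u)"
    using assms(1) by (auto simp: uvGCD_initial_def)
  show "(l2 u, l2 v, l2 w) \<in> trips m n k"
    using deg by (simp add: trips_def)
  show "norm (l2 v, l2 w) = 1"
    using sv euclid_norm_cofactor_vec[OF deg(2,3)] by (simp add: min_right_singular_vector_def)
  show "norm (l2 p * l2 w - l2 q * l2 v) = sigma_min (sylvester m n k p q)"
    using sigma_min_properties(2)[OF sylvester_carrier sv] sylvester_mult_norm[OF deg(2,3)] assms by simp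
  show "norm (l2 u * l2 v - l2 p, l2 u * l2 w - l2 q) \<le> norm (u' * l2 v - l2 p, u' * l2 w - l2 q)"
    if "u' \<in> deg_le k" for u'
    using ls least_squares_solution_iff[OF deg(1) assms(2,3) deg(2,3) assms(4,5)] that by blast
qed

lemma uvGCD_initial_nonempty:
  assumes "k \<le> m" "k \<le> n" "degree p \<le> m" "degree q \<le> n"
  shows "uvGCD_initial m n k p q \<noteq> {}"
proof -
  have S: "sylvester m n k p q \<in> carrier_mat (m + n - k + 1) ((n - k) + (m - k) + 1 + 1)"
    by (rule sylvester_carrier[OF assms(1,2)])
  obtain x where x: "min_right_singular_vector (sylvester m n k p q) x"
    using sigma_min_properties(1)[OF S] by blast
  then have "x \<in> carrier_vec ((n - k) + (m - k) + 1 + 1)"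
    using carrier_matD(2)[OF S] by (simp add: min_right_singular_vector_def)
  then obtain v w where vw: "degree v \<le> m - k" "degree w \<le> n - k"
    and x_eq: "x = coeff_vec (n - k) w @\<^sub>v - coeff_vec (m - k) v"
    by (rule cofactor_vec_surj)
  have "norm (l2 v, l2 w) = 1"
    using x euclid_norm_cofactor_vec[OF vw] by (simp add: min_right_singular_vector_def x_eq)
  then have "(l2 v, l2 w) \<noteq> 0"
    by auto
  then obtain u where u: "u \<in> deg_le k"
    "\<And>u'. u' \<in> deg_le k \<Longrightarrow> norm (u * l2 v - l2 p, u * l2 w - l2 q) \<le> norm (u' * l2 v - l2 p, u' * l2 w - l2 q)"
    using ex_best_cofactor[of "l2 v" m k "l2 w" n "l2 p" "l2 q"] vw by auto
  then have "(poly_of u, v, w) \<in> uvGCD_initial m n k p q"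
    using vw x least_squares_solution_iff[of "poly_of u" k m n v w p q] assms
    by (simp add: uvGCD_initial_def x_eq deg_le_def)
  then show ?thesis
    by blast
qed

context reference_factorization
begin

text \<open>The cofactors of the exact pair are in the kernel of its Sylvester matrix; at this unit vector
  only the perturbation of the pair contributes. The assumption \<open>n \<le> m\<close> makes
  \<open>m - k + 1\<close> the larger of the two block widths.\<close>

lemma sigma_min_sylvester_perturbed_le:
  assumes "n \<le> m" "degree p \<le> m" "degree q \<le> n"
  shows "sigma_min (sylvester m n k p q)
    \<le> sqrt (real (m - k + 1)) * norm (l2 p - l2 (uh * vh), l2 q - l2 (uh * wh))"
proof -
  define v w where "v = smult (1 / of_real Nh) vh" and "w = smult (1 / of_real Nh) wh"
  define dp dq where "dp = l2 p - l2 (uh * vh)" and "dq = l2 q - l2 (uh * wh)"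
  let ?S = "sqrt (real (m - k + 1))"
  have deg: "degree v \<le> m - k" "degree w \<le> n - k"
    using degrees by (simp_all add: v_def w_def)
  have "(l2 v, l2 w) = scaleR (1 / Nh) (l2 vh, l2 wh)"
    by (simp add: v_def w_def l2_simps scaleR_l2_poly_def)
  then have "norm (l2 v, l2 w) = \<bar>1 / Nh\<bar> * Nh"
    by (simp only: norm_scaleR Nh_def)
  then have unit_vw: "norm (l2 v, l2 w) = 1"
    using Nh_pos by simp
  have "l2 p * l2 w - l2 q * l2 v = l2 w * dp - l2 v * dq"
    by (simp add: dp_def dq_def l2_simps v_def w_def smul_simps algebra_simps)
  then have "sigma_min (sylvester m n k p q) \<le> norm (l2 w * dp - l2 v * dq)"
    using sigma_min_sylvester_le[OF deg degrees(4,5) assms(2,3) unit_vw] by simp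
  also have "\<dots> \<le> norm (l2 w * dp) + norm (l2 v * dq)"
    by (rule norm_triangle_ineq4)
  also have "\<dots> \<le> ?S * norm (l2 w) * norm dp + ?S * norm (l2 v) * norm dq"
  proof (rule add_mono)
    have "norm (l2 w * dp) \<le> sqrt (real (n - k + 1)) * norm (l2 w) * norm dp"
      using deg by (intro norm_mult_le) simp
    also have "\<dots> \<le> ?S * norm (l2 w) * norm dp"
      using assms(1) by (intro mult_right_mono) auto
    finally show "norm (l2 w * dp) \<le> ?S * norm (l2 w) * norm dp" .
    show "norm (l2 v * dq) \<le> ?S * norm (l2 v) * norm dq"
      using deg by (intro norm_mult_le) simp
  qed
  also have "\<dots> = ?S * inner (norm (l2 v), norm (l2 w)) (norm dq, norm dp)"
    by (simp add: inner_prod_def algebra_simps)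
  also have "\<dots> \<le> ?S * (norm (norm (l2 v), norm (l2 w)) * norm (norm dq, norm dp))"
    by (intro mult_left_mono norm_cauchy_schwarz) simp
  also have "norm (norm (l2 v), norm (l2 w)) = 1"
    using unit_vw by (simp add: norm_prod_def)
  also have "norm (norm dq, norm dp) = norm (dp, dq)"
    by (simp add: norm_prod_def add.commute)
  finally show ?thesis
    by (simp add: dp_def dq_def)
qed

end

section \<open>Numerical GCDs near an exact pair\<close>

lemma theta_perturbed_greater:
  assumes "pair_norm (p - ph) (q - qh) < \<eta>" "ereal \<epsilon> < theta m n (k + 1) ph qh - ereal \<eta>" "j > k"
  shows "ereal \<epsilon> < theta m n j p q"
proof -
  have "theta m n (k + 1) ph qh \<le> theta m n j ph qh"
    using assms(3) by (intro theta_mono) simp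
  also have "\<dots> \<le> ereal (pair_norm (ph - p) (qh - q)) + theta m n j p q"
    by (rule theta_triangle)
  also have "\<dots> \<le> ereal \<eta> + theta m n j p q"
    using assms(1) pair_norm_commute[of p ph q qh] by (intro add_right_mono) simp
  finally show ?thesis
    using assms(2) by (cases "theta m n (k + 1) ph qh"; cases "theta m n j p q") auto
qed

lemma degree_perturbed:
  assumes "degree f \<le> degree g" "norm (l2 f - l2 g) < cmod (lead_coeff g)"
  shows "degree f = degree g" "f \<noteq> 0"
proof -
  have "cmod (coeff f (degree g) - lead_coeff g) < cmod (lead_coeff g)"
    using norm_coeff_le[of "l2 f - l2 g" "degree g"] assms(2) by simp
  then have "coeff f (degree g) \<noteq> 0"
    by auto
  then show "degree f = degree g" "f \<noteq> 0"
    using assms(1) le_degree by (auto intro: antisym)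
qed

text \<open>The best approximation by products over the whole vector space of triplets attains the
  distance. It has the right degrees by assumption \<open>nearby\<close>, and its GCD cannot have a degree above
  \<open>k\<close>, since the distance to pairs with such a GCD exceeds \<open>\<epsilon>\<close>.\<close>

lemma ex_nearest_pair:
  assumes theta: "theta m n k p q < ereal \<epsilon>" "\<And>j. j > k \<Longrightarrow> ereal \<epsilon> < theta m n j p q"
    and k: "k \<le> m" "k \<le> n"
    and nearby: "\<And>r s. degree r \<le> m \<Longrightarrow> degree s \<le> n \<Longrightarrow> ereal (pair_norm (r - p) (s - q)) \<le> theta m n k p q \<Longrightarrow>
      (r, s) \<in> poly_pairs m n"
  obtains pt qt where "(pt, qt) \<in> num_gcd_pairs m n \<epsilon> p q" "(pt, qt) \<in> poly_pairs_gcd m n k"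
    "theta m n k p q = ereal (pair_norm (pt - p) (qt - q))"
proof -
  obtain u v w where uvw: "(u, v, w) \<in> trips m n k" "norm (v, w) = 1"
    and best: "\<And>u' v' w'. (u', v', w') \<in> trips m n k \<Longrightarrow>
      norm (u * v - l2 p, u * w - l2 q) \<le> norm (u' * v' - l2 p, u' * w' - l2 q)"
    using ex_best_factorization by metis
  define pt qt where "pt = poly_of (u * v)" and "qt = poly_of (u * w)"
  have deg: "degree (poly_of u) \<le> k" "degree (poly_of v) \<le> m - k" "degree (poly_of w) \<le> n - k"
    using uvw(1) by (simp_all add: trips_def deg_le_def)
  have pair: "pair_norm (pt - p) (qt - q) = norm (u * v - l2 p, u * w - l2 q)"
    by (simp add: pair_norm_eq_norm pt_def qt_def l2_simps(2) poly_of_inverse del: poly_of_simps)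
  have "theta m n k p q \<le> ereal (pair_norm (p - poly_of u * poly_of v) (q - poly_of u * poly_of w))"
    by (rule theta_le_factored[OF deg k])
  then have "theta m n k p q \<le> ereal (pair_norm (pt - p) (qt - q))"
    using pair_norm_commute[of p pt q qt] by (simp add: pt_def qt_def)
  moreover have "ereal (pair_norm (pt - p) (qt - q)) \<le> theta m n k p q"
    unfolding theta_def
  proof (rule INF_greatest, clarify)
    fix r s assume "(r, s) \<in> poly_pairs_gcd m n k"
    then obtain a b c where abc: "r = a * b" "s = a * c" "degree a = k" "degree b = m - k" "degree c = n - k"
      by (rule poly_pairs_gcdE)
    then have "(l2 a, l2 b, l2 c) \<in> trips m n k"
      by (simp add: trips_def)
    then have "pair_norm (pt - p) (qt - q) \<le> pair_norm (r - p) (s - q)"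
      unfolding pair using best[of "l2 a" "l2 b" "l2 c"] by (simp add: pair_norm_eq_norm abc l2_simps)
    then show "ereal (pair_norm (pt - p) (qt - q)) \<le> ereal (pair_norm (p - r) (q - s))"
      by (simp add: pair_norm_commute[of p])
  qed
  ultimately have eq: "theta m n k p q = ereal (pair_norm (pt - p) (qt - q))"
    by (rule antisym)
  have pairs: "(pt, qt) \<in> poly_pairs m n"
  proof (rule nearby)
    show "degree pt \<le> m" "degree qt \<le> n"
      using order_trans[OF degree_mult_le add_mono[OF deg(1,2)]]
        order_trans[OF degree_mult_le add_mono[OF deg(1,3)]] k by (simp_all add: pt_def qt_def)
  qed (simp add: eq)
  then obtain l where l: "(pt, qt) \<in> poly_pairs_gcd m n l" "\<And>d. d dvd pt \<Longrightarrow> d dvd qt \<Longrightarrow> degree d \<le> l"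
    using poly_pairs_imp_gcd by blast
  have "degree (poly_of u) + degree (poly_of v) = m"
    using pairs by (auto simp: poly_pairs_def pt_def degree_mult_eq)
  then have "degree (poly_of u) = k"
    using deg k by simp
  then have "k \<le> l"
    using l(2)[of "poly_of u"] by (simp add: pt_def qt_def)
  moreover have "theta m n l p q \<le> ereal (pair_norm (pt - p) (qt - q))"
    using theta_le_member[OF l(1), of p q] by (simp add: pair_norm_commute[of p])
  then have "theta m n l p q < ereal \<epsilon>"
    using theta(1)[unfolded eq] by (rule le_less_trans)
  then have "\<not> k < l"
    using theta(2)[of l] by (metis less_asym)
  ultimately have "l = k"
    by simp
  have "num_gcd_degree m n \<epsilon> p q = k"
    using theta by (intro num_gcd_degree_eqI) (auto intro: less_imp_le)
  then show thesis
    using l(1) eq \<open>l = k\<close> by (intro that[of pt qt]) (simp_all add: num_gcd_pairs_def)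
qed

text \<open>Any iterate consists of polynomials within the degree bounds, so its residual is at least the
  distance to the pairs whose GCD has degree \<open>j\<close>.\<close>

lemma not_accepted_above:
  assumes theta: "ereal \<epsilon> < theta m n j p q" and j: "0 < j" "j \<le> m" "j \<le> n"
    and pq: "degree p \<le> m" "degree q \<le> n"
  shows "\<not> uvGCD_accepts m n j p q \<epsilon>"
proof
  assume "uvGCD_accepts m n j p q \<epsilon>"
  then obtain r i where r: "r \<in> uvGCD_runs m n j p q" "r (Suc i) \<noteq> None"
    and res: "uvGCD_residual m n j p q r i < \<epsilon>"
    unfolding uvGCD_accepts_def by blast
  obtain u v w where uvw: "(u, v, w) \<in> uvGCD_initial m n j p q" "r = uvGCD_run_from m n j p q (u, v, w)"
    using r(1) j(1) by (auto simp: uvGCD_runs_def)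
  then have deg: "degree u \<le> j" "degree v \<le> m - j" "degree w \<le> n - j"
    by (auto simp: uvGCD_initial_def)
  define s where "s = complex_of_real (poly_norm u)"
  define u' where "u' = smult (1 / s) u"
  have "u \<noteq> 0"
    using r(2) uvw(2) by (auto simp: uvGCD_run_from_def)
  then have run: "r i = gauss_newton m n j p q (coeff_vec j u') (u', smult s v, smult s w) i" for i
    by (simp add: uvw(2) uvGCD_run_from_def Let_def s_def u'_def)
  have "r i \<noteq> None"
  proof
    assume "r i = None"
    then have "r (Suc i) = None"
      using run[of i] run[of "Suc i"] by simp
    with r(2) show False
      by simp
  qed
  then obtain t where t: "r i = Some t"
    by blast
  have "(u', smult s v, smult s w) = polys (l2 u', smul s (l2 v), smul s (l2 w))"
    by (simp add: polys_def)
  moreover have "(l2 u', smul s (l2 v), smul s (l2 w)) \<in> trips m n j"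
    using deg by (auto simp: trips_def u'_def)
  ultimately obtain z where z: "t = polys z" "z \<in> trips m n j"
    using gauss_newton_in_trips[of m n j p q _ _ i t] t run by metis
  obtain a b c where abc: "z = (a, b, c)" by (metis prod_cases3)
  have rhs: "(1, l2 p, l2 q) \<in> out_space m n"
    using pq by (simp add: out_space_def)
  have "uvGCD_residual m n j p q r i = euclid_norm (out_vec m n (fac (l2 u') z - (1, l2 p, l2 q)))"
    using run[of 0] t z gn_fun_eq[OF z(2) j(2,3)] by (simp add: uvGCD_residual_def gn_rhs_eq out_vec_diff)
  also have "\<dots> = norm (fac (l2 u') z - (1, l2 p, l2 q))"
    by (rule euclid_norm_out_vec[OF out_space_diff[OF fac_in_out_space[OF z(2) j(2,3)] rhs]])
  finally have "norm (a * b - l2 p, a * c - l2 q) < \<epsilon>"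
    using res norm_snd_le[of "(a * b - l2 p, a * c - l2 q)" "cinner a (l2 u') - 1"]
    by (simp add: fac_def abc)
  then have "pair_norm (p - poly_of a * poly_of b) (q - poly_of a * poly_of c) < \<epsilon>"
    unfolding pair_norm_commute[of p] by (simp add: pair_norm_eq_norm l2_simps)
  moreover have "theta m n j p q \<le> ereal (pair_norm (p - poly_of a * poly_of b) (q - poly_of a * poly_of c))"
    using z(2) by (intro theta_le_factored j) (simp_all add: abc trips_def deg_le_def)
  ultimately have "theta m n j p q < ereal \<epsilon>"
    by (simp add: le_less_trans)
  with theta show False
    by (metis less_asym)
qed

definition run_converges :: "(nat \<Rightarrow> triplet option) \<Rightarrow> complex poly \<Rightarrow> complex poly \<Rightarrow> bool" where
  "run_converges r pt qt \<longleftrightarrow> (\<exists>U V W u.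
     (\<forall>j. r j = Some (U j, V j, W j)) \<and>
     u \<in> poly_gcds pt qt \<and>
     (\<lambda>j. poly_norm (U j - u)) \<longlonglongrightarrow> 0 \<and>
     (\<lambda>j. pair_norm (U j * V j - pt) (U j * W j - qt)) \<longlonglongrightarrow> 0)"

lemma run_convergesI:
  assumes r: "\<And>i. r i = Some (polys (Z i))" and Z: "\<And>i. Z i \<in> trips m n k" "Z \<longlonglongrightarrow> (us, vs, ws)"
    and zs: "(us, vs, ws) \<in> trips m n k" "us * vs = l2 pt" "us * ws = l2 qt"
    and pt: "(pt, qt) \<in> poly_pairs_gcd m n k" and "k \<le> m"
  shows "run_converges r pt qt"
proof -
  define U V W where "U = (\<lambda>i. poly_of (fst (Z i)))" and "V = (\<lambda>i. poly_of (fst (snd (Z i))))"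
    and "W = (\<lambda>i. poly_of (snd (snd (Z i))))"
  have "r i = Some (U i, V i, W i)" for i
    by (simp add: r polys_def U_def V_def W_def split_beta)
  moreover have "poly_of us \<in> poly_gcds pt qt"
  proof -
    have prod: "pt = poly_of us * poly_of vs" "qt = poly_of us * poly_of ws"
      using arg_cong[OF zs(2), of poly_of] arg_cong[OF zs(3), of poly_of] by simp_all
    have "degree pt = m" "pt \<noteq> 0"
      using pt by (auto simp: poly_pairs_gcd_def poly_pairs_def)
    then have "degree (poly_of us) + degree (poly_of vs) = m"
      by (auto simp: prod degree_mult_eq)
    moreover have "degree (poly_of us) \<le> k" "degree (poly_of vs) \<le> m - k"
      using zs(1) by (simp_all add: trips_def deg_le_def)
    ultimately have "degree (poly_of us) = k"
      using \<open>k \<le> m\<close> by linarith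
    moreover have "\<exists>g. g \<in> poly_gcds pt qt \<and> degree g = k"
      using pt by (auto simp: poly_pairs_gcd_def)
    ultimately show ?thesis
      by (auto simp: poly_gcds_def prod)
  qed
  moreover have "(\<lambda>i. poly_norm (U i - poly_of us)) \<longlonglongrightarrow> 0"
  proof -
    have "(\<lambda>i. norm (fst (Z i) - us)) \<longlonglongrightarrow> norm (us - us)"
      using tendsto_fst[OF Z(2)] by (intro tendsto_intros) simp
    then show ?thesis
      by (simp add: poly_norm_eq_norm U_def l2_simps)
  qed
  moreover have "(\<lambda>i. pair_norm (U i * V i - pt) (U i * W i - qt)) \<longlonglongrightarrow> 0"
  proof -
    have lims: "(\<lambda>i. fst (Z i)) \<longlonglongrightarrow> us" "(\<lambda>i. fst (snd (Z i))) \<longlonglongrightarrow> vs" "(\<lambda>i. snd (snd (Z i))) \<longlonglongrightarrow> ws"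
      using tendsto_fst[OF Z(2)] tendsto_fst[OF tendsto_snd[OF Z(2)]] tendsto_snd[OF tendsto_snd[OF Z(2)]]
      by simp_all
    have deg: "fst (Z i) \<in> deg_le k" "us \<in> deg_le k" for i
      using Z(1)[of i] zs(1) by (auto simp: trips_def)
    have "(\<lambda>i. fst (Z i) * fst (snd (Z i))) \<longlonglongrightarrow> us * vs" "(\<lambda>i. fst (Z i) * snd (snd (Z i))) \<longlonglongrightarrow> us * ws"
      using deg by (auto intro!: tendsto_mult_deg_le[where l = k] lims)
    then have "(\<lambda>i. norm (fst (Z i) * fst (snd (Z i)) - l2 pt, fst (Z i) * snd (snd (Z i)) - l2 qt))
        \<longlonglongrightarrow> norm (us * vs - l2 pt, us * ws - l2 qt)"
      by (intro tendsto_intros)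
    then show ?thesis
      by (simp add: pair_norm_eq_norm U_def V_def W_def l2_simps zs norm_prod_def)
  qed
  ultimately show ?thesis
    unfolding run_converges_def by blast
qed

context reference_factorization
begin

abbreviation "ph \<equiv> uh * vh"
abbreviation "qh \<equiv> uh * wh"

lemma lead_coeffs_pos: "cmod (lead_coeff ph) > 0" "cmod (lead_coeff qh) > 0"
  using uh_nonzero cofactors by simp_all

lemma degree_products: "degree ph = m" "degree qh = n"
  using uh_nonzero cofactors degrees by (simp_all add: degree_mult_eq)

text \<open>Every nearest pair has an exact factorization close to the reference up to phase, by
  \<open>initial_triplet_near\<close>. Aligned with a starting point it becomes a critical point with a basin,
  by \<open>gauss_newton_local\<close>. With the reference as the starting point this gives uniqueness, since a basin
  contains only one critical point; with the initial triplet of a run it gives convergence.\<close>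

lemma uvGCD_regular:
  assumes "n \<le> m" "\<delta> > 0"
  shows "\<exists>\<eta>::real. \<eta> > 0 \<and>
    (\<forall>p q (\<epsilon>::real). (p, q) \<in> poly_pairs m n \<and> \<epsilon> > 0 \<and>
       pair_norm (p - ph) (q - qh) < \<eta> \<and> \<eta> < \<epsilon> \<and>
       ereal \<epsilon> < theta m n (k + 1) ph qh - ereal \<eta> \<longrightarrow>
       (\<exists>pt qt.
          (pt, qt) \<in> num_gcd_pairs m n \<epsilon> p q \<and>
          num_gcd_classes m n \<epsilon> p q = {poly_gcds pt qt} \<and>
          (pt, qt) \<in> poly_pairs_gcd m n k \<and>
          pair_norm (pt - ph) (qt - qh) < \<delta> \<and>
          uvGCD_reaches m n k p q \<epsilon> \<and>
          uvGCD_runs m n k p q \<noteq> {} \<and>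
          (\<forall>r\<in>uvGCD_runs m n k p q. run_converges r pt qt)))"
proof -
  obtain \<kappa> \<eta>1 \<rho> \<gamma> where pos: "\<kappa> > 0" "\<eta>1 > 0" "\<gamma> > 0"
    and local: "\<And>p q z0 \<alpha> u1 v1 w1 \<beta>. z0 \<in> trips m n k \<Longrightarrow> norm (fst z0) = 1 \<Longrightarrow>
      norm (rot \<alpha> z0 - zh) < \<kappa> \<Longrightarrow> cmod \<alpha> = 1 \<Longrightarrow>
      (u1, v1, w1) \<in> trips m n k \<Longrightarrow> norm (rot \<beta> (u1, v1, w1) - zh) < \<kappa> \<Longrightarrow> cmod \<beta> = 1 \<Longrightarrow>
      (\<And>u v w. (u, v, w) \<in> trips m n k \<Longrightarrow>
        norm (u1 * v1 - p, u1 * w1 - q) \<le> norm (u * v - p, u * w - q)) \<Longrightarrow>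
      norm (u1 * v1 - p, u1 * w1 - q) < \<eta>1 \<Longrightarrow>
      \<exists>u v w. (u, v, w) \<in> trips m n k \<and> u * v = u1 * v1 \<and> u * w = u1 * w1 \<and>
        norm (z0 - (u, v, w)) \<le> \<rho> / 2 \<and> gn_direction m n k (fst z0) p q (u, v, w) 0 \<and>
        gn_basin m n k (fst z0) p q \<gamma> \<rho> (u, v, w)"
    using gauss_newton_local by metis
  obtain \<eta>2 where \<eta>2: "\<eta>2 > 0" and initial:
    "\<And>p q u v w. norm (p - l2 ph, q - l2 qh) < \<eta>2 \<Longrightarrow> (u, v, w) \<in> trips m n k \<Longrightarrow>
      norm (v, w) = 1 \<Longrightarrow> norm (p * w - q * v) < \<eta>2 \<Longrightarrow>
      (\<And>u'. u' \<in> deg_le k \<Longrightarrow> norm (u * v - p, u * w - q) \<le> norm (u' * v - p, u' * w - q)) \<Longrightarrow>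
      u \<noteq> 0 \<and> (\<exists>\<alpha>. cmod \<alpha> = 1 \<and> norm (rot \<alpha> (normalize_trip (u, v, w)) - zh) < \<kappa>)"
    using initial_triplet_near[OF pos(1)] by metis
  let ?S = "sqrt (real (m - k + 1))"
  have S: "?S \<ge> 1"
    by simp
  \<comment> \<open>A nearest pair is within \<open>2 \<eta>\<close> of the exact one: \<open>\<eta>\<close> away from \<open>(p, q)\<close>, and \<open>\<eta>\<close> further on.
    Below half of the leading coefficients the degrees \<open>m\<close> and \<open>n\<close> persist.\<close>
  define \<eta> where "\<eta> = Min {\<delta> / 2, \<eta>1, \<eta>2 / (2 * ?S), cmod (lead_coeff ph) / 2, cmod (lead_coeff qh) / 2}"
  have \<eta>_pos: "\<eta> > 0"
    using assms(2) pos(2) \<eta>2 S lead_coeffs_pos by (simp add: \<eta>_def)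
  have \<eta>_le: "2 * \<eta> \<le> \<delta>" "\<eta> \<le> \<eta>1" "2 * \<eta> \<le> cmod (lead_coeff ph)" "2 * \<eta> \<le> cmod (lead_coeff qh)"
    by (simp_all add: \<eta>_def min_le_iff_disj)
  have "\<eta> \<le> \<eta>2 / (2 * ?S)"
    by (simp add: \<eta>_def min_le_iff_disj)
  then have "2 * (?S * \<eta>) \<le> \<eta>2"
    using S by (simp add: field_simps)
  moreover have "2 * \<eta> \<le> 2 * (?S * \<eta>)"
    using S \<eta>_pos by simp
  ultimately have \<eta>_le2: "2 * \<eta> \<le> \<eta>2" "?S * \<eta> \<le> \<eta>2"
    using \<eta>_pos by linarith+
  show ?thesis
  proof (intro exI[of _ \<eta>] conjI allI impI \<eta>_pos; elim conjE)
    fix p q and \<epsilon> :: real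
    assume pq: "(p, q) \<in> poly_pairs m n" and close: "pair_norm (p - ph) (q - qh) < \<eta>" and "\<eta> < \<epsilon>"
      and below: "ereal \<epsilon> < theta m n (k + 1) ph qh - ereal \<eta>"
    have deg_pq: "degree p \<le> m" "degree q \<le> n"
      using pq by (auto simp: poly_pairs_def)
    have above: "ereal \<epsilon> < theta m n j p q" if "j > k" for j
      using close below that by (rule theta_perturbed_greater)
    have ph_qh: "(ph, qh) \<in> poly_pairs_gcd m n k"
      using cofactors degrees uh_nonzero by (intro poly_pairs_gcdI) auto
    have theta_less: "theta m n k p q < ereal \<eta>"
      using theta_le_member[OF ph_qh, of p q] close by (simp add: le_less_trans)
    then have theta_less': "theta m n k p q < ereal \<epsilon>"
      using \<open>\<eta> < \<epsilon>\<close> by (meson ereal_less_eq(3) less_imp_le less_le_trans)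
    have near: "pair_norm (r - ph) (s - qh) < 2 * \<eta>"
      if "ereal (pair_norm (r - p) (s - q)) \<le> theta m n k p q" for r s
    proof -
      have "ereal (pair_norm (r - p) (s - q)) < ereal \<eta>"
        using that theta_less by (rule le_less_trans)
      then show ?thesis
        using pair_norm_triangle[of r ph s qh p q] close by simp
    qed
    have nearby: "(r, s) \<in> poly_pairs m n" if "degree r \<le> m" "degree s \<le> n"
      "ereal (pair_norm (r - p) (s - q)) \<le> theta m n k p q" for r s
    proof -
      have "norm (l2 r - l2 ph, l2 s - l2 qh) < 2 * \<eta>"
        using near[OF that(3)] by (simp add: pair_norm_eq_norm l2_simps)
      then have "norm (l2 r - l2 ph) < cmod (lead_coeff ph)" "norm (l2 s - l2 qh) < cmod (lead_coeff qh)"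
        using norm_fst_le[of "l2 r - l2 ph" "l2 s - l2 qh"] norm_snd_le[of "l2 s - l2 qh" "l2 r - l2 ph"] \<eta>_le
        by linarith+
      then show ?thesis
        using that degree_perturbed[of r ph] degree_perturbed[of s qh] degree_products
        by (simp add: poly_pairs_def)
    qed
    obtain pt qt where pt: "(pt, qt) \<in> num_gcd_pairs m n \<epsilon> p q" "(pt, qt) \<in> poly_pairs_gcd m n k"
      and theta_eq: "theta m n k p q = ereal (pair_norm (pt - p) (qt - q))"
      using ex_nearest_pair[OF theta_less' above degrees(4,5) nearby] by blast
    have degree_eq: "num_gcd_degree m n \<epsilon> p q = k"
      using theta_less' above by (intro num_gcd_degree_eqI) (auto intro: less_imp_le)
    have minimal: "norm (l2 r - l2 p, l2 s - l2 q) \<le> norm (u * v - l2 p, u * w - l2 q)"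
      if rs: "(r, s) \<in> num_gcd_pairs m n \<epsilon> p q" and t: "(u, v, w) \<in> trips m n k" for r s u v w
    proof -
      have "ereal (pair_norm (r - p) (s - q)) = theta m n k p q"
        using rs by (simp add: num_gcd_pairs_def degree_eq)
      also have "\<dots> \<le> ereal (pair_norm (p - poly_of u * poly_of v) (q - poly_of u * poly_of w))"
        using t by (intro theta_le_factored degrees) (simp_all add: trips_def deg_le_def)
      finally show ?thesis
        unfolding pair_norm_commute[of p] by (simp add: pair_norm_eq_norm l2_simps)
    qed
    have lift: "\<exists>\<beta> u v w. (u, v, w) \<in> trips m n k \<and> u * v = l2 r \<and> u * w = l2 s \<and>
        cmod \<beta> = 1 \<and> norm (rot \<beta> (u, v, w) - zh) < \<kappa>"
      if rs: "(r, s) \<in> num_gcd_pairs m n \<epsilon> p q" for r s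
    proof -
      have dist: "ereal (pair_norm (r - p) (s - q)) = theta m n k p q" and "(r, s) \<in> poly_pairs_gcd m n k"
        using rs by (simp_all add: num_gcd_pairs_def degree_eq)
      then obtain a b c where abc: "r = a * b" "s = a * c" "b \<noteq> 0"
        "degree a = k" "degree b = m - k" "degree c = n - k"
        by (elim poly_pairs_gcdE)
      \<comment> \<open>Rescale to unit cofactors, for which the least squares problem has residual 0.\<close>
      define N where "N = norm (l2 b, l2 c)"
      have N: "N > 0"
        using abc(3) unfolding N_def by (simp add: zero_prod_def flip: l2_simps(6))
      define u v w where "u = scaleR N (l2 a)" and "v = scaleR (1 / N) (l2 b)" and "w = scaleR (1 / N) (l2 c)"
      have t: "(u, v, w) \<in> trips m n k"
        using abc by (auto simp: trips_def u_def v_def w_def)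
      have prod: "u * v = l2 r" "u * w = l2 s"
        using N by (simp_all add: u_def v_def w_def abc l2_simps scaleR_l2_poly_def smul_simps flip: of_real_mult)
      have "(v, w) = scaleR (1 / N) (l2 b, l2 c)"
        by (simp add: v_def w_def)
      then have "norm (v, w) = \<bar>1 / N\<bar> * N"
        by (simp only: norm_scaleR N_def)
      then have "norm (v, w) = 1"
        using N by simp
      moreover have "norm (l2 r - l2 ph, l2 s - l2 qh) < \<eta>2"
        using near[of r s] dist \<eta>_le2(1) by (simp add: pair_norm_eq_norm l2_simps)
      moreover have "norm (l2 r * w - l2 s * v) < \<eta>2"
        using \<eta>2 by (simp add: mult_ac flip: prod)
      ultimately have u: "u \<noteq> 0" "\<exists>\<alpha>. cmod \<alpha> = 1 \<and> norm (rot \<alpha> (normalize_trip (u, v, w)) - zh) < \<kappa>"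
        using initial[of "l2 r" "l2 s" u v w] t by (simp_all add: prod)
      have "scaleR (1 / norm u) u * scaleR (norm u) v = l2 r" "scaleR (1 / norm u) u * scaleR (norm u) w = l2 s"
        using u(1) by (simp_all add: scaleR_l2_poly_def smul_simps prod flip: of_real_mult)
      moreover have "(scaleR (1 / norm u) u, scaleR (norm u) v, scaleR (norm u) w) \<in> trips m n k"
        using t by (auto simp: trips_def)
      ultimately show ?thesis
        using u(2) unfolding normalize_trip_def prod.case by blast
    qed
    have limit: "\<exists>u v w. (u, v, w) \<in> trips m n k \<and> u * v = l2 r \<and> u * w = l2 s \<and>
        norm (z0 - (u, v, w)) \<le> \<rho> / 2 \<and> gn_direction m n k (fst z0) (l2 p) (l2 q) (u, v, w) 0 \<and>
        gn_basin m n k (fst z0) (l2 p) (l2 q) \<gamma> \<rho> (u, v, w)"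
      if rs: "(r, s) \<in> num_gcd_pairs m n \<epsilon> p q" and z0: "z0 \<in> trips m n k" "norm (fst z0) = 1"
        "norm (rot \<alpha> z0 - zh) < \<kappa>" "cmod \<alpha> = 1" for r s z0 \<alpha>
    proof -
      obtain \<beta> u v w where uvw: "(u, v, w) \<in> trips m n k" "u * v = l2 r" "u * w = l2 s"
        "cmod \<beta> = 1" "norm (rot \<beta> (u, v, w) - zh) < \<kappa>"
        using lift[OF rs] by blast
      have "ereal (pair_norm (r - p) (s - q)) < ereal \<eta>"
        using rs theta_less by (simp add: num_gcd_pairs_def degree_eq)
      then have "norm (u * v - l2 p, u * w - l2 q) < \<eta>1"
        using \<eta>_le(2) by (simp add: uvw pair_norm_eq_norm l2_simps)
      from local[OF z0 uvw(1,5,4) _ this] show ?thesis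
        using minimal[OF rs] by (simp only: uvw(2,3))
    qed
    have "(r, s) = (pt, qt)" if rs: "(r, s) \<in> num_gcd_pairs m n \<epsilon> p q" for r s
    proof -
      have zh: "zh \<in> trips m n k" "norm (fst zh) = 1" "norm (rot 1 zh - zh) < \<kappa>" "cmod 1 = 1"
        using zh_in_trips pos(1) by (simp_all add: rot_simps zh_def unit)
      obtain u v w where a: "(u, v, w) \<in> trips m n k" "u * v = l2 pt" "u * w = l2 qt"
        "norm (zh - (u, v, w)) \<le> \<rho> / 2" "gn_basin m n k (fst zh) (l2 p) (l2 q) \<gamma> \<rho> (u, v, w)"
        using limit[OF pt(1) zh] by blast
      obtain u' v' w' where b: "(u', v', w') \<in> trips m n k" "u' * v' = l2 r" "u' * w' = l2 s"
        "norm (zh - (u', v', w')) \<le> \<rho> / 2" "gn_direction m n k (fst zh) (l2 p) (l2 q) (u', v', w') 0"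
        using limit[OF rs zh] by blast
      have "norm ((u', v', w') - (u, v, w)) \<le> \<rho>"
        using norm_triangle_ineq4[of "zh - (u, v, w)" "zh - (u', v', w')"] a(4) b(4) by simp
      then have "norm ((u', v', w') - 0 - (u, v, w)) \<le> norm ((u', v', w') - (u, v, w)) / 2"
        using a(5) b(1,5) unfolding gn_basin_def by blast
      then have "(u', v', w') = (u, v, w)"
        by (simp add: zero_prod_def)
      then show ?thesis
        using a(2,3) b(2,3) by simp
    qed
    then have "num_gcd_pairs m n \<epsilon> p q = {(pt, qt)}"
      using pt(1) by fast
    then have classes: "num_gcd_classes m n \<epsilon> p q = {poly_gcds pt qt}"
      by (simp add: num_gcd_classes_def)
    have "pair_norm (pt - ph) (qt - qh) < \<delta>"
      using near[of pt qt] theta_eq \<eta>_le(1) by simp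
    moreover have "uvGCD_reaches m n k p q \<epsilon>"
    proof -
      have "\<not> uvGCD_accepts m n j p q \<epsilon>" if "j \<in> {k<..n}" for j
        using that above[of j] assms(1) deg_pq by (intro not_accepted_above) auto
      moreover have "uvGCD_test m n k p q \<epsilon>"
      proof -
        have "sigma_min (sylvester m n k p q) \<le> ?S * norm (l2 p - l2 ph, l2 q - l2 qh)"
          by (rule sigma_min_sylvester_perturbed_le[OF assms(1) deg_pq])
        also have "\<dots> < ?S * \<epsilon>"
          using close \<open>\<eta> < \<epsilon>\<close> S by (intro mult_strict_left_mono) (simp_all add: pair_norm_eq_norm l2_simps)
        finally show ?thesis
          by (simp add: uvGCD_test_def mult.commute)
      qed
      ultimately show ?thesis
        by (simp add: uvGCD_reaches_def)
    qed
    moreover have "uvGCD_runs m n k p q \<noteq> {}"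
      using uvGCD_initial_nonempty[OF degrees(4,5) deg_pq] by (simp add: uvGCD_runs_def)
    moreover have "run_converges r pt qt"
      if r: "r \<in> uvGCD_runs m n k p q" for r
    proof (cases "k = 0")
      case True
      \<comment> \<open>For coprime \<open>(p, q)\<close> the nearest pair is \<open>(p, q)\<close> itself, and the constant run is exact.\<close>
      obtain l where l: "(p, q) \<in> poly_pairs_gcd m n l"
        using poly_pairs_imp_gcd[OF pq] by blast
      have "theta m n l p q \<le> 0"
        using theta_le_member[OF l, of p q] by (simp add: pair_norm_eq_norm l2_simps zero_ereal_def norm_prod_def)
      then have "theta m n l p q < ereal \<epsilon>"
        using \<eta>_pos \<open>\<eta> < \<epsilon>\<close> by (simp add: le_less_trans)
      then have "l = k"
        using above[of l] True by (metis gr0I less_asym)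
      then have "ereal (pair_norm (pt - p) (qt - q)) \<le> 0"
        using \<open>theta m n l p q \<le> 0\<close> theta_eq by simp
      then have "norm (l2 pt - l2 p, l2 qt - l2 q) = 0"
        by (simp add: pair_norm_eq_norm l2_simps)
      then have eq: "pt = p" "qt = q"
        by (simp_all add: zero_prod_def)
      have "1 \<in> poly_gcds pt qt"
        using pt(2) True by (auto simp: poly_pairs_gcd_def poly_gcds_def)
      moreover have "r j = Some (1, p, q)" for j
        using r True by (simp add: uvGCD_runs_def)
      ultimately show ?thesis
        unfolding run_converges_def
        by (intro exI[of _ "\<lambda>_. 1"] exI[of _ "\<lambda>_. p"] exI[of _ "\<lambda>_. q"] exI[of _ 1])
          (simp add: eq poly_norm_eq_norm pair_norm_eq_norm l2_simps norm_prod_def)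
    next
      case False
      then obtain u v w where init: "(u, v, w) \<in> uvGCD_initial m n k p q"
        and r_eq: "r = uvGCD_run_from m n k p q (u, v, w)"
        using r by (auto simp: uvGCD_runs_def)
      note init = uvGCD_initialD[OF init degrees(4,5) deg_pq]
      have close': "norm (l2 p - l2 ph, l2 q - l2 qh) < \<eta>"
        using close by (simp add: pair_norm_eq_norm l2_simps)
      have "sigma_min (sylvester m n k p q) \<le> ?S * norm (l2 p - l2 ph, l2 q - l2 qh)"
        by (rule sigma_min_sylvester_perturbed_le[OF assms(1) deg_pq])
      also have "\<dots> < ?S * \<eta>"
        using close' S by (intro mult_strict_left_mono) auto
      finally have "norm (l2 p * l2 w - l2 q * l2 v) < \<eta>2"
        using init(3) \<eta>_le2(2) by simp
      moreover have "norm (l2 p - l2 ph, l2 q - l2 qh) < \<eta>2"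
        using close' \<eta>_le2(1) \<eta>_pos by simp
      ultimately obtain \<alpha> where u0: "l2 u \<noteq> 0" and \<alpha>: "cmod \<alpha> = 1"
        "norm (rot \<alpha> (normalize_trip (l2 u, l2 v, l2 w)) - zh) < \<kappa>"
        using initial[OF _ init(1,2) _ init(4)] by blast
      define z0 where "z0 = normalize_trip (l2 u, l2 v, l2 w)"
      define u' where "u' = smult (1 / of_real (norm (l2 u))) u"
      have z0: "z0 \<in> trips m n k" "norm (fst z0) = 1" "fst z0 = l2 u'"
        using init(1) u0
        by (auto simp: z0_def normalize_trip_def trips_def u'_def l2_simps(5) scaleR_l2_poly_def norm_divide)
      have run: "r i = gauss_newton m n k p q (coeff_vec k u') (polys z0) i" for i
        using u0 by (simp add: r_eq uvGCD_run_from_def Let_def poly_norm_eq_norm u'_def z0_def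
            normalize_trip_def polys_def scaleR_l2_poly_def l2_simps(6)[symmetric] del: zero_l2_poly.rep_eq)
      obtain us vs ws where zs: "(us, vs, ws) \<in> trips m n k" "us * vs = l2 pt" "us * ws = l2 qt"
        "norm (z0 - (us, vs, ws)) \<le> \<rho> / 2"
        and basin: "gn_basin m n k (l2 u') (l2 p) (l2 q) \<gamma> \<rho> (us, vs, ws)"
        using limit[OF pt(1) z0(1,2) \<alpha>(2)[folded z0_def] \<alpha>(1)] unfolding z0(3) by blast
      have start: "norm (z0 - (us, vs, ws)) \<le> \<rho>"
        using zs(4) norm_ge_zero[of "z0 - (us, vs, ws)"] by linarith
      obtain Z where Z: "\<And>i. gauss_newton m n k p q (coeff_vec k u') (polys z0) i = Some (polys (Z i))"
        "\<And>i. Z i \<in> trips m n k" "Z \<longlonglongrightarrow> (us, vs, ws)"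
        using gauss_newton_converges[OF degrees(4,5) deg_pq z0(1) start pos(3) basin] by blast
      show ?thesis
        using run_convergesI[OF _ Z(2,3) zs(1-3) pt(2) degrees(4)] run Z(1) by simp
    qed
    ultimately show "\<exists>pt qt. (pt, qt) \<in> num_gcd_pairs m n \<epsilon> p q \<and>
          num_gcd_classes m n \<epsilon> p q = {poly_gcds pt qt} \<and>
          (pt, qt) \<in> poly_pairs_gcd m n k \<and>
          pair_norm (pt - ph) (qt - qh) < \<delta> \<and>
          uvGCD_reaches m n k p q \<epsilon> \<and>
          uvGCD_runs m n k p q \<noteq> {} \<and>
          (\<forall>r\<in>uvGCD_runs m n k p q. run_converges r pt qt)"
      using pt classes by blast
  qed
qed

end

theorem theorem10p1:
  fixes m n k :: nat and ph qh :: "complex poly"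
  assumes "m \<ge> n"
    and "(ph, qh) \<in> poly_pairs_gcd m n k"
  shows "\<forall>\<delta>::real. \<delta> > 0 \<longrightarrow> (\<exists>\<eta>::real. \<eta> > 0 \<and>
    (\<forall>(p::complex poly) (q::complex poly) (\<epsilon>::real).
       (p, q) \<in> poly_pairs m n \<and> \<epsilon> > 0 \<and>
       pair_norm (p - ph) (q - qh) < \<eta> \<and> \<eta> < \<epsilon> \<and>
       ereal \<epsilon> < theta m n (k + 1) ph qh - ereal \<eta> \<longrightarrow>
       (\<exists>pt qt.
          (pt, qt) \<in> num_gcd_pairs m n \<epsilon> p q \<and>
          num_gcd_classes m n \<epsilon> p q = {poly_gcds pt qt} \<and>
          (pt, qt) \<in> poly_pairs_gcd m n k \<and>
          pair_norm (pt - ph) (qt - qh) < \<delta> \<and>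
          uvGCD_reaches m n k p q \<epsilon> \<and>
          uvGCD_runs m n k p q \<noteq> {} \<and>
          (\<forall>r\<in>uvGCD_runs m n k p q. \<exists>U V W u.
             (\<forall>j. r j = Some (U j, V j, W j)) \<and>
             u \<in> poly_gcds pt qt \<and>
             (\<lambda>j. poly_norm (U j - u)) \<longlonglongrightarrow> 0 \<and>
             (\<lambda>j. pair_norm (U j * V j - pt) (U j * W j - qt)) \<longlonglongrightarrow> 0))))"
proof -
  obtain u v w where uvw: "ph = u * v" "qh = u * w" "coprime v w" "u \<noteq> 0" "v \<noteq> 0" "w \<noteq> 0"
    "degree u = k" "degree v = m - k" "degree w = n - k" "k \<le> m" "k \<le> n"
    using poly_pairs_gcdE[OF assms(2)] by metis
  define c where "c = complex_of_real (norm (l2 u))"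
  have c: "c \<noteq> 0"
    using uvw(4) by (simp add: c_def flip: l2_simps(6))
  interpret reference_factorization m n k "smult (1 / c) u" "smult c v" "smult c w"
  proof
    show "norm (l2 (smult (1 / c) u)) = 1"
      using c by (simp add: l2_simps norm_divide) (simp add: c_def)
    show "coprime (smult c v) (smult c w)"
      using c uvw(3) by (simp add: coprime_def smult_dvd_iff dvd_smult_iff)
  qed (use c uvw in auto)
  have eqs: "ph = smult (1 / c) u * smult c v" "qh = smult (1 / c) u * smult c w"
    using c by (simp_all add: uvw)
  show ?thesis
    unfolding eqs run_converges_def[symmetric] by (intro allI impI) (rule uvGCD_regular[OF assms(1)])
qed

end
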